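(* All locally nonequivalent structures $(M,[\lambda,\mu])$ of oriented congruences having vanishing twist, nonvanishing shear, with $T_1\equiv0$, $K_1\equiv0$ and $K_0\neq0$ (nowhere zero), are described by invariant forms $(\omega,\omega_1,\bar\omega_1)$ on $M$ ($\omega=f\lambda$ real, $\omega_1=h\mu$), obtained from the normalization $K_0=\varepsilon=\pm1$, which satisfy the system $$d\omega=0,\qquad d\omega_1=(iB-A)\,\omega_1\wedge\bar\omega_1+iT_0\,\omega_1\wedge\omega+\bar\omega_1\wedge\omega,$$ $$d\bar\omega_1=(iB+A)\,\omega_1\wedge\bar\omega_1+\omega_1\wedge\omega-iT_0\,\bar\omega_1\wedge\omega,$$ $$d\big[(A+iB)\omega_1+(A-iB)\bar\omega_1+\omega\big]=\varepsilon\, i\,\omega_1\wedge\bar\omega_1,$$ together with the integrability conditions $$dA=\big[A_1+\tfrac i2(B_1+\bar B_1+\varepsilon)\big]\omega_1+\big[A_1-\tfrac i2(B_1+\bar B_1+\varepsilon)\big]\bar\omega_1+(A-BT_0)\omega,$$ $$dB=B_1\omega_1+\bar B_1\bar\omega_1+(AT_0-B)\omega,\qquad dT_0\wedge\omega=0,$$ where $A,B,T_0$ (real) are the scalar invariants on $M$, and $A_1$ (real), $B_1$ (complex) are the scalar invariants of the next higher order. That is, up to local equivalence these structures are precisely the ones represented by $\lambda=\omega$, $\mu=\omega_1$ for coframes $(\omega,\omega_1,\bar\omega_1)$ satisfying this system.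
   Context: All objects are smooth. A structure of an oriented congruence $(M,[\lambda,\mu])$ on a 3-manifold $M$ is an equivalence class of pairs of 1-forms $(\lambda,\mu)$, $\lambda$ real, $\mu$ complex, with $\lambda\wedge\mu\wedge\bar\mu\neq 0$ everywhere, where $(\lambda,\mu)\sim(\lambda',\mu')$ iff $\lambda'=f\lambda$, $\mu'=h\mu$ for nonvanishing functions $f$ (real), $h$ (complex). Two structures are (locally) equivalent iff there is a (local) diffeomorphism $\varphi:M\to M'$ with $\varphi^*\lambda'=f\lambda$, $\varphi^*\mu'=h\mu$ for such $f,h$. For a representative write $d\lambda=ia\,\mu\wedge\bar\mu+b\,\mu\wedge\lambda+\bar b\,\bar\mu\wedge\lambda$, $d\mu=p\,\mu\wedge\bar\mu+q\,\mu\wedge\lambda+s\,\bar\mu\wedge\lambda$; $a$ is the twist, $s$ the shear. If $a\equiv0$ and $s\neq0$ everywhere, then on $P$, locally $M\times\mathbb{R}_+$ with fibre coordinate $\rho>0$, there are (uniquely, up to the discrete choices of the sign of $\omega$ and of the sign of $\omega_1$) 1-forms $\omega=\pm|s|\lambda$, $\omega_1=\rho e^{i\phi}\mu$ ($\phi$ a function on $M$), $\Omega$ (real), and functions $T_0,K_0$ (real), $T_1,K_1$ (complex) with $$d\omega=T_1\omega_1\wedge\omega+\bar T_1\bar\omega_1\wedge\omega,\qquad d\omega_1=\Omega\wedge\omega_1+(\omega_1+\bar\omega_1)\wedge\omega+iT_0\omega_1\wedge\omega,$$ $$d\Omega=iK_0\omega_1\wedge\bar\omega_1+K_1\omega_1\wedge\omega+\bar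 K_1\bar\omega_1\wedge\omega .$$ Here $\rho T_1$, $\rho^2K_0$, $\rho K_1$, $T_0$ are (pulled back from) functions on $M$. When $K_0$ is nowhere zero, requiring $K_0=\varepsilon=\mathrm{sign}(K_0)$ fixes $\rho$ and one pulls back all objects to $M$; then $\Omega=(A+iB)\omega_1+(A-iB)\bar\omega_1+\omega$. *)

theory Defs
  imports "HOL-Analysis.Analysis" "HOL-Library.Function_Algebras"
begin

section \<open>Smooth manifolds\<close>

text \<open>\<open>k\<close>-fold continuous differentiability on an open set, by induction on all directional
  derivatives.\<close>

primrec Ck_on :: "nat \<Rightarrow> 'e::euclidean_space set \<Rightarrow> ('e \<Rightarrow> 'v::real_normed_vector) \<Rightarrow> bool" where
  "Ck_on 0 S f \<longleftrightarrow> continuous_on S f"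
| "Ck_on (Suc k) S f \<longleftrightarrow> (\<forall>y\<in>S. f differentiable (at y)) \<and>
     (\<forall>v. Ck_on k S (\<lambda>y. frechet_derivative f (at y) v))"

definition smooth_on :: "'e::euclidean_space set \<Rightarrow> ('e \<Rightarrow> 'v::real_normed_vector) \<Rightarrow> bool" where
  "smooth_on S f \<longleftrightarrow> (\<forall>k. Ck_on k S f)"

text \<open>A chart is a pair of a domain and a coordinate map. Only the part of the domain that lies in
  the space \<open>mtop\<close> counts (\<open>chart_dom\<close>). In this way an open submanifold keeps the index set of
  charts of the ambient manifold, and forms, which are given by their components in
  the charts, restrict to it without change.\<close>

type_synonym ('a, 'e) chart = "'a set \<times> ('a \<Rightarrow> 'e)"

record ('a, 'e) mfd =
  mtop :: "'a topology"
  charts :: "('a, 'e) chart set"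

definition points :: "('a, 'e) mfd \<Rightarrow> 'a set" where
  "points M = topspace (mtop M)"

definition chart_dom :: "('a, 'e) mfd \<Rightarrow> ('a, 'e) chart \<Rightarrow> 'a set" where
  "chart_dom M c = fst c \<inter> points M"

definition chart_img :: "('a, 'e) mfd \<Rightarrow> ('a, 'e) chart \<Rightarrow> 'e set" where
  "chart_img M c = snd c ` chart_dom M c"

definition param :: "('a, 'e) mfd \<Rightarrow> ('a, 'e) chart \<Rightarrow> 'e \<Rightarrow> 'a" where
  "param M c = inv_into (chart_dom M c) (snd c)"

definition smooth_manifold :: "('a, 'e::euclidean_space) mfd \<Rightarrow> bool" where
  "smooth_manifold M \<longleftrightarrow>
     Hausdorff_space (mtop M) \<and> second_countable (mtop M) \<and>
     points M = (\<Union>c\<in>charts M. chart_dom M c) \<and>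
     (\<forall>c\<in>charts M. openin (mtop M) (chart_dom M c) \<and> open (chart_img M c) \<and>
        homeomorphic_map (subtopology (mtop M) (chart_dom M c)) (top_of_set (chart_img M c))
          (snd c)) \<and>
     (\<forall>c\<in>charts M. \<forall>c'\<in>charts M.
        smooth_on (snd c ` (chart_dom M c \<inter> chart_dom M c')) (snd c' \<circ> param M c))"

definition submfd :: "('a, 'e) mfd \<Rightarrow> 'a set \<Rightarrow> ('a, 'e) mfd"  (infixl "\<restriction>" 90) where
  "M \<restriction> U = M\<lparr>mtop := subtopology (mtop M) U\<rparr>"

text \<open>The product of \<open>M\<close> with the half-line of positive reals, with the product charts. The fibre
  coordinate (called \<open>\<rho>\<close> below) is \<open>snd\<close>.\<close>

definition half_line_bundle :: "('a, 'e) mfd \<Rightarrow> ('a \<times> real, 'e \<times> real) mfd" where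
  "half_line_bundle M =
     \<lparr>mtop = prod_topology (mtop M) (top_of_set {0<..}),
      charts = (\<lambda>c. (fst c \<times> {0<..}, map_prod (snd c) (\<lambda>\<rho>. \<rho>))) ` charts M\<rparr>"

definition smooth_fun ::
  "('a, 'e::euclidean_space) mfd \<Rightarrow> ('a \<Rightarrow> 'v::real_normed_vector) \<Rightarrow> bool" where
  "smooth_fun M f \<longleftrightarrow> (\<forall>c\<in>charts M. smooth_on (chart_img M c) (f \<circ> param M c))"

definition smooth_map ::
  "('a, 'e::euclidean_space) mfd \<Rightarrow> ('b, 'g::euclidean_space) mfd \<Rightarrow> ('a \<Rightarrow> 'b) \<Rightarrow> bool" where
  "smooth_map M N \<psi> \<longleftrightarrow> continuous_map (mtop M) (mtop N) \<psi> \<and>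
     (\<forall>c\<in>charts M. \<forall>c'\<in>charts N.
        smooth_on (snd c ` {x \<in> chart_dom M c. \<psi> x \<in> chart_dom N c'}) (snd c' \<circ> \<psi> \<circ> param M c))"

definition diffeomorphism ::
  "('a, 'e::euclidean_space) mfd \<Rightarrow> ('b, 'e) mfd \<Rightarrow> ('a \<Rightarrow> 'b) \<Rightarrow> bool" where
  "diffeomorphism M N \<psi> \<longleftrightarrow> bij_betw \<psi> (points M) (points N) \<and>
     smooth_map M N \<psi> \<and> smooth_map N M (inv_into (points M) \<psi>)"

section \<open>Complex-valued differential forms\<close>

text \<open>A tangent vector at \<open>x\<close> is an equivalence class of pairs of a chart \<open>c\<close> around \<open>x\<close> and a
  component vector, two such pairs being identified by the derivative of the change of charts.
  \<open>\<alpha> c x v\<close> is the value at \<open>x\<close> of the form \<open>\<alpha>\<close> on the tangent vector with components \<open>v\<close> in the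
  chart \<open>c\<close>; for forms of degree two or three \<open>v\<close> is a pair or a triple of vectors. Values are
  relevant only for charts \<open>c\<close> of the manifold and for \<open>x\<close> in the domain of \<open>c\<close>, hence the
  relation \<open>form_eq\<close>. Sums of forms are the pointwise sums of functions.\<close>

type_synonym ('a, 'e, 'v) form = "('a, 'e) chart \<Rightarrow> 'a \<Rightarrow> 'v \<Rightarrow> complex"

definition form_eq ::
  "('a, 'e, 'v) form \<Rightarrow> ('a, 'e) mfd \<Rightarrow> ('a, 'e, 'v) form \<Rightarrow> bool"
  ("(_ \<doteq>\<^bsub>_\<^esub>/ _)" [51, 0, 51] 50) where
  "\<alpha> \<doteq>\<^bsub>M\<^esub> \<beta> \<longleftrightarrow> (\<forall>c\<in>charts M. \<forall>x\<in>chart_dom M c. \<forall>v. \<alpha> c x v = \<beta> c x v)"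

definition one_form :: "('a, 'e::euclidean_space) mfd \<Rightarrow> ('a, 'e, 'e) form \<Rightarrow> bool" where
  "one_form M \<alpha> \<longleftrightarrow> (\<forall>c\<in>charts M.
     (\<forall>x\<in>chart_dom M c. linear (\<alpha> c x)) \<and>
     (\<forall>v. smooth_on (chart_img M c) (\<lambda>y. \<alpha> c (param M c y) v)) \<and>
     (\<forall>c'\<in>charts M. \<forall>x\<in>chart_dom M c \<inter> chart_dom M c'. \<forall>v.
        \<alpha> c x v = \<alpha> c' x (frechet_derivative (snd c' \<circ> param M c) (at (snd c x)) v)))"

definition real_form :: "('a, 'e) mfd \<Rightarrow> ('a, 'e, 'v) form \<Rightarrow> bool" where
  "real_form M \<alpha> \<longleftrightarrow> (\<forall>c\<in>charts M. \<forall>x\<in>chart_dom M c. \<forall>v. \<alpha> c x v \<in> \<real>)"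

definition smul :: "('a \<Rightarrow> complex) \<Rightarrow> ('a, 'e, 'v) form \<Rightarrow> ('a, 'e, 'v) form"
  (infixr "\<odot>" 75) where
  "f \<odot> \<alpha> = (\<lambda>c x v. f x * \<alpha> c x v)"

definition cconj :: "('a, 'e, 'v) form \<Rightarrow> ('a, 'e, 'v) form" where
  "cconj \<alpha> = (\<lambda>c x v. cnj (\<alpha> c x v))"

definition wedge :: "('a, 'e, 'e) form \<Rightarrow> ('a, 'e, 'e) form \<Rightarrow> ('a, 'e, 'e \<times> 'e) form"
  (infix "\<^bold>\<and>" 77) where
  "\<alpha> \<^bold>\<and> \<beta> = (\<lambda>c x (u, v). \<alpha> c x u * \<beta> c x v - \<alpha> c x v * \<beta> c x u)"

definition wedge12 ::
  "('a, 'e, 'e) form \<Rightarrow> ('a, 'e, 'e \<times> 'e) form \<Rightarrow> ('a, 'e, 'e \<times> 'e \<times> 'e) form"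
  (infix "\<^bold>\<and>\<^bold>\<and>" 76) where
  "\<alpha> \<^bold>\<and>\<^bold>\<and> \<theta> = (\<lambda>c x (u, v, w).
     \<alpha> c x u * \<theta> c x (v, w) - \<alpha> c x v * \<theta> c x (u, w) + \<alpha> c x w * \<theta> c x (u, v))"

definition dfun :: "('a, 'e::euclidean_space) mfd \<Rightarrow> ('a \<Rightarrow> complex) \<Rightarrow> ('a, 'e, 'e) form" where
  "dfun M f = (\<lambda>c x v. frechet_derivative (f \<circ> param M c) (at (snd c x)) v)"

definition ext_d ::
  "('a, 'e::euclidean_space) mfd \<Rightarrow> ('a, 'e, 'e) form \<Rightarrow> ('a, 'e, 'e \<times> 'e) form" where
  "ext_d M \<alpha> = (\<lambda>c x (u, v).
     frechet_derivative (\<lambda>y. \<alpha> c (param M c y) v) (at (snd c x)) u -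
     frechet_derivative (\<lambda>y. \<alpha> c (param M c y) u) (at (snd c x)) v)"

text \<open>The pullback of a 1-form on \<open>N\<close> by a map \<open>\<psi>\<close> from \<open>M\<close> to \<open>N\<close>; for a 1-form it does not
  depend on the chosen chart of \<open>N\<close> around \<open>\<psi> x\<close>.\<close>

definition pullback ::
  "('a, 'e::euclidean_space) mfd \<Rightarrow> ('b, 'g::euclidean_space) mfd \<Rightarrow> ('a \<Rightarrow> 'b) \<Rightarrow>
   ('b, 'g, 'g) form \<Rightarrow> ('a, 'e, 'e) form" where
  "pullback M N \<psi> \<alpha> = (\<lambda>c x v.
     let c' = (SOME c'. c' \<in> charts N \<and> \<psi> x \<in> chart_dom N c')
     in \<alpha> c' (\<psi> x) (frechet_derivative (snd c' \<circ> \<psi> \<circ> param M c) (at (snd c x)) v))"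

section \<open>Structures of an oriented congruence\<close>

text \<open>The pair \<open>(lam, \<mu>)\<close> represents the structure \<open>(M, [lam, \<mu>])\<close>.\<close>

definition coframe :: "('a, 'e) mfd \<Rightarrow> ('a, 'e, 'e) form \<Rightarrow> ('a, 'e, 'e) form \<Rightarrow> bool" where
  "coframe M lam \<mu> \<longleftrightarrow> (\<forall>c\<in>charts M. \<forall>x\<in>chart_dom M c.
     \<exists>u v w. (lam \<^bold>\<and>\<^bold>\<and> \<mu> \<^bold>\<and> cconj \<mu>) c x (u, v, w) \<noteq> 0)"

definition oriented_congruence ::
  "('a, real^3) mfd \<Rightarrow> ('a, real^3, real^3) form \<Rightarrow> ('a, real^3, real^3) form \<Rightarrow> bool" where
  "oriented_congruence M lam \<mu> \<longleftrightarrow>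
     one_form M lam \<and> real_form M lam \<and> one_form M \<mu> \<and> coframe M lam \<mu>"

definition same_structure ::
  "('a, 'e::euclidean_space) mfd \<Rightarrow> ('a, 'e, 'e) form \<Rightarrow> ('a, 'e, 'e) form \<Rightarrow>
   ('a, 'e, 'e) form \<Rightarrow> ('a, 'e, 'e) form \<Rightarrow> bool" where
  "same_structure M lam \<mu> lam' \<mu>' \<longleftrightarrow> (\<exists>f h.
     smooth_fun M f \<and> smooth_fun M h \<and> (\<forall>x\<in>points M. f x \<noteq> 0 \<and> h x \<noteq> 0) \<and>
     lam' \<doteq>\<^bsub>M\<^esub> (\<lambda>x. complex_of_real (f x)) \<odot> lam \<and> \<mu>' \<doteq>\<^bsub>M\<^esub> h \<odot> \<mu>)"

definition cong_equivalence ::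
  "('a, 'e::euclidean_space) mfd \<Rightarrow> ('a, 'e, 'e) form \<Rightarrow> ('a, 'e, 'e) form \<Rightarrow>
   ('b, 'e) mfd \<Rightarrow> ('b, 'e, 'e) form \<Rightarrow> ('b, 'e, 'e) form \<Rightarrow> ('a \<Rightarrow> 'b) \<Rightarrow> bool" where
  "cong_equivalence M lam \<mu> N lam' \<mu>' \<psi> \<longleftrightarrow> diffeomorphism M N \<psi> \<and>
     same_structure M lam \<mu> (pullback M N \<psi> lam') (pullback M N \<psi> \<mu>')"

definition structure_functions ::
  "('a, 'e::euclidean_space) mfd \<Rightarrow> ('a, 'e, 'e) form \<Rightarrow> ('a, 'e, 'e) form \<Rightarrow>
   ('a \<Rightarrow> real) \<Rightarrow> ('a \<Rightarrow> complex) \<Rightarrow> ('a \<Rightarrow> complex) \<Rightarrow> ('a \<Rightarrow> complex) \<Rightarrow> ('a \<Rightarrow> complex) \<Rightarrow>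
   bool" where
  "structure_functions M lam \<mu> a b p q s \<longleftrightarrow>
     ext_d M lam \<doteq>\<^bsub>M\<^esub> (\<lambda>x. \<i> * complex_of_real (a x)) \<odot> (\<mu> \<^bold>\<and> cconj \<mu>)
                      + b \<odot> (\<mu> \<^bold>\<and> lam) + (\<lambda>x. cnj (b x)) \<odot> (cconj \<mu> \<^bold>\<and> lam) \<and>
     ext_d M \<mu> \<doteq>\<^bsub>M\<^esub> p \<odot> (\<mu> \<^bold>\<and> cconj \<mu>) + q \<odot> (\<mu> \<^bold>\<and> lam) + s \<odot> (cconj \<mu> \<^bold>\<and> lam)"

text \<open>The structure functions are unique because \<open>(lam, \<mu>, cconj \<mu>)\<close> is a coframe: \<open>a\<close> is the
  twist and \<open>s\<close> is the shear.\<close>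

definition no_twist_shear ::
  "('a, 'e::euclidean_space) mfd \<Rightarrow> ('a, 'e, 'e) form \<Rightarrow> ('a, 'e, 'e) form \<Rightarrow>
   ('a \<Rightarrow> complex) \<Rightarrow> bool" where
  "no_twist_shear M lam \<mu> s \<longleftrightarrow> (\<exists>a b p q. structure_functions M lam \<mu> a b p q s \<and>
     (\<forall>x\<in>points M. a x = 0 \<and> s x \<noteq> 0))"

text \<open>The forms and functions on the half-line bundle associated with a structure with vanishing
  twist and nowhere vanishing shear. The sign \<open>\<sigma>\<close> and the phase \<open>\<phi>\<close> (fixed by the equations up
  to multiples of \<open>\<pi>\<close>) account for the discrete freedom in \<open>\<omega>\<close> and \<open>\<omega>1\<close>. A global \<open>\<phi>\<close> need not exist,
  so in general this is available only over sufficiently small open subsets.\<close>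

definition adapted_lift ::
  "('a, 'e::euclidean_space) mfd \<Rightarrow> ('a, 'e, 'e) form \<Rightarrow> ('a, 'e, 'e) form \<Rightarrow>
   ('a \<times> real, 'e \<times> real, 'e \<times> real) form \<Rightarrow> ('a \<times> real, 'e \<times> real, 'e \<times> real) form \<Rightarrow>
   ('a \<times> real, 'e \<times> real, 'e \<times> real) form \<Rightarrow>
   ('a \<times> real \<Rightarrow> real) \<Rightarrow> ('a \<times> real \<Rightarrow> real) \<Rightarrow> ('a \<times> real \<Rightarrow> complex) \<Rightarrow> ('a \<times> real \<Rightarrow> complex) \<Rightarrow>
   bool" where
  "adapted_lift M lam \<mu> \<omega> \<omega>1 \<Omega> T0 K0 T1 K1 \<longleftrightarrow> (let P = half_line_bundle M in
     (\<exists>s (\<sigma>::real) (\<phi> :: 'a \<Rightarrow> real).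
        no_twist_shear M lam \<mu> s \<and> \<sigma> \<in> {1, -1} \<and> smooth_fun M \<phi> \<and>
        \<omega> \<doteq>\<^bsub>P\<^esub> pullback P M fst ((\<lambda>x. complex_of_real (\<sigma> * cmod (s x))) \<odot> lam) \<and>
        \<omega>1 \<doteq>\<^bsub>P\<^esub> (\<lambda>(x, \<rho>). complex_of_real \<rho>) \<odot> pullback P M fst ((\<lambda>x. cis (\<phi> x)) \<odot> \<mu>)) \<and>
     one_form P \<omega> \<and> one_form P \<omega>1 \<and> one_form P \<Omega> \<and> real_form P \<Omega> \<and>
     smooth_fun P T0 \<and> smooth_fun P K0 \<and> smooth_fun P T1 \<and> smooth_fun P K1 \<and>
     ext_d P \<omega> \<doteq>\<^bsub>P\<^esub> T1 \<odot> (\<omega>1 \<^bold>\<and> \<omega>) + (\<lambda>z. cnj (T1 z)) \<odot> (cconj \<omega>1 \<^bold>\<and> \<omega>) \<and>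
     ext_d P \<omega>1 \<doteq>\<^bsub>P\<^esub> \<Omega> \<^bold>\<and> \<omega>1 + (\<omega>1 + cconj \<omega>1) \<^bold>\<and> \<omega>
                       + (\<lambda>z. \<i> * complex_of_real (T0 z)) \<odot> (\<omega>1 \<^bold>\<and> \<omega>) \<and>
     ext_d P \<Omega> \<doteq>\<^bsub>P\<^esub> (\<lambda>z. \<i> * complex_of_real (K0 z)) \<odot> (\<omega>1 \<^bold>\<and> cconj \<omega>1)
                      + K1 \<odot> (\<omega>1 \<^bold>\<and> \<omega>) + (\<lambda>z. cnj (K1 z)) \<odot> (cconj \<omega>1 \<^bold>\<and> \<omega>))"

text \<open>The lift is unique up to the discrete
  freedom, so the conditions on \<open>T1\<close>, \<open>K1\<close>, \<open>K0\<close> do not depend on which local lift is used.\<close>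

definition lift_conditions ::
  "('a, 'e) mfd \<Rightarrow> ('a \<times> real \<Rightarrow> real) \<Rightarrow> ('a \<times> real \<Rightarrow> complex) \<Rightarrow> ('a \<times> real \<Rightarrow> complex) \<Rightarrow>
   bool" where
  "lift_conditions M K0 T1 K1 \<longleftrightarrow>
     (\<forall>z\<in>points (half_line_bundle M). T1 z = 0 \<and> K1 z = 0 \<and> K0 z \<noteq> 0)"

definition special_congruence ::
  "('a, real^3) mfd \<Rightarrow> ('a, real^3, real^3) form \<Rightarrow> ('a, real^3, real^3) form \<Rightarrow> bool" where
  "special_congruence M lam \<mu> \<longleftrightarrow>
     oriented_congruence M lam \<mu> \<and> (\<exists>s. no_twist_shear M lam \<mu> s) \<and>
     (\<forall>x\<in>points M. \<exists>U \<omega> \<omega>1 \<Omega> T0 K0 T1 K1. openin (mtop M) U \<and> x \<in> U \<and>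
        adapted_lift (M\<restriction>U) lam \<mu> \<omega> \<omega>1 \<Omega> T0 K0 T1 K1 \<and> lift_conditions (M\<restriction>U) K0 T1 K1)"

text \<open>The forms and the function on \<open>M\<close> obtained by pulling back a lift along the section
  \<open>\<rho> = r x\<close> on which \<open>K0 = \<epsilon> = sgn K0\<close>.\<close>

definition invariant_coframe ::
  "('a, 'e::euclidean_space) mfd \<Rightarrow> ('a, 'e, 'e) form \<Rightarrow> ('a, 'e, 'e) form \<Rightarrow> real \<Rightarrow>
   ('a, 'e, 'e) form \<Rightarrow> ('a, 'e, 'e) form \<Rightarrow> ('a, 'e, 'e) form \<Rightarrow> ('a \<Rightarrow> real) \<Rightarrow> bool" where
  "invariant_coframe M lam \<mu> \<epsilon> \<omega> \<omega>1 \<Omega> T0 \<longleftrightarrow> (let P = half_line_bundle M in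
     \<epsilon> \<in> {1, -1} \<and>
     (\<exists>\<omega>P \<omega>1P \<Omega>P T0P K0 T1 K1 (r :: 'a \<Rightarrow> real).
        adapted_lift M lam \<mu> \<omega>P \<omega>1P \<Omega>P T0P K0 T1 K1 \<and> lift_conditions M K0 T1 K1 \<and>
        (\<forall>z\<in>points P. sgn (K0 z) = \<epsilon>) \<and>
        smooth_fun M r \<and> (\<forall>x\<in>points M. r x > 0 \<and> K0 (x, r x) = \<epsilon>) \<and>
        \<omega> \<doteq>\<^bsub>M\<^esub> pullback M P (\<lambda>x. (x, r x)) \<omega>P \<and>
        \<omega>1 \<doteq>\<^bsub>M\<^esub> pullback M P (\<lambda>x. (x, r x)) \<omega>1P \<and>
        \<Omega> \<doteq>\<^bsub>M\<^esub> pullback M P (\<lambda>x. (x, r x)) \<Omega>P \<and>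
        (\<forall>x\<in>points M. T0 x = T0P (x, r x))))"

definition Omega_form ::
  "('a, 'e, 'e) form \<Rightarrow> ('a, 'e, 'e) form \<Rightarrow> ('a \<Rightarrow> real) \<Rightarrow> ('a \<Rightarrow> real) \<Rightarrow> ('a, 'e, 'e) form" where
  "Omega_form \<omega> \<omega>1 A B =
     (\<lambda>x. complex_of_real (A x) + \<i> * complex_of_real (B x)) \<odot> \<omega>1
   + (\<lambda>x. complex_of_real (A x) - \<i> * complex_of_real (B x)) \<odot> cconj \<omega>1 + \<omega>"

definition invariant_system ::
  "('a, 'e::euclidean_space) mfd \<Rightarrow> real \<Rightarrow> ('a, 'e, 'e) form \<Rightarrow> ('a, 'e, 'e) form \<Rightarrow>
   ('a \<Rightarrow> real) \<Rightarrow> ('a \<Rightarrow> real) \<Rightarrow> ('a \<Rightarrow> real) \<Rightarrow> ('a \<Rightarrow> real) \<Rightarrow> ('a \<Rightarrow> complex) \<Rightarrow> bool" where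
  "invariant_system M \<epsilon> \<omega> \<omega>1 A B T0 A1 B1 \<longleftrightarrow>
     \<epsilon> \<in> {1, -1} \<and>
     one_form M \<omega> \<and> real_form M \<omega> \<and> one_form M \<omega>1 \<and> coframe M \<omega> \<omega>1 \<and>
     smooth_fun M A \<and> smooth_fun M B \<and> smooth_fun M T0 \<and> smooth_fun M A1 \<and> smooth_fun M B1 \<and>
     (ext_d M \<omega> \<doteq>\<^bsub>M\<^esub> 0) \<and>
     (ext_d M \<omega>1 \<doteq>\<^bsub>M\<^esub>
         (\<lambda>x. \<i> * complex_of_real (B x) - complex_of_real (A x)) \<odot> (\<omega>1 \<^bold>\<and> cconj \<omega>1)
       + (\<lambda>x. \<i> * complex_of_real (T0 x)) \<odot> (\<omega>1 \<^bold>\<and> \<omega>) + cconj \<omega>1 \<^bold>\<and> \<omega>) \<and>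
     (ext_d M (cconj \<omega>1) \<doteq>\<^bsub>M\<^esub>
         (\<lambda>x. \<i> * complex_of_real (B x) + complex_of_real (A x)) \<odot> (\<omega>1 \<^bold>\<and> cconj \<omega>1)
       + \<omega>1 \<^bold>\<and> \<omega> - (\<lambda>x. \<i> * complex_of_real (T0 x)) \<odot> (cconj \<omega>1 \<^bold>\<and> \<omega>)) \<and>
     (ext_d M (Omega_form \<omega> \<omega>1 A B) \<doteq>\<^bsub>M\<^esub>
         (\<lambda>x. complex_of_real \<epsilon> * \<i>) \<odot> (\<omega>1 \<^bold>\<and> cconj \<omega>1)) \<and>
     (dfun M (\<lambda>x. complex_of_real (A x)) \<doteq>\<^bsub>M\<^esub>
         (\<lambda>x. complex_of_real (A1 x) + \<i> / 2 * (B1 x + cnj (B1 x) + complex_of_real \<epsilon>)) \<odot> \<omega>1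
       + (\<lambda>x. complex_of_real (A1 x) - \<i> / 2 * (B1 x + cnj (B1 x) + complex_of_real \<epsilon>)) \<odot> cconj \<omega>1
       + (\<lambda>x. complex_of_real (A x - B x * T0 x)) \<odot> \<omega>) \<and>
     (dfun M (\<lambda>x. complex_of_real (B x)) \<doteq>\<^bsub>M\<^esub>
         B1 \<odot> \<omega>1 + (\<lambda>x. cnj (B1 x)) \<odot> cconj \<omega>1
       + (\<lambda>x. complex_of_real (A x * T0 x - B x)) \<odot> \<omega>) \<and>
     (dfun M (\<lambda>x. complex_of_real (T0 x)) \<^bold>\<and> \<omega> \<doteq>\<^bsub>M\<^esub> 0)"

end

theory Submission
  imports Defs
begin

text \<open>With \<open>T1 = K1 = 0\<close> the equations of a lift say that \<open>d\<omega> = 0\<close>, that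
  \<open>d\<theta> = \<Omega> \<and> \<theta> + (\<theta> + \<theta>') \<and> \<omega> + i T \<theta> \<and> \<omega>\<close>, and that \<open>d\<Omega> = i k \<theta> \<and> \<theta>'\<close>, where \<open>\<theta>'\<close> is the
  conjugate of \<open>\<theta>\<close>. These equations are preserved by pullback along smooth maps, and by the
  rescaling \<open>\<theta> \<mapsto> g \<theta>\<close>, \<open>\<Omega> \<mapsto> \<Omega> + d ln g\<close>, \<open>k \<mapsto> k / g\<^sup>2\<close>. Pulling a lift back along a section of
  the half-line bundle and rescaling by \<open>g = \<surd>\<bar>k\<bar>\<close> gives the invariant coframe; conversely, pulling
  a coframe with \<open>k = \<epsilon>\<close> back along the projection and rescaling by \<open>\<rho> / r\<close> gives a lift. No
  uniqueness of lifts is needed.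

  In dimension three \<open>d(d\<Omega>) = 0\<close> forces the coefficient of \<open>\<omega>\<close> in \<open>\<Omega>\<close> to be \<open>1\<close>, the equation
  for \<open>d\<Omega>\<close> determines \<open>dA\<close> and \<open>dB\<close> up to \<open>A1\<close> and \<open>B1\<close>, and \<open>d(d\<theta>) = 0\<close> gives \<open>dT \<and> \<omega> = 0\<close>.
  If two such coframes define the same structure, say \<open>\<omega>2 = f \<omega>\<close> and \<open>\<theta>2 = h \<theta>\<close>, then the shear
  terms give \<open>h = f h'\<close>, hence \<open>f = \<plusminus>1\<close>, and the normalization \<open>k = \<plusminus>1\<close> gives \<open>\<bar>h\<bar> = 1\<close>.\<close>

section \<open>Smooth functions\<close>

text \<open>The relation h = f cnj h is read off the coefficient of \<open>cconj \<theta>\<close>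
  \<and> \<omega> in d(h \<theta>): the term dh \<and> \<theta> cannot reach that coefficient, so dh
  drops out. Taking moduli gives f = 1 or f = -1, hence h is real or purely imaginary: h = t R with
  t = 1 or t = \<i> and R real. Only R falls under the rescaling. The constant phase t changes
  \<Omega> to \<Omega> + (f - 1) \<omega>, which has the same differential because \<omega> is
  closed. What survives is the group of fourth roots of unity \<tau>, acting by \<theta> -> \<tau>
  \<theta> and \<omega> -> \<tau>^2 \<omega>. The obstacle that shapes the proof is that phase
  functions, and constant signs, exist only locally. The arguments are therefore set up so that they
  apply to open submanifolds; signs become constants either by shrinking an open set or by
  connectedness, and the only datum that has to be global, the shear, is glued pointwise.\<close>

abbreviation frd :: "('a::real_normed_vector \<Rightarrow> 'b::real_normed_vector) \<Rightarrow> 'a \<Rightarrow> 'a \<Rightarrow> 'b" where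
  "frd f y \<equiv> frechet_derivative f (at y)"

lemma frd_has: "f differentiable (at y) \<Longrightarrow> (f has_derivative frd f y) (at y)"
  using frechet_derivative_works by blast

lemma frd_eqI: "(f has_derivative f') (at y) \<Longrightarrow> frd f y = f'"
  using frechet_derivative_at by metis

text \<open>Both functions have the same derivatives at the point, so the choice operator in
  \<open>frechet_derivative\<close> returns the same map for both, even where neither is
  differentiable.\<close>

lemma frd_cong:
  assumes "open S" "y \<in> S" "\<And>z. z \<in> S \<Longrightarrow> f z = g z"
  shows "frd f y = frd g y"
proof -
  have "(f has_derivative f') (at y) \<longleftrightarrow> (g has_derivative f') (at y)" for f'
    using has_derivative_transform_within_open[OF _ assms(1,2), of f f' UNIV g]
      has_derivative_transform_within_open[OF _ assms(1,2), of g f' UNIV f] assms(3) by auto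
  then show ?thesis unfolding frechet_derivative_def by simp
qed

lemma differentiable_cong_open:
  assumes "open S" "y \<in> S" "\<And>z. z \<in> S \<Longrightarrow> f z = g z" "f differentiable (at y)"
  shows "g differentiable (at y)"
  using has_derivative_transform_within_open[OF _ assms(1,2), of f _ UNIV g] assms(3,4) unfolding
      differentiable_def by blast

lemma frd_compose:
  assumes "f differentiable (at (g y))" "g differentiable (at y)"
  shows "frd (\<lambda>y. f (g y)) y v = frd f (g y) (frd g y v)"
  using frechet_derivative_compose[OF assms(2,1)] by (simp add: o_def)

section \<open>Closure properties of k-fold differentiability\<close>

lemma Ck_on_cong:
  assumes "open S"
  shows "(\<And>y. y \<in> S \<Longrightarrow> f y = g y) \<Longrightarrow> Ck_on k S f \<Longrightarrow> Ck_on k S g"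
proof (induction k arbitrary: f g)
  case 0
  then show ?case using continuous_on_cong[of S S f g] by simp
next
  case (Suc k)
  have "frd f y v = frd g y v" if "y \<in> S" for y v
    by (rule fun_cong[OF frd_cong[OF assms that Suc.prems(1)]])
  then have "Ck_on k S (\<lambda>y. frd g y v)" for v
    using Suc.IH[of "\<lambda>y. frd f y v" "\<lambda>y. frd g y v"] Suc.prems by auto
  moreover have "g differentiable (at y)" if "y \<in> S" for y
    using differentiable_cong_open[OF assms that Suc.prems(1)] Suc.prems(2) that by simp
  ultimately show ?case by simp
qed

text \<open>\<open>Ck_on (Suc k)\<close> does not literally contain \<open>Ck_on k\<close>. At the
  bottom, differentiability gives continuity; above it, the induction is applied to the directional
  derivatives.\<close>

lemma Ck_on_Suc_imp: "Ck_on (Suc k) S f \<Longrightarrow> Ck_on k S f"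
proof (induction k arbitrary: f)
  case 0
  then show ?case
    by (auto intro!: continuous_at_imp_continuous_on differentiable_imp_continuous_within)
next
  case (Suc k)
  have "Ck_on k S (\<lambda>y. frd f y v)" for v
    by (rule Suc.IH) (use Suc.prems in \<open>simp only: Ck_on.simps(2)[of "Suc k"]\<close>)
  moreover have "\<forall>y\<in>S. f differentiable (at y)"
    using Suc.prems Ck_on.simps(2)[of "Suc k" S f] by blast
  ultimately show ?case by (simp only: Ck_on.simps) blast
qed

lemma Ck_on_subset: "Ck_on k S f \<Longrightarrow> T \<subseteq> S \<Longrightarrow> Ck_on k T f"
  by (induction k arbitrary: f) (auto intro: continuous_on_subset)

text \<open>This is what lets a pullback be checked with a target chart that varies from point to
  point.\<close>

lemma Ck_on_local:
  assumes "\<And>y. y \<in> S \<Longrightarrow> \<exists>T. open T \<and> y \<in> T \<and> Ck_on k T f"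
  shows "Ck_on k S f"
  using assms
proof (induction k arbitrary: f)
  case 0
  show ?case unfolding Ck_on.simps
  proof (intro continuous_at_imp_continuous_on ballI)
    fix y assume "y \<in> S"
    then obtain T where "open T" "y \<in> T" "continuous_on T f"
      using 0 by auto
    then show "isCont f y" using continuous_on_eq_continuous_at by blast
  qed
next
  case (Suc k)
  have "Ck_on k S (\<lambda>y. frd f y v)" for v
    by (rule Suc.IH) (use Suc.prems in \<open>force\<close>)
  moreover have "f differentiable (at y)" if "y \<in> S" for y
    using Suc.prems[OF that] by auto
  ultimately show ?case by simp
qed

lemma Ck_on_const [simp]: "Ck_on k S (\<lambda>_. a)"
  by (induction k arbitrary: a) (auto simp: frechet_derivative_const)

text \<open>The scheme of several closure lemmas: a derivative formula valid at the points of
  \<open>S\<close> identifies the directional derivatives there, the induction hypothesis covers its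
  right-hand side, and \<open>Ck_on_cong\<close> carries the result back.\<close>

lemma Ck_on_linear_comp:
  fixes L :: "'v::real_normed_vector \<Rightarrow> 'w::real_normed_vector"
  assumes "bounded_linear L" "open S"
  shows "Ck_on k S f \<Longrightarrow> Ck_on k S (\<lambda>y. L (f y))"
proof (induction k arbitrary: f)
  case 0
  then show ?case using bounded_linear.continuous_on[OF assms(1)] by auto
next
  case (Suc k)
  have d: "((\<lambda>y. L (f y)) has_derivative (\<lambda>v. L (frd f y v))) (at y)" if "y \<in> S" for y
    using bounded_linear.has_derivative[OF assms(1) frd_has] Suc.prems that by auto
  have "Ck_on k S (\<lambda>y. L (frd f y v))" for v
    using Suc by simp
  then have "Ck_on k S (\<lambda>y. frd (\<lambda>y. L (f y)) y v)" for v
    by (rule Ck_on_cong[OF assms(2), rotated]) (simp add: frd_eqI[OF d])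
  then show ?case using d by (auto simp: differentiable_def)
qed

lemma Ck_on_add:
  assumes "open S"
  shows "Ck_on k S f \<Longrightarrow> Ck_on k S g \<Longrightarrow> Ck_on k S (\<lambda>y. f y + g y)"
proof (induction k arbitrary: f g)
  case 0
  then show ?case by (auto intro: continuous_on_add)
next
  case (Suc k)
  have d: "((\<lambda>y. f y + g y) has_derivative (\<lambda>v. frd f y v + frd g y v)) (at y)" if "y \<in> S" for y
    using Suc.prems that by (intro has_derivative_add frd_has) auto
  have "Ck_on k S (\<lambda>y. frd f y v + frd g y v)" for v
    using Suc by simp
  then have "Ck_on k S (\<lambda>y. frd (\<lambda>y. f y + g y) y v)" for v
    by (rule Ck_on_cong[OF assms, rotated]) (simp add: frd_eqI[OF d])
  then show ?case using d by (auto simp: differentiable_def)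
qed

lemma Ck_on_sum:
  assumes "open S" "finite I" "\<And>i. i \<in> I \<Longrightarrow> Ck_on k S (f i)"
  shows "Ck_on k S (\<lambda>y. \<Sum>i\<in>I. f i y)"
  using assms(2,3) by (induction I rule: finite_induct) (auto intro: Ck_on_add[OF assms(1)])

text \<open>The Leibniz rule pairs each function, undifferentiated, with the derivative of the
  other. The induction hypothesis is therefore used with \<open>f\<close> and \<open>g\<close>
  themselves lowered by \<open>Ck_on_Suc_imp\<close>.\<close>

lemma Ck_on_bilinear:
  assumes bl: "bounded_bilinear m" and S: "open S"
  shows "Ck_on k S f \<Longrightarrow> Ck_on k S g \<Longrightarrow> Ck_on k S (\<lambda>y. m (f y) (g y))"
proof (induction k arbitrary: f g)
  case 0
  then show ?case using bounded_bilinear.continuous_on[OF bl] by auto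
next
  case (Suc k)
  have d: "((\<lambda>y. m (f y) (g y)) has_derivative (\<lambda>v. m (f y) (frd g y v) + m (frd f y v) (g y))) (at
      y)"
    if "y \<in> S" for y
    using Suc.prems that by (intro bounded_bilinear.FDERIV[OF bl] frd_has) auto
  have "Ck_on k S (\<lambda>y. m (f y) (frd g y v) + m (frd f y v) (g y))" for v
  proof -
    have "Ck_on k S f" "Ck_on k S g" using Suc.prems Ck_on_Suc_imp by blast+
    moreover have "Ck_on k S (\<lambda>y. frd f y v)" "Ck_on k S (\<lambda>y. frd g y v)" using Suc.prems by
        simp_all
    ultimately show ?thesis by (intro Ck_on_add[OF S] Suc.IH)
  qed
  then have "Ck_on k S (\<lambda>y. frd (\<lambda>y. m (f y) (g y)) y v)" for v
    by (rule Ck_on_cong[OF S, rotated]) (simp add: frd_eqI[OF d])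
  then show ?case using d by (auto simp: differentiable_def)
qed

lemma linear_Basis_expand:
  fixes L :: "'e::euclidean_space \<Rightarrow> 'v::real_vector"
  assumes "linear L"
  shows "L v = (\<Sum>i\<in>Basis. (v \<bullet> i) *\<^sub>R L i)"
proof -
  have "L v = L (\<Sum>i\<in>Basis. (v \<bullet> i) *\<^sub>R i)" by (simp add: euclidean_representation)
  also have "\<dots> = (\<Sum>i\<in>Basis. (v \<bullet> i) *\<^sub>R L i)"
    using assms by (simp add: linear_sum linear_cmul)
  finally show ?thesis .
qed

text \<open>In \<open>frd f (g y) (frd g y v)\<close> both the base point and the vector depend on
  \<open>y\<close>. Expanding the vector in the standard basis separates the two dependences into a
  finite sum of products.\<close>

lemma Ck_on_compose:
  assumes S: "open S" and T: "open T" and gT: "g ` S \<subseteq> T"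
  shows "Ck_on k T f \<Longrightarrow> Ck_on k S g \<Longrightarrow> Ck_on k S (\<lambda>y. f (g y))"
proof (induction k arbitrary: f)
  case 0
  then show ?case using gT continuous_on_compose2 by auto
next
  case (Suc k)
  have gk: "Ck_on k S g" using Suc.prems Ck_on_Suc_imp by blast
  have df: "f differentiable (at (g y))" and dg: "g differentiable (at y)" if "y \<in> S" for y
    using Suc.prems gT that by auto
  have eq: "frd (\<lambda>y. f (g y)) y v = (\<Sum>i\<in>Basis. (frd g y v \<bullet> i) *\<^sub>R frd f (g y) i)" if "y \<in> S" for y
      v
    using frd_compose[OF df dg] linear_Basis_expand[OF linear_frechet_derivative[OF df]] that by
        metis
  have "Ck_on k S (\<lambda>y. \<Sum>i\<in>Basis. (frd g y v \<bullet> i) *\<^sub>R frd f (g y) i)" for v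
  proof (intro Ck_on_sum S Ck_on_bilinear[OF bounded_bilinear_scaleR S])
    fix i :: 'b assume "i \<in> Basis"
    show "Ck_on k S (\<lambda>y. frd g y v \<bullet> i)"
      by (rule Ck_on_linear_comp[OF bounded_linear_inner_left S]) (use Suc.prems in simp)
    show "Ck_on k S (\<lambda>y. frd f (g y) i)"
      using Suc.IH[of "\<lambda>z. frd f z i"] Suc.prems gk by auto
  qed auto
  then have "Ck_on k S (\<lambda>y. frd (\<lambda>y. f (g y)) y v)" for v
    by (rule Ck_on_cong[OF S, rotated]) (simp add: eq)
  moreover have "(\<lambda>y. f (g y)) differentiable (at y)" if "y \<in> S" for y
    using differentiable_chain_at[OF dg df] that by (simp add: o_def)
  ultimately show ?case by simp
qed

text \<open>The derivative \<open>- (inverse y * v * inverse y)\<close> is built from the function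
  itself, so each order of differentiability yields the next.\<close>

lemma Ck_on_inverse: "Ck_on k (- {0}) (inverse :: 'a::{euclidean_space,real_normed_field} \<Rightarrow> 'a)"
proof (induction k)
  case 0
  then show ?case by (auto intro!: continuous_on_inverse continuous_on_id)
next
  case (Suc k)
  have d: "(inverse has_derivative (\<lambda>h. - (inverse y * h * inverse y))) (at y)" if "y \<noteq> 0" for y ::
      'a
    using has_derivative_inverse'[OF that] by simp
  have "Ck_on k (- {0}) (\<lambda>y::'a. - (inverse y * v * inverse y))" for v
    by (intro Ck_on_linear_comp[OF bounded_linear_minus[OF bounded_linear_ident]]
        Ck_on_bilinear[OF bounded_bilinear_mult] Suc) auto
  then have "Ck_on k (- {0}) (\<lambda>y::'a. frd inverse y v)" for v
    by (rule Ck_on_cong[rotated 2]) (auto simp: frd_eqI[OF d])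
  then show ?case using d by (auto simp: differentiable_def)
qed

section \<open>Closure properties of smooth functions\<close>

lemma smooth_onI: "(\<And>k. Ck_on k S f) \<Longrightarrow> smooth_on S f"
  by (simp add: smooth_on_def)

lemma smooth_onD: "smooth_on S f \<Longrightarrow> Ck_on k S f"
  by (simp add: smooth_on_def)

lemma smooth_on_cong: "open S \<Longrightarrow> (\<And>y. y \<in> S \<Longrightarrow> f y = g y) \<Longrightarrow> smooth_on S f \<Longrightarrow> smooth_on S g"
  by (rule smooth_onI, rule Ck_on_cong[OF _ _ smooth_onD])

lemma smooth_on_subset: "smooth_on S f \<Longrightarrow> T \<subseteq> S \<Longrightarrow> smooth_on T f"
  by (rule smooth_onI, rule Ck_on_subset[OF smooth_onD])

lemma smooth_on_local:
  assumes "\<And>y. y \<in> S \<Longrightarrow> \<exists>T. open T \<and> y \<in> T \<and> smooth_on T f"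
  shows "smooth_on S f"
  by (rule smooth_onI, rule Ck_on_local) (use assms smooth_onD in blast)

lemma smooth_on_const [simp]: "smooth_on S (\<lambda>_. a)"
  by (simp add: smooth_on_def)

lemma smooth_on_linear_comp:
  "bounded_linear L \<Longrightarrow> open S \<Longrightarrow> smooth_on S f \<Longrightarrow> smooth_on S (\<lambda>y. L (f y))"
  by (rule smooth_onI, rule Ck_on_linear_comp[of L, OF _ _ smooth_onD[of S f]])

lemma smooth_on_add: "open S \<Longrightarrow> smooth_on S f \<Longrightarrow> smooth_on S g \<Longrightarrow> smooth_on S (\<lambda>y. f y + g y)"
  by (rule smooth_onI, rule Ck_on_add[OF _ smooth_onD[of S f] smooth_onD[of S g]])

lemma smooth_on_minus: "open S \<Longrightarrow> smooth_on S f \<Longrightarrow> smooth_on S (\<lambda>y. - f y)"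
  by (rule smooth_on_linear_comp[OF bounded_linear_minus[OF bounded_linear_ident]])

lemma smooth_on_diff: "open S \<Longrightarrow> smooth_on S f \<Longrightarrow> smooth_on S g \<Longrightarrow> smooth_on S (\<lambda>y. f y - g y)"
  using smooth_on_add[OF _ _ smooth_on_minus, of S f g] by simp

lemma smooth_on_sum:
  assumes "open S" "finite I" "\<And>i. i \<in> I \<Longrightarrow> smooth_on S (f i)"
  shows "smooth_on S (\<lambda>y. \<Sum>i\<in>I. f i y)"
  by (rule smooth_onI, rule Ck_on_sum[OF assms(1,2) smooth_onD[OF assms(3)]])

lemma smooth_on_scaleR:
  "open S \<Longrightarrow> smooth_on S f \<Longrightarrow> smooth_on S g \<Longrightarrow> smooth_on S (\<lambda>y. f y *\<^sub>R g y)"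
  by (rule smooth_onI, rule Ck_on_bilinear[OF bounded_bilinear_scaleR _ smooth_onD[of S f]
      smooth_onD[of S g]])

lemma smooth_on_mult:
  fixes f g :: "'e::euclidean_space \<Rightarrow> 'v::real_normed_algebra"
  shows "open S \<Longrightarrow> smooth_on S f \<Longrightarrow> smooth_on S g \<Longrightarrow> smooth_on S (\<lambda>y. f y * g y)"
  by (rule smooth_onI, rule Ck_on_bilinear[OF bounded_bilinear_mult _ smooth_onD[of S f]
      smooth_onD[of S g]])

lemma smooth_on_compose:
  "open S \<Longrightarrow> open T \<Longrightarrow> g ` S \<subseteq> T \<Longrightarrow> smooth_on T f \<Longrightarrow> smooth_on S g \<Longrightarrow> smooth_on S (\<lambda>y. f (g y))"
  by (rule smooth_onI, rule Ck_on_compose[OF _ _ _ smooth_onD[of T f] smooth_onD[of S g]])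

lemma Ck_on_ident: "Ck_on k S (\<lambda>y. y)"
  by (cases k) auto

lemma smooth_on_ident [simp]: "smooth_on S (\<lambda>y. y)"
  by (simp add: smooth_on_def Ck_on_ident)

lemma smooth_on_inverse:
  fixes f :: "'e::euclidean_space \<Rightarrow> 'v::{euclidean_space,real_normed_field}"
  assumes "open S" "smooth_on S f" "\<And>y. y \<in> S \<Longrightarrow> f y \<noteq> 0"
  shows "smooth_on S (\<lambda>y. inverse (f y))"
  by (rule smooth_on_compose[of S "- {0}" f inverse, OF assms(1) _ _ smooth_onI[OF Ck_on_inverse]
      assms(2)])
     (use assms(3) in auto)

lemma smooth_on_divide:
  fixes f g :: "'e::euclidean_space \<Rightarrow> 'v::{euclidean_space,real_normed_field}"
  assumes "open S" "smooth_on S f" "smooth_on S g" "\<And>y. y \<in> S \<Longrightarrow> g y \<noteq> 0"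
  shows "smooth_on S (\<lambda>y. f y / g y)"
  using smooth_on_mult[OF assms(1,2) smooth_on_inverse[OF assms(1,3,4)]] by (simp add:
      divide_inverse)

lemma smooth_on_Pair:
  fixes f :: "'e::euclidean_space \<Rightarrow> 'v::real_normed_vector" and g :: "'e \<Rightarrow> 'w::real_normed_vector"
  assumes "open S" "smooth_on S f" "smooth_on S g"
  shows "smooth_on S (\<lambda>y. (f y, g y))"
proof -
  have "smooth_on S (\<lambda>y. (f y, 0::'w) + (0::'v, g y))"
    by (intro smooth_on_add assms smooth_on_linear_comp[of "\<lambda>z. (z, 0)"] smooth_on_linear_comp[of
        "Pair 0"]
        bounded_linear_intros)
  then show ?thesis by simp
qed

text \<open>The derivative is half of \<open>inverse (sqrt y)\<close>, a composition of the
  inversion with the function itself, so the induction feeds on its own conclusion.\<close>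

lemma Ck_on_sqrt: "Ck_on k {0<..} sqrt"
proof (induction k)
  case 0
  then show ?case by (auto intro!: continuous_intros)
next
  case (Suc k)
  have d: "(sqrt has_derivative (\<lambda>h. (1/2) *\<^sub>R (inverse (sqrt y) * h))) (at y)" if "y > 0" for y
    by (rule has_derivative_eq_rhs[OF DERIV_real_sqrt[OF that, unfolded has_field_derivative_def]])
       (simp add: fun_eq_iff)
  have "Ck_on k {0<..} (\<lambda>y. (1/2) *\<^sub>R (inverse (sqrt y) * v))" for v
    by (intro Ck_on_linear_comp[OF bounded_linear_scaleR_right] Ck_on_bilinear[OF
        bounded_bilinear_mult]
        Ck_on_compose[of _ "- {0}" sqrt k inverse] Suc Ck_on_inverse) auto
  then have "Ck_on k {0<..} (\<lambda>y. frd sqrt y v)" for v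
    by (rule Ck_on_cong[rotated 2]) (auto simp: frd_eqI[OF d])
  then show ?case using d by (auto simp: differentiable_def)
qed

lemma smooth_on_sqrt:
  assumes "open S" "smooth_on S f" "\<And>y. y \<in> S \<Longrightarrow> f y > 0"
  shows "smooth_on S (\<lambda>y. sqrt (f y))"
  by (rule smooth_on_compose[of S "{0<..}" f sqrt, OF assms(1) _ _ smooth_onI[OF Ck_on_sqrt]
      assms(2)])
     (use assms(3) in auto)

text \<open>A case split replaces the induction: the derivative is the inversion, which is smooth on
  the slit plane because that plane avoids zero.\<close>

lemma smooth_on_Ln: "smooth_on (- \<real>\<^sub>\<le>\<^sub>0) Ln"
proof (rule smooth_onI)
  fix k
  show "Ck_on k (- \<real>\<^sub>\<le>\<^sub>0) Ln"
  proof (cases k)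
    case 0
    then show ?thesis by (auto intro!: continuous_on_Ln continuous_on_id)
  next
    case (Suc j)
    have d: "(Ln has_derivative (\<lambda>h. inverse y * h)) (at y)" if "y \<notin> \<real>\<^sub>\<le>\<^sub>0" for y
      using has_field_derivative_Ln[OF that] by (simp add: has_field_derivative_def)
    have o: "open (- \<real>\<^sub>\<le>\<^sub>0 :: complex set)" by (simp add: open_Compl)
    have "Ck_on j (- \<real>\<^sub>\<le>\<^sub>0) (\<lambda>y::complex. inverse y * v)" for v
      by (intro Ck_on_bilinear[OF bounded_bilinear_mult] o Ck_on_const Ck_on_subset[OF
          Ck_on_inverse]) auto
    then have "Ck_on j (- \<real>\<^sub>\<le>\<^sub>0) (\<lambda>y. frd Ln y v)" for v
      by (rule Ck_on_cong[OF o, rotated]) (auto simp: frd_eqI[OF d])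
    then show ?thesis using d Suc by (auto simp: differentiable_def)
  qed
qed

lemma smooth_on_differentiable: "smooth_on S f \<Longrightarrow> y \<in> S \<Longrightarrow> f differentiable (at y)"
  using smooth_onD[of S f "Suc 0"] by simp

lemma smooth_on_frd: "smooth_on S f \<Longrightarrow> smooth_on S (\<lambda>y. frd f y v)"
  by (rule smooth_onI) (use smooth_onD[of S f "Suc k" for k] in simp)

lemma smooth_on_continuous: "smooth_on S f \<Longrightarrow> continuous_on S f"
  using smooth_onD[of S f 0] by simp

section \<open>Symmetry of second derivatives\<close>

lemma has_real_derivative_along_line:
  fixes f :: "'e::euclidean_space \<Rightarrow> real"
  assumes "f differentiable (at (w + s *\<^sub>R u))"
  shows "((\<lambda>s. f (w + s *\<^sub>R u)) has_real_derivative frd f (w + s *\<^sub>R u) u) (at s)"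
proof -
  have "((\<lambda>s. f (w + s *\<^sub>R u)) has_derivative (\<lambda>h. frd f (w + s *\<^sub>R u) (h *\<^sub>R u))) (at s)"
    by (rule has_derivative_compose[of "\<lambda>s. w + s *\<^sub>R u" "\<lambda>h. h *\<^sub>R u", OF _ frd_has[OF assms]])
      (auto intro!: derivative_eq_intros)
  then show ?thesis
    unfolding has_field_derivative_def
    using linear_cmul[OF linear_frechet_derivative[OF assms]]
    by (simp add: mult_commute_abs)
qed

text \<open>The left-hand side is symmetric in \<open>u\<close> and \<open>v\<close>, which yields the symmetry of second
    derivatives.\<close>

lemma second_difference:
  fixes f :: "'e::euclidean_space \<Rightarrow> real"
  assumes f: "smooth_on S f" and S: "ball y r \<subseteq> S" and h: "h > 0" "h * (norm u + norm v) < r"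
  shows "\<exists>p\<in>cball y (h * (norm u + norm v)).
    f (y + h *\<^sub>R u + h *\<^sub>R v) - f (y + h *\<^sub>R u) - f (y + h *\<^sub>R v) + f y
    = h * h * frd (\<lambda>z. frd f z u) p v"
proof -
  have inb: "dist y (y + s *\<^sub>R u + t *\<^sub>R v) \<le> h * (norm u + norm v)" if "0 \<le> s" "s \<le> h" "0 \<le> t" "t \<le>
      h" for s t
  proof -
    have "norm (s *\<^sub>R u + t *\<^sub>R v) \<le> s * norm u + t * norm v"
      using norm_triangle_ineq[of "s *\<^sub>R u" "t *\<^sub>R v"] that by simp
    also have "\<dots> \<le> h * norm u + h * norm v"
      using that by (intro add_mono mult_right_mono) auto
    finally show ?thesis by (simp add: dist_norm algebra_simps norm_minus_commute)
  qed
  then have inS: "y + s *\<^sub>R u + t *\<^sub>R v \<in> S" if "0 \<le> s" "s \<le> h" "0 \<le> t" "t \<le> h" for s t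
    using that h(2) S by (meson le_less_trans mem_ball subsetD)
  have df: "f differentiable (at (y + s *\<^sub>R u + t *\<^sub>R v))" if "0 \<le> s" "s \<le> h" "0 \<le> t" "t \<le> h" for s
      t
    using smooth_on_differentiable[OF f inS] that by blast
  \<comment> \<open>The mean value theorem is applied twice: in \<open>s\<close> to the difference
    of \<open>f\<close> along two parallel lines in direction \<open>u\<close>, then in
    \<open>t\<close> to the derivative so obtained.\<close>
  have d1: "((\<lambda>s. f (y + s *\<^sub>R u + h *\<^sub>R v) - f (y + s *\<^sub>R u)) has_real_derivative
      frd f (y + s *\<^sub>R u + h *\<^sub>R v) u - frd f (y + s *\<^sub>R u) u) (at s)" if "0 \<le> s" "s \<le> h" for s
  proof (intro DERIV_diff)
    show "((\<lambda>s. f (y + s *\<^sub>R u + h *\<^sub>R v)) has_real_derivative frd f (y + s *\<^sub>R u + h *\<^sub>R v) u) (at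
        s)"
      using has_real_derivative_along_line[of f "y + h *\<^sub>R v" s u] df[of s h] that h(1)
      by (simp add: add.commute add.left_commute)
    show "((\<lambda>s. f (y + s *\<^sub>R u)) has_real_derivative frd f (y + s *\<^sub>R u) u) (at s)"
      using has_real_derivative_along_line[of f y s u] df[of s 0] that h(1) by simp
  qed
  obtain s where s: "0 < s" "s < h" and
    e1: "f (y + h *\<^sub>R u + h *\<^sub>R v) - f (y + h *\<^sub>R u) - (f (y + 0 *\<^sub>R u + h *\<^sub>R v) - f (y + 0 *\<^sub>R u))
      = (h - 0) * (frd f (y + s *\<^sub>R u + h *\<^sub>R v) u - frd f (y + s *\<^sub>R u) u)"
    using MVT2[OF h(1) d1] by blast
  have d2: "((\<lambda>t. frd f (y + s *\<^sub>R u + t *\<^sub>R v) u) has_real_derivative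
      frd (\<lambda>z. frd f z u) (y + s *\<^sub>R u + t *\<^sub>R v) v) (at t)" if "0 \<le> t" "t \<le> h" for t
    using has_real_derivative_along_line[of "\<lambda>z. frd f z u" "y + s *\<^sub>R u" t v]
      smooth_on_differentiable[OF smooth_on_frd[OF f] inS[of s t]] that s by simp
  obtain t where t: "0 < t" "t < h" and
    e2: "frd f (y + s *\<^sub>R u + h *\<^sub>R v) u - frd f (y + s *\<^sub>R u + 0 *\<^sub>R v) u
      = (h - 0) * frd (\<lambda>z. frd f z u) (y + s *\<^sub>R u + t *\<^sub>R v) v"
    using MVT2[OF h(1) d2] by blast
  have "y + s *\<^sub>R u + t *\<^sub>R v \<in> cball y (h * (norm u + norm v))"
    using inb[of s t] s t by simp
  moreover have "f (y + h *\<^sub>R u + h *\<^sub>R v) - f (y + h *\<^sub>R u) - f (y + h *\<^sub>R v) + f y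
    = h * h * frd (\<lambda>z. frd f z u) (y + s *\<^sub>R u + t *\<^sub>R v) v"
    using e1 e2 by simp
  ultimately show ?thesis by blast
qed

text \<open>One second difference equals \<open>h * h\<close> times either mixed derivative, each at
  some point near \<open>y\<close>. As the parallelogram shrinks, continuity of both mixed
  derivatives identifies their values at \<open>y\<close>.\<close>

lemma frd_symmetric_real:
  fixes f :: "'e::euclidean_space \<Rightarrow> real"
  assumes S: "open S" "y \<in> S" and f: "smooth_on S f"
  shows "frd (\<lambda>z. frd f z u) y v = frd (\<lambda>z. frd f z v) y u"
proof (rule ccontr)
  let ?G = "\<lambda>u v z. frd (\<lambda>z. frd f z u) z v"
  assume ne: "?G u v y \<noteq> ?G v u y"
  \<comment> \<open>Half of the supposed gap: a number cannot be closer than \<open>e\<close> to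
    both values.\<close>
  define e where "e = \<bar>?G u v y - ?G v u y\<bar> / 2"
  have e: "e > 0" using ne by (simp add: e_def)
  have cont: "isCont (?G u v) y" for u v
    using smooth_on_continuous[OF smooth_on_frd[OF smooth_on_frd[OF f]]]
        continuous_on_eq_continuous_at S by blast
  obtain d1 where d1: "d1 > 0" "\<And>z. dist z y < d1 \<Longrightarrow> dist (?G u v z) (?G u v y) < e"
    using cont[of u v] e unfolding continuous_at_eps_delta by blast
  obtain d2 where d2: "d2 > 0" "\<And>z. dist z y < d2 \<Longrightarrow> dist (?G v u z) (?G v u y) < e"
    using cont[of v u] e unfolding continuous_at_eps_delta by blast
  obtain r where r: "r > 0" "ball y r \<subseteq> S" using S open_contains_ball by blast
  define m where "m = min r (min d1 d2)"
  \<comment> \<open>The summand 1 keeps the denominator positive when \<open>u\<close> and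
    \<open>v\<close> both vanish, and it makes the bound by \<open>m\<close> strict.\<close>
  define h where "h = m / (norm u + norm v + 1)"
  have m: "m > 0" "m \<le> r" "m \<le> d1" "m \<le> d2" using r d1 d2 by (auto simp: m_def)
  have pos: "norm u + norm v + 1 > 0" by (smt (verit) norm_ge_zero)
  have h: "h > 0" "h * (norm u + norm v) < m"
    using m pos by (auto simp: h_def field_simps)
  obtain p where p: "p \<in> cball y (h * (norm u + norm v))"
    "f (y + h *\<^sub>R u + h *\<^sub>R v) - f (y + h *\<^sub>R u) - f (y + h *\<^sub>R v) + f y = h * h * ?G u v p"
    using second_difference[OF f r(2) h(1), of u v] h m by fastforce
  obtain q where q: "q \<in> cball y (h * (norm v + norm u))"
    "f (y + h *\<^sub>R v + h *\<^sub>R u) - f (y + h *\<^sub>R v) - f (y + h *\<^sub>R u) + f y = h * h * ?G v u q"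
    using second_difference[OF f r(2) h(1), of v u] h m by (fastforce simp: add.commute)
  have "y + h *\<^sub>R v + h *\<^sub>R u = y + h *\<^sub>R u + h *\<^sub>R v" by simp
  then have "h * h * ?G u v p = h * h * ?G v u q" using p(2) q(2) by (smt (verit))
  then have "?G u v p = ?G v u q" using h(1) by simp
  moreover have "dist p y < m" "dist q y < m"
    using p(1) q(1) h(2) by (auto simp: dist_commute add.commute)
  then have "dist (?G u v p) (?G u v y) < e" "dist (?G v u q) (?G v u y) < e"
    using d1 d2 m by auto
  ultimately show False unfolding e_def dist_real_def by argo
qed

lemma frd_linear_comp:
  assumes "bounded_linear L" "f differentiable (at y)"
  shows "frd (\<lambda>y. L (f y)) y v = L (frd f y v)"
  using frd_eqI[OF bounded_linear.has_derivative[OF assms(1) frd_has[OF assms(2)]]] by simp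

lemma frd_symmetric:
  fixes f :: "'e::euclidean_space \<Rightarrow> 'v::euclidean_space"
  assumes S: "open S" "y \<in> S" and f: "smooth_on S f"
  shows "frd (\<lambda>z. frd f z u) y v = frd (\<lambda>z. frd f z v) y u"
proof (rule euclidean_eqI)
  fix b :: 'v assume "b \<in> Basis"
  have fb: "smooth_on S (\<lambda>z. f z \<bullet> b)"
    by (rule smooth_on_linear_comp[OF bounded_linear_inner_left S(1) f])
  have *: "frd (\<lambda>z. frd f z u) y v \<bullet> b = frd (\<lambda>z. frd (\<lambda>z. f z \<bullet> b) z u) y v" for u v
  proof -
    have "frd (\<lambda>z. frd f z u) y v \<bullet> b = frd (\<lambda>z. frd f z u \<bullet> b) y v"
      using frd_linear_comp[OF bounded_linear_inner_left smooth_on_differentiable[OF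
          smooth_on_frd[OF f] S(2)]]
      by metis
    also have "\<dots> = frd (\<lambda>z. frd (\<lambda>z. f z \<bullet> b) z u) y v"
      by (rule fun_cong[OF frd_cong[OF S]])
        (simp add: frd_linear_comp[OF bounded_linear_inner_left smooth_on_differentiable[OF f]])
    finally show ?thesis .
  qed
  show "frd (\<lambda>z. frd f z u) y v \<bullet> b = frd (\<lambda>z. frd f z v) y u \<bullet> b"
    using frd_symmetric_real[OF S fb] * by metis
qed

text \<open>The product rule for evaluating a moving linear map on a moving vector. In
  \<open>ext_d_pullback\<close> the map \<open>a\<close> is a form in a target chart,
  \<open>g\<close> is the coordinate expression of a smooth map, and \<open>w\<close> is the
  derivative of \<open>g\<close> in a fixed direction.\<close>

lemma frd_linear_family:
  fixes a :: "'g::euclidean_space \<Rightarrow> 'g \<Rightarrow> 'v::real_normed_vector"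
  assumes T: "open T" "g y \<in> T" and lin: "\<And>z. z \<in> T \<Longrightarrow> linear (a z)"
    and da: "\<And>w. (\<lambda>z. a z w) differentiable (at (g y))"
    and dg: "g differentiable (at y)" and dw: "w differentiable (at y)"
  shows "frd (\<lambda>y. a (g y) (w y)) y u = frd (\<lambda>z. a z (w y)) (g y) (frd g y u) + a (g y) (frd w y u)"
proof -
  let ?F = "\<lambda>y. \<Sum>i\<in>Basis. (w y \<bullet> i) *\<^sub>R a (g y) i"
  \<comment> \<open>Linearity of \<open>a z\<close> is available for \<open>z\<close> in
    \<open>T\<close> only, so the basis expansion is differentiated on a neighbourhood that
    \<open>g\<close> maps into \<open>T\<close>.\<close>
  obtain R where R: "open R" "y \<in> R" "g ` R \<subseteq> T"
  proof -
    have "isCont g y" using dg differentiable_imp_continuous_within by blast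
    then obtain R where "open R" "y \<in> R" "\<forall>z\<in>R. g z \<in> T"
      using T continuous_at_open[of y g] by blast
    then show thesis using that by blast
  qed
  have "frd (\<lambda>y. a (g y) (w y)) y u = frd ?F y u"
    by (rule fun_cong[OF frd_cong[OF R(1,2)]]) (use R(3) in \<open>auto intro!: linear_Basis_expand lin\<close>)
  also have "\<dots> = (\<Sum>i\<in>Basis. (w y \<bullet> i) *\<^sub>R frd (\<lambda>z. a z i) (g y) (frd g y u) + (frd w y u \<bullet> i) *\<^sub>R a
      (g y) i)"
  proof -
    have ga: "((\<lambda>y. a (g y) i) has_derivative (\<lambda>u. frd (\<lambda>z. a z i) (g y) (frd g y u))) (at y)" for i
      by (rule has_derivative_compose[OF frd_has[OF dg] frd_has[OF da]])
    have wi: "((\<lambda>y. w y \<bullet> i) has_derivative (\<lambda>u. frd w y u \<bullet> i)) (at y)" for i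
      by (rule has_derivative_inner_left[OF frd_has[OF dw]])
    have "(?F has_derivative (\<lambda>u. \<Sum>i\<in>Basis. (w y \<bullet> i) *\<^sub>R frd (\<lambda>z. a z i) (g y) (frd g y u)
        + (frd w y u \<bullet> i) *\<^sub>R a (g y) i)) (at y)"
      by (intro has_derivative_sum has_derivative_scaleR ga wi)
    from frd_eqI[OF this] show ?thesis by simp
  qed
  also have "\<dots> = (\<Sum>i\<in>Basis. (w y \<bullet> i) *\<^sub>R frd (\<lambda>z. a z i) (g y) (frd g y u))
      + (\<Sum>i\<in>Basis. (frd w y u \<bullet> i) *\<^sub>R a (g y) i)"
    by (rule sum.distrib)
  also have "(\<Sum>i\<in>Basis. (frd w y u \<bullet> i) *\<^sub>R a (g y) i) = a (g y) (frd w y u)"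
    by (rule linear_Basis_expand[OF lin[OF T(2)], symmetric])
  also have "(\<Sum>i\<in>Basis. (w y \<bullet> i) *\<^sub>R frd (\<lambda>z. a z i) (g y) (frd g y u)) = frd (\<lambda>z. a z (w y)) (g y)
      (frd g y u)"
  proof -
    have "frd (\<lambda>z. a z (w y)) (g y) = frd (\<lambda>z. \<Sum>i\<in>Basis. (w y \<bullet> i) *\<^sub>R a z i) (g y)"
      by (rule frd_cong[OF T]) (rule linear_Basis_expand[OF lin])
    also have "\<dots> = (\<lambda>x. \<Sum>i\<in>Basis. (w y \<bullet> i) *\<^sub>R frd (\<lambda>z. a z i) (g y) x)"
      by (rule frd_eqI) (intro has_derivative_sum has_derivative_scaleR_right frd_has da)
    finally show ?thesis by simp
  qed
  finally show ?thesis .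
qed

lemma smooth_on_linear_family:
  fixes a :: "'g::euclidean_space \<Rightarrow> 'g \<Rightarrow> 'v::real_normed_vector" and g :: "'e::euclidean_space \<Rightarrow> 'g"
  assumes S: "open S" and T: "open T" "g ` S \<subseteq> T" and lin: "\<And>z. z \<in> T \<Longrightarrow> linear (a z)"
    and da: "\<And>w. smooth_on T (\<lambda>z. a z w)" and dg: "smooth_on S g" and dw: "smooth_on S w"
  shows "smooth_on S (\<lambda>y. a (g y) (w y))"
proof -
  have "smooth_on S (\<lambda>y. \<Sum>i\<in>Basis. (w y \<bullet> i) *\<^sub>R a (g y) i)"
    by (intro smooth_on_sum S smooth_on_scaleR smooth_on_linear_comp[OF bounded_linear_inner_left S
        dw]
        smooth_on_compose[OF S T da dg]) auto
  then show ?thesis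
    by (rule smooth_on_cong[OF S, rotated]) (use T(2) linear_Basis_expand[OF lin] in \<open>force\<close>)
qed

section \<open>Charts\<close>

text \<open>The part of \<open>smooth_manifold\<close> that is about charts, so that nothing else has to be checked for
  the half-line bundle.\<close>

definition smooth_atlas :: "('a, 'e::euclidean_space) mfd \<Rightarrow> bool" where
  "smooth_atlas M \<longleftrightarrow>
     points M = (\<Union>c\<in>charts M. chart_dom M c) \<and>
     (\<forall>c\<in>charts M. openin (mtop M) (chart_dom M c) \<and> open (chart_img M c) \<and>
        homeomorphic_map (subtopology (mtop M) (chart_dom M c)) (top_of_set (chart_img M c))
          (snd c)) \<and>
     (\<forall>c\<in>charts M. \<forall>c'\<in>charts M.
        smooth_on (snd c ` (chart_dom M c \<inter> chart_dom M c')) (snd c' \<circ> param M c))"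

lemma smooth_manifold_atlas: "smooth_manifold M \<Longrightarrow> smooth_atlas M"
  unfolding smooth_manifold_def smooth_atlas_def by blast

lemma chart_in_img: "x \<in> chart_dom M c \<Longrightarrow> snd c x \<in> chart_img M c"
  by (simp add: chart_img_def)

lemma param_in_dom: "y \<in> chart_img M c \<Longrightarrow> param M c y \<in> chart_dom M c"
  unfolding chart_img_def param_def by (rule inv_into_into)

lemma chart_param: "y \<in> chart_img M c \<Longrightarrow> snd c (param M c y) = y"
  unfolding chart_img_def param_def by (rule f_inv_into_f)

lemma dom_subset_points: "chart_dom M c \<subseteq> points M"
  by (simp add: chart_dom_def)

context
  fixes M :: "('a, 'e::euclidean_space) mfd"
  assumes M: "smooth_atlas M"
begin

lemma atlas_cover: "x \<in> points M \<Longrightarrow> \<exists>c\<in>charts M. x \<in> chart_dom M c"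
  using M unfolding smooth_atlas_def by blast

lemma dom_open: "c \<in> charts M \<Longrightarrow> openin (mtop M) (chart_dom M c)"
  using M unfolding smooth_atlas_def by blast

lemma img_open: "c \<in> charts M \<Longrightarrow> open (chart_img M c)"
  using M unfolding smooth_atlas_def by blast

lemma chart_homeo: "c \<in> charts M \<Longrightarrow>
    homeomorphic_map (subtopology (mtop M) (chart_dom M c)) (top_of_set (chart_img M c)) (snd c)"
  using M unfolding smooth_atlas_def by blast

lemma transition_smooth: "c \<in> charts M \<Longrightarrow> c' \<in> charts M \<Longrightarrow>
    smooth_on (snd c ` (chart_dom M c \<inter> chart_dom M c')) (snd c' \<circ> param M c)"
  using M unfolding smooth_atlas_def by blast

lemma topspace_dom: "topspace (subtopology (mtop M) (chart_dom M c)) = chart_dom M c"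
  by (auto simp: chart_dom_def points_def)

lemma chart_inj: "c \<in> charts M \<Longrightarrow> inj_on (snd c) (chart_dom M c)"
  using homeomorphic_imp_injective_map[OF chart_homeo] topspace_dom by metis

lemma param_chart: "c \<in> charts M \<Longrightarrow> x \<in> chart_dom M c \<Longrightarrow> param M c (snd c x) = x"
  unfolding param_def by (rule inv_into_f_f[OF chart_inj])

lemma chart_image_open:
  assumes c: "c \<in> charts M" and V: "openin (mtop M) V"
  shows "open (snd c ` (chart_dom M c \<inter> V))"
proof -
  have "openin (subtopology (mtop M) (chart_dom M c)) (chart_dom M c \<inter> V)"
    using V by (metis openin_subtopology_Int Int_commute)
  then have "openin (top_of_set (chart_img M c)) (snd c ` (chart_dom M c \<inter> V))"
    using homeomorphic_imp_open_map[OF chart_homeo[OF c]] by (simp add: open_map_def)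
  then show ?thesis using openin_open_eq[OF img_open[OF c]] by blast
qed

lemma chart_vimage_open:
  assumes c: "c \<in> charts M" and V: "open V"
  shows "openin (mtop M) {x \<in> chart_dom M c. snd c x \<in> V}"
proof -
  have "openin (top_of_set (chart_img M c)) (chart_img M c \<inter> V)"
    using V by (auto simp: openin_open)
  then have "openin (subtopology (mtop M) (chart_dom M c)) {x \<in> chart_dom M c. snd c x \<in> chart_img M
      c \<inter> V}"
    using homeomorphic_imp_continuous_map[OF chart_homeo[OF c]] topspace_dom
    unfolding continuous_map_def by metis
  moreover have "{x \<in> chart_dom M c. snd c x \<in> chart_img M c \<inter> V} = {x \<in> chart_dom M c. snd c x \<in>
      V}"
    by (auto simp: chart_in_img)
  ultimately show ?thesis using dom_open[OF c] openin_trans_full by metis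
qed

text \<open>Used to cut out open sets by conditions on the values of smooth functions, and to turn
  connectedness into constancy of signs.\<close>

lemma smooth_fun_continuous:
  assumes f: "smooth_fun M f"
  shows "continuous_map (mtop M) euclidean f"
proof -
  have "openin (mtop M) {x \<in> topspace (mtop M). f x \<in> V}" if V: "open V" for V
  proof -
    have eq: "{x \<in> topspace (mtop M). f x \<in> V} =
        (\<Union>c\<in>charts M. {x \<in> chart_dom M c. snd c x \<in> chart_img M c \<inter> (f \<circ> param M c) -` V})"
      using atlas_cover param_chart chart_in_img dom_subset_points
      by (fastforce simp: points_def)
    have "openin (mtop M) {x \<in> chart_dom M c. snd c x \<in> chart_img M c \<inter> (f \<circ> param M c) -` V}"
      if c: "c \<in> charts M" for c
      by (intro chart_vimage_open c continuous_open_preimage img_open V smooth_on_continuous)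
        (use f c in \<open>auto simp: smooth_fun_def\<close>)
    then show ?thesis unfolding eq by auto
  qed
  then show ?thesis by (simp add: continuous_map_def)
qed

end

lemma form_eqI: "(\<And>c x v. c \<in> charts M \<Longrightarrow> x \<in> chart_dom M c \<Longrightarrow> \<alpha> c x v = \<beta> c x v) \<Longrightarrow> \<alpha> \<doteq>\<^bsub>M\<^esub> \<beta>"
  by (simp add: form_eq_def)

lemma form_eqD: "\<alpha> \<doteq>\<^bsub>M\<^esub> \<beta> \<Longrightarrow> c \<in> charts M \<Longrightarrow> x \<in> chart_dom M c \<Longrightarrow> \<alpha> c x v = \<beta> c x v"
  by (simp add: form_eq_def)

lemma form_eq_refl: "\<alpha> \<doteq>\<^bsub>M\<^esub> \<alpha>"
  by (simp add: form_eq_def)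

lemma form_eq_sym: "\<alpha> \<doteq>\<^bsub>M\<^esub> \<beta> \<Longrightarrow> \<beta> \<doteq>\<^bsub>M\<^esub> \<alpha>"
  by (simp add: form_eq_def)

lemma form_eq_trans: "\<alpha> \<doteq>\<^bsub>M\<^esub> \<beta> \<Longrightarrow> \<beta> \<doteq>\<^bsub>M\<^esub> \<gamma> \<Longrightarrow> \<alpha> \<doteq>\<^bsub>M\<^esub> \<gamma>"
  by (simp add: form_eq_def)

section \<open>Smooth maps\<close>

text \<open>The differential of \<open>\<psi>\<close> in a pair of charts. It takes the point
  \<open>x\<close> rather than its coordinates, because the forms it is composed with are indexed by
  points.\<close>

definition tangent_map :: "('a, 'e::euclidean_space) mfd \<Rightarrow> ('a \<Rightarrow> 'b) \<Rightarrow> ('a, 'e) chart \<Rightarrow>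
    ('b, 'g::euclidean_space) chart \<Rightarrow> 'a \<Rightarrow> 'e \<Rightarrow> 'g" where
  "tangent_map M \<psi> c c' x = frd (snd c' \<circ> \<psi> \<circ> param M c) (snd c x)"

context
  fixes M :: "('a, 'e::euclidean_space) mfd" and N :: "('b, 'g::euclidean_space) mfd" and \<psi> :: "'a \<Rightarrow>
      'b"
  assumes M: "smooth_atlas M" and N: "smooth_atlas N" and \<psi>: "smooth_map M N \<psi>"
begin

lemma smooth_map_points: "x \<in> points M \<Longrightarrow> \<psi> x \<in> points N"
  using \<psi> unfolding smooth_map_def continuous_map_def points_def by blast

lemma smooth_map_region_open:
  assumes "c \<in> charts M" "c' \<in> charts N"
  shows "open (snd c ` {x \<in> chart_dom M c. \<psi> x \<in> chart_dom N c'})"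
proof -
  have "openin (mtop M) {x \<in> topspace (mtop M). \<psi> x \<in> chart_dom N c'}"
    using \<psi> dom_open[OF N assms(2)] unfolding smooth_map_def continuous_map_def by blast
  moreover have "chart_dom M c \<inter> {x \<in> topspace (mtop M). \<psi> x \<in> chart_dom N c'} = {x \<in> chart_dom M c.
      \<psi> x \<in> chart_dom N c'}"
    by (auto simp: chart_dom_def points_def)
  ultimately show ?thesis using chart_image_open[OF M assms(1)] by metis
qed

lemma smooth_map_region_smooth:
  "c \<in> charts M \<Longrightarrow> c' \<in> charts N \<Longrightarrow>
   smooth_on (snd c ` {x \<in> chart_dom M c. \<psi> x \<in> chart_dom N c'}) (snd c' \<circ> \<psi> \<circ> param M c)"
  using \<psi> unfolding smooth_map_def by blast

lemma smooth_map_differentiable: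
  assumes "c \<in> charts M" "c' \<in> charts N" "x \<in> chart_dom M c" "\<psi> x \<in> chart_dom N c'"
  shows "(snd c' \<circ> \<psi> \<circ> param M c) differentiable (at (snd c x))"
  by (rule smooth_on_differentiable[OF smooth_map_region_smooth[OF assms(1,2)]]) (use assms in auto)

lemma tangent_map_linear:
  assumes "c \<in> charts M" "c' \<in> charts N" "x \<in> chart_dom M c" "\<psi> x \<in> chart_dom N c'"
  shows "linear (tangent_map M \<psi> c c' x)"
  unfolding tangent_map_def by (rule linear_frechet_derivative[OF smooth_map_differentiable[OF
      assms]])

lemma smooth_fun_compose:
  assumes f: "smooth_fun N f"
  shows "smooth_fun M (\<lambda>x. f (\<psi> x))"
  unfolding smooth_fun_def
proof
  fix c assume c: "c \<in> charts M"
  show "smooth_on (chart_img M c) ((\<lambda>x. f (\<psi> x)) \<circ> param M c)"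
  proof (rule smooth_on_local)
    fix y assume y: "y \<in> chart_img M c"
    have "\<psi> (param M c y) \<in> points N"
      by (rule smooth_map_points[OF subsetD[OF dom_subset_points param_in_dom[OF y]]])
    then obtain c' where c': "c' \<in> charts N" "\<psi> (param M c y) \<in> chart_dom N c'"
      using atlas_cover[OF N] by blast
    let ?R = "snd c ` {x \<in> chart_dom M c. \<psi> x \<in> chart_dom N c'}"
    have R: "open ?R" by (rule smooth_map_region_open[OF c c'(1)])
    have "smooth_on ?R (\<lambda>y. (f \<circ> param N c') ((snd c' \<circ> \<psi> \<circ> param M c) y))"
    proof (rule smooth_on_compose[OF R img_open[OF N c'(1)] _ _ smooth_map_region_smooth[OF c
        c'(1)]])
      show "(snd c' \<circ> \<psi> \<circ> param M c) ` ?R \<subseteq> chart_img N c'"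
        using param_chart[OF M c] chart_in_img by fastforce
      show "smooth_on (chart_img N c') (f \<circ> param N c')" using f c' by (simp add: smooth_fun_def)
    qed
    then have "smooth_on ?R ((\<lambda>x. f (\<psi> x)) \<circ> param M c)"
      by (rule smooth_on_cong[OF R, rotated])
        (use param_chart[OF M c] param_chart[OF N c'(1)] in auto)
    moreover have "y \<in> ?R"
      using param_in_dom[OF y] chart_param[OF y] c'(2)
      by (metis (mono_tags, lifting) image_eqI mem_Collect_eq)
    ultimately show "\<exists>T. open T \<and> y \<in> T \<and> smooth_on T ((\<lambda>x. f (\<psi> x)) \<circ> param M c)"
      using R by blast
  qed
qed

lemma tangent_map_transition:
  assumes c: "c \<in> charts M" and c': "c' \<in> charts N" "c'' \<in> charts N"
    and x: "x \<in> chart_dom M c" "\<psi> x \<in> chart_dom N c'" "\<psi> x \<in> chart_dom N c''"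
  shows "tangent_map M \<psi> c c'' x v = frd (snd c'' \<circ> param N c') (snd c' (\<psi> x)) (tangent_map M \<psi> c c'
      x v)"
proof -
  let ?g = "snd c' \<circ> \<psi> \<circ> param M c" and ?h = "snd c'' \<circ> param N c'"
  let ?R = "snd c ` {x \<in> chart_dom M c. \<psi> x \<in> chart_dom N c'}"
  have R: "open ?R" "snd c x \<in> ?R" using smooth_map_region_open[OF c c'(1)] x by auto
  have px: "?g (snd c x) = snd c' (\<psi> x)" using param_chart[OF M c x(1)] by simp
  have "tangent_map M \<psi> c c'' x = frd (\<lambda>y. ?h (?g y)) (snd c x)"
    unfolding tangent_map_def
    by (rule frd_cong[OF R]) (use param_chart[OF M c] param_chart[OF N c'(1)] in auto)
  moreover have "?h differentiable (at (?g (snd c x)))"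
    unfolding px by (rule smooth_on_differentiable[OF transition_smooth[OF N c']]) (use x in auto)
  ultimately show ?thesis
    using frd_compose[of ?h ?g "snd c x" v] smooth_map_differentiable[OF c c'(1) x(1,2)] px
    unfolding tangent_map_def by simp
qed

text \<open>\<open>pullback\<close> selects its target chart by choice. The transition law of
  \<open>\<alpha>\<close> absorbs the change to any other chart around \<open>\<psi> x\<close>, so
  computations may use whichever chart is at hand.\<close>

lemma pullback_eq:
  assumes \<alpha>: "one_form N \<alpha>" and c: "c \<in> charts M" and c': "c' \<in> charts N"
    and x: "x \<in> chart_dom M c" "\<psi> x \<in> chart_dom N c'"
  shows "pullback M N \<psi> \<alpha> c x v = \<alpha> c' (\<psi> x) (tangent_map M \<psi> c c' x v)"
proof -
  define d where "d = (SOME c'. c' \<in> charts N \<and> \<psi> x \<in> chart_dom N c')"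
  have d: "d \<in> charts N" "\<psi> x \<in> chart_dom N d"
    using someI[of "\<lambda>c'. c' \<in> charts N \<and> \<psi> x \<in> chart_dom N c'", OF conjI[OF c' x(2)]]
    unfolding d_def by auto
  have "pullback M N \<psi> \<alpha> c x v = \<alpha> d (\<psi> x) (tangent_map M \<psi> c d x v)"
    by (simp add: pullback_def tangent_map_def d_def Let_def)
  also have "\<dots> = \<alpha> d (\<psi> x) (frd (snd d \<circ> param N c') (snd c' (\<psi> x)) (tangent_map M \<psi> c c' x v))"
    using tangent_map_transition[OF c c' d(1) x d(2)] by simp
  also have "\<dots> = \<alpha> c' (\<psi> x) (tangent_map M \<psi> c c' x v)"
    using \<alpha> c' d x(2) unfolding one_form_def by (metis IntI)
  finally show ?thesis .
qed

text \<open>The chain rule for a change of charts on the source; this is the transition law that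
  makes a pullback a 1-form.\<close>

lemma tangent_map_source:
  assumes c: "c \<in> charts M" "d \<in> charts M" and c': "c' \<in> charts N"
    and x: "x \<in> chart_dom M c" "x \<in> chart_dom M d" "\<psi> x \<in> chart_dom N c'"
  shows "tangent_map M \<psi> c c' x v = tangent_map M \<psi> d c' x (frd (snd d \<circ> param M c) (snd c x) v)"
proof -
  let ?g = "snd d \<circ> param M c" and ?h = "snd c' \<circ> \<psi> \<circ> param M d"
  let ?R = "snd c ` (chart_dom M c \<inter> chart_dom M d)"
  have R: "open ?R" "snd c x \<in> ?R" using chart_image_open[OF M c(1) dom_open[OF M c(2)]] x by auto
  have px: "?g (snd c x) = snd d x" using param_chart[OF M c(1) x(1)] by simp
  have "tangent_map M \<psi> c c' x = frd (\<lambda>y. ?h (?g y)) (snd c x)"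
    unfolding tangent_map_def
    by (rule frd_cong[OF R]) (use param_chart[OF M c(1)] param_chart[OF M c(2)] in auto)
  moreover have "?g differentiable (at (snd c x))"
    by (rule smooth_on_differentiable[OF transition_smooth[OF M c] R(2)])
  ultimately show ?thesis
    using frd_compose[of ?h ?g "snd c x" v] smooth_map_differentiable[OF c(2) c' x(2,3)] px
    unfolding tangent_map_def by simp
qed

end

section \<open>Calculus of forms\<close>

lemmas form_simps = smul_def cconj_def wedge_def wedge12_def plus_fun_def zero_fun_def fun_diff_def

lemma frd_add:
  assumes "f differentiable (at y)" "g differentiable (at y)"
  shows "frd (\<lambda>y. f y + g y) y v = frd f y v + frd g y v"
  by (rule fun_cong[OF frd_eqI[OF has_derivative_add[OF frd_has frd_has]], OF assms])

lemma frd_diff: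
  assumes "f differentiable (at y)" "g differentiable (at y)"
  shows "frd (\<lambda>y. f y - g y) y v = frd f y v - frd g y v"
  by (rule fun_cong[OF frd_eqI[OF has_derivative_diff[OF frd_has frd_has]], OF assms])

lemma frd_mult:
  fixes f g :: "'e::real_normed_vector \<Rightarrow> 'v::real_normed_algebra"
  assumes "f differentiable (at y)" "g differentiable (at y)"
  shows "frd (\<lambda>y. f y * g y) y v = f y * frd g y v + frd f y v * g y"
  by (rule fun_cong[OF frd_eqI[OF has_derivative_mult[OF frd_has frd_has]], OF assms])

lemma param_in_points: "y \<in> chart_img M c \<Longrightarrow> param M c y \<in> points M"
  by (rule subsetD[OF dom_subset_points param_in_dom])

section \<open>Smooth functions and 1-forms on a manifold\<close>

lemma smooth_fun_linear:
  assumes M: "smooth_atlas M" and L: "bounded_linear L" and f: "smooth_fun M f"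
  shows "smooth_fun M (\<lambda>x. L (f x))"
  using f smooth_on_linear_comp[OF L img_open[OF M]] unfolding smooth_fun_def o_def by blast

lemma smooth_fun_const: "smooth_fun M (\<lambda>_. a)"
  by (simp add: smooth_fun_def o_def)

lemma smooth_fun_cong:
  assumes M: "smooth_atlas M" and f: "smooth_fun M f" and eq: "\<And>x. x \<in> points M \<Longrightarrow> f x = g x"
  shows "smooth_fun M g"
  unfolding smooth_fun_def
proof
  fix c assume c: "c \<in> charts M"
  show "smooth_on (chart_img M c) (g \<circ> param M c)"
    by (rule smooth_on_cong[OF img_open[OF M c], of "f \<circ> param M c"])
      (use f c eq in \<open>auto simp: smooth_fun_def param_in_points\<close>)
qed

context
  fixes M :: "('a, 'e::euclidean_space) mfd"
  assumes M: "smooth_atlas M"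
begin

lemma smooth_fun_add: "smooth_fun M f \<Longrightarrow> smooth_fun M g \<Longrightarrow> smooth_fun M (\<lambda>x. f x + g x)"
  using smooth_on_add[OF img_open[OF M]] unfolding smooth_fun_def o_def by blast

lemma smooth_fun_diff: "smooth_fun M f \<Longrightarrow> smooth_fun M g \<Longrightarrow> smooth_fun M (\<lambda>x. f x - g x)"
  using smooth_on_diff[OF img_open[OF M]] unfolding smooth_fun_def o_def by blast

lemma smooth_fun_mult:
  fixes f g :: "'a \<Rightarrow> 'v::real_normed_algebra"
  shows "smooth_fun M f \<Longrightarrow> smooth_fun M g \<Longrightarrow> smooth_fun M (\<lambda>x. f x * g x)"
  using smooth_on_mult[OF img_open[OF M]] unfolding smooth_fun_def o_def by blast

lemma smooth_fun_inverse:
  fixes f :: "'a \<Rightarrow> 'v::{euclidean_space,real_normed_field}"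
  assumes "smooth_fun M f" "\<And>x. x \<in> points M \<Longrightarrow> f x \<noteq> 0"
  shows "smooth_fun M (\<lambda>x. inverse (f x))"
  unfolding smooth_fun_def o_def
  by (intro ballI smooth_on_inverse img_open[OF M])
    (use assms in \<open>simp_all add: smooth_fun_def o_def param_in_points\<close>)

lemma smooth_fun_divide:
  fixes f g :: "'a \<Rightarrow> 'v::{euclidean_space,real_normed_field}"
  assumes "smooth_fun M f" "smooth_fun M g" "\<And>x. x \<in> points M \<Longrightarrow> g x \<noteq> 0"
  shows "smooth_fun M (\<lambda>x. f x / g x)"
  using smooth_fun_mult[OF assms(1) smooth_fun_inverse[OF assms(2,3)]] by (simp add: divide_inverse)

lemma smooth_fun_of_real: "smooth_fun M f \<Longrightarrow> smooth_fun M (\<lambda>x. complex_of_real (f x))"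
  by (rule smooth_fun_linear[OF M bounded_linear_of_real])

lemma smooth_fun_Re: "smooth_fun M f \<Longrightarrow> smooth_fun M (\<lambda>x. Re (f x))"
  by (rule smooth_fun_linear[OF M bounded_linear_Re])

lemma smooth_fun_Im: "smooth_fun M f \<Longrightarrow> smooth_fun M (\<lambda>x. Im (f x))"
  by (rule smooth_fun_linear[OF M bounded_linear_Im])

lemma smooth_fun_differentiable:
  "smooth_fun M f \<Longrightarrow> c \<in> charts M \<Longrightarrow> x \<in> chart_dom M c \<Longrightarrow> (f \<circ> param M c) differentiable (at (snd c
      x))"
  by (rule smooth_on_differentiable[OF _ chart_in_img]) (simp_all add: smooth_fun_def)

lemma one_form_linear: "one_form M \<alpha> \<Longrightarrow> c \<in> charts M \<Longrightarrow> x \<in> chart_dom M c \<Longrightarrow> linear (\<alpha> c x)"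
  unfolding one_form_def by blast

lemma one_form_smooth: "one_form M \<alpha> \<Longrightarrow> c \<in> charts M \<Longrightarrow>
    smooth_on (chart_img M c) (\<lambda>y. \<alpha> c (param M c y) v)"
  unfolding one_form_def by blast

lemma one_form_transition: "one_form M \<alpha> \<Longrightarrow> c \<in> charts M \<Longrightarrow> c' \<in> charts M \<Longrightarrow>
    x \<in> chart_dom M c \<Longrightarrow> x \<in> chart_dom M c' \<Longrightarrow>
    \<alpha> c x v = \<alpha> c' x (frd (snd c' \<circ> param M c) (snd c x) v)"
  unfolding one_form_def by blast

lemma one_form_differentiable: "one_form M \<alpha> \<Longrightarrow> c \<in> charts M \<Longrightarrow> x \<in> chart_dom M c \<Longrightarrow>
    (\<lambda>y. \<alpha> c (param M c y) v) differentiable (at (snd c x))"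
  by (rule smooth_on_differentiable[OF one_form_smooth chart_in_img])

lemma one_formI:
  assumes "\<And>c x. c \<in> charts M \<Longrightarrow> x \<in> chart_dom M c \<Longrightarrow> linear (\<alpha> c x)"
    and "\<And>c v. c \<in> charts M \<Longrightarrow> smooth_on (chart_img M c) (\<lambda>y. \<alpha> c (param M c y) v)"
    and "\<And>c c' x v. c \<in> charts M \<Longrightarrow> c' \<in> charts M \<Longrightarrow> x \<in> chart_dom M c \<Longrightarrow> x \<in> chart_dom M c' \<Longrightarrow>
      \<alpha> c x v = \<alpha> c' x (frd (snd c' \<circ> param M c) (snd c x) v)"
  shows "one_form M \<alpha>"
  unfolding one_form_def by (intro ballI conjI allI; (rule assms(1) assms(2) assms(3)); auto)

lemma one_form_cong:
  assumes \<alpha>: "one_form M \<alpha>" and eq: "\<alpha> \<doteq>\<^bsub>M\<^esub> \<beta>"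
  shows "one_form M \<beta>"
proof (rule one_formI)
  fix c x assume "c \<in> charts M" "x \<in> chart_dom M c"
  then have "\<alpha> c x = \<beta> c x" using form_eqD[OF eq] by blast
  then show "linear (\<beta> c x)" using one_form_linear[OF \<alpha> \<open>c \<in> charts M\<close> \<open>x \<in> chart_dom M c\<close>] by simp
next
  fix c v assume c: "c \<in> charts M"
  show "smooth_on (chart_img M c) (\<lambda>y. \<beta> c (param M c y) v)"
    by (rule smooth_on_cong[OF img_open[OF M c] _ one_form_smooth[OF \<alpha> c]])
      (rule form_eqD[OF eq c param_in_dom])
next
  fix c c' x v assume "c \<in> charts M" "c' \<in> charts M" "x \<in> chart_dom M c" "x \<in> chart_dom M c'"
  then show "\<beta> c x v = \<beta> c' x (frd (snd c' \<circ> param M c) (snd c x) v)"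
    using one_form_transition[OF \<alpha>] form_eqD[OF eq] by metis
qed

lemma one_form_smul:
  assumes f: "smooth_fun M f" and \<alpha>: "one_form M \<alpha>"
  shows "one_form M (f \<odot> \<alpha>)"
proof (rule one_formI)
  fix c x assume "c \<in> charts M" "x \<in> chart_dom M c"
  from one_form_linear[OF \<alpha> this] show "linear ((f \<odot> \<alpha>) c x)"
    unfolding smul_def by (auto simp: linear_iff algebra_simps)
next
  fix c v assume c: "c \<in> charts M"
  show "smooth_on (chart_img M c) (\<lambda>y. (f \<odot> \<alpha>) c (param M c y) v)"
    using smooth_on_mult[OF img_open[OF M c] _ one_form_smooth[OF \<alpha> c]] f c
    unfolding smul_def smooth_fun_def o_def by blast
next
  fix c c' x v assume "c \<in> charts M" "c' \<in> charts M" "x \<in> chart_dom M c" "x \<in> chart_dom M c'"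
  from one_form_transition[OF \<alpha> this]
  show "(f \<odot> \<alpha>) c x v = (f \<odot> \<alpha>) c' x (frd (snd c' \<circ> param M c) (snd c x) v)"
    by (simp add: smul_def)
qed

lemma one_form_add:
  assumes \<alpha>: "one_form M \<alpha>" and \<beta>: "one_form M \<beta>"
  shows "one_form M (\<alpha> + \<beta>)"
proof (rule one_formI)
  fix c x assume "c \<in> charts M" "x \<in> chart_dom M c"
  from one_form_linear[OF \<alpha> this] one_form_linear[OF \<beta> this] show "linear ((\<alpha> + \<beta>) c x)"
    unfolding plus_fun_def by (auto simp: linear_iff algebra_simps)
next
  fix c v assume c: "c \<in> charts M"
  show "smooth_on (chart_img M c) (\<lambda>y. (\<alpha> + \<beta>) c (param M c y) v)"
    using smooth_on_add[OF img_open[OF M c] one_form_smooth[OF \<alpha> c] one_form_smooth[OF \<beta> c]]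
    unfolding plus_fun_def by blast
next
  fix c c' x v assume "c \<in> charts M" "c' \<in> charts M" "x \<in> chart_dom M c" "x \<in> chart_dom M c'"
  from one_form_transition[OF \<alpha> this] one_form_transition[OF \<beta> this]
  show "(\<alpha> + \<beta>) c x v = (\<alpha> + \<beta>) c' x (frd (snd c' \<circ> param M c) (snd c x) v)"
    by (simp add: plus_fun_def)
qed

lemma one_form_cconj:
  assumes \<alpha>: "one_form M \<alpha>"
  shows "one_form M (cconj \<alpha>)"
proof (rule one_formI)
  fix c x assume "c \<in> charts M" "x \<in> chart_dom M c"
  from one_form_linear[OF \<alpha> this] show "linear (cconj \<alpha> c x)"
    unfolding cconj_def by (auto simp: linear_iff)
next
  fix c v assume c: "c \<in> charts M"
  show "smooth_on (chart_img M c) (\<lambda>y. cconj \<alpha> c (param M c y) v)"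
    using smooth_on_linear_comp[OF bounded_linear_cnj img_open[OF M c] one_form_smooth[OF \<alpha> c]]
    unfolding cconj_def by blast
next
  fix c c' x v assume "c \<in> charts M" "c' \<in> charts M" "x \<in> chart_dom M c" "x \<in> chart_dom M c'"
  from one_form_transition[OF \<alpha> this]
  show "cconj \<alpha> c x v = cconj \<alpha> c' x (frd (snd c' \<circ> param M c) (snd c x) v)"
    by (simp add: cconj_def)
qed

lemma dfun_param: "y \<in> chart_img M c \<Longrightarrow> dfun M f c (param M c y) v = frd (f \<circ> param M c) y v"
  by (simp add: dfun_def chart_param)

lemma one_form_dfun:
  assumes f: "smooth_fun M f"
  shows "one_form M (dfun M f)"
proof (rule one_formI)
  fix c x assume "c \<in> charts M" "x \<in> chart_dom M c"
  from linear_frechet_derivative[OF smooth_fun_differentiable[OF f this]]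
  show "linear (dfun M f c x)" unfolding dfun_def .
next
  fix c v assume c: "c \<in> charts M"
  have "smooth_on (chart_img M c) (\<lambda>y. frd (f \<circ> param M c) y v)"
    by (rule smooth_on_frd) (use f c in \<open>simp add: smooth_fun_def\<close>)
  then show "smooth_on (chart_img M c) (\<lambda>y. dfun M f c (param M c y) v)"
    by (rule smooth_on_cong[OF img_open[OF M c], rotated]) (simp add: dfun_param)
next
  fix c c' x v assume c: "c \<in> charts M" "c' \<in> charts M" "x \<in> chart_dom M c" "x \<in> chart_dom M c'"
  let ?R = "snd c ` (chart_dom M c \<inter> chart_dom M c')"
  have R: "open ?R" "snd c x \<in> ?R" using chart_image_open[OF M c(1) dom_open[OF M c(2)]] c by auto
  have "frd (f \<circ> param M c) (snd c x) = frd (\<lambda>y. (f \<circ> param M c') ((snd c' \<circ> param M c) y)) (snd c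
      x)"
    by (rule frd_cong[OF R]) (use param_chart[OF M c(1)] param_chart[OF M c(2)] in auto)
  moreover have px: "(snd c' \<circ> param M c) (snd c x) = snd c' x" using param_chart[OF M c(1,3)] by
      simp
  ultimately show "dfun M f c x v = dfun M f c' x (frd (snd c' \<circ> param M c) (snd c x) v)"
    using frd_compose[of "f \<circ> param M c'" "snd c' \<circ> param M c" "snd c x" v]
      smooth_fun_differentiable[OF f c(2,4)] smooth_on_differentiable[OF transition_smooth[OF M
          c(1,2)] R(2)]
    by (simp add: dfun_def)
qed

lemma dfun_cong:
  assumes "\<And>x. x \<in> points M \<Longrightarrow> f x = g x"
  shows "dfun M f \<doteq>\<^bsub>M\<^esub> dfun M g"
proof (rule form_eqI)
  fix c x v assume c: "c \<in> charts M" "x \<in> chart_dom M c"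
  have "frd (f \<circ> param M c) (snd c x) = frd (g \<circ> param M c) (snd c x)"
    by (rule frd_cong[OF img_open[OF M c(1)] chart_in_img[OF c(2)]])
      (use assms in \<open>simp add: param_in_points\<close>)
  then show "dfun M f c x v = dfun M g c x v" by (simp add: dfun_def)
qed

lemma dfun_const: "dfun M (\<lambda>_. a) c x v = 0"
  by (simp add: dfun_def o_def)

lemma dfun_mult:
  assumes "smooth_fun M f" "smooth_fun M g" "c \<in> charts M" "x \<in> chart_dom M c"
  shows "dfun M (\<lambda>x. f x * g x) c x v = f x * dfun M g c x v + dfun M f c x v * g x"
  using frd_mult[OF smooth_fun_differentiable[OF assms(1,3,4)]
      smooth_fun_differentiable[OF assms(2,3,4)]] param_chart[OF M assms(3,4)]
  by (simp add: dfun_def o_def)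

lemma dfun_add:
  assumes "smooth_fun M f" "smooth_fun M g" "c \<in> charts M" "x \<in> chart_dom M c"
  shows "dfun M (\<lambda>x. f x + g x) c x v = dfun M f c x v + dfun M g c x v"
  using frd_add[OF smooth_fun_differentiable[OF assms(1,3,4)] smooth_fun_differentiable[OF
      assms(2,3,4)]]
  by (simp add: dfun_def o_def)

lemma dfun_linear:
  assumes "bounded_linear L" "smooth_fun M f" "c \<in> charts M" "x \<in> chart_dom M c"
  shows "dfun M (\<lambda>x. L (f x)) c x v = L (dfun M f c x v)"
  using frd_linear_comp[OF assms(1) smooth_fun_differentiable[OF assms(2-4)]]
  by (simp add: dfun_def o_def)

lemma dfun_of_real_Reals:
  assumes "smooth_fun M f" "c \<in> charts M" "x \<in> chart_dom M c"
  shows "dfun M (\<lambda>x. complex_of_real (f x)) c x v \<in> \<real>"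
proof -
  have "dfun M (\<lambda>x. complex_of_real (f x)) c x v = of_real (frd (f \<circ> param M c) (snd c x) v)"
    using frd_linear_comp[OF bounded_linear_of_real[where 'a=complex] smooth_fun_differentiable[OF
        assms], of v]
    by (simp add: dfun_def o_def)
  then show ?thesis by simp
qed

text \<open>Differentiate \<open>f x * inverse (f x) = 1\<close>. This identity holds only at the
  points of \<open>M\<close>, hence the passage through \<open>dfun_cong\<close>.\<close>

lemma dfun_inverse:
  assumes "smooth_fun M f" "\<And>x. x \<in> points M \<Longrightarrow> f x \<noteq> 0" "c \<in> charts M" "x \<in> chart_dom M c"
  shows "dfun M (\<lambda>x. inverse (f x)) c x v = - (dfun M f c x v / (f x)\<^sup>2)"
proof -
  have fx: "f x \<noteq> 0" by (rule assms(2)[OF subsetD[OF dom_subset_points assms(4)]])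
  have "dfun M (\<lambda>x. f x * inverse (f x)) c x v = dfun M (\<lambda>_. 1) c x v"
    by (rule form_eqD[OF dfun_cong assms(3,4)]) (use assms(2) in simp)
  then have "f x * dfun M (\<lambda>x. inverse (f x)) c x v + dfun M f c x v * inverse (f x) = 0"
    using dfun_mult[OF assms(1) smooth_fun_inverse[OF assms(1,2)] assms(3,4), of v] dfun_const by
        simp
  then have "f x * (f x * dfun M (\<lambda>x. inverse (f x)) c x v) = - dfun M f c x v"
    using fx by (simp add: field_simps eq_neg_iff_add_eq_0)
  then show ?thesis using fx by (simp add: field_simps power2_eq_square eq_neg_iff_add_eq_0)
qed

lemma ext_d_cong:
  assumes "\<alpha> \<doteq>\<^bsub>M\<^esub> \<beta>"
  shows "ext_d M \<alpha> \<doteq>\<^bsub>M\<^esub> ext_d M \<beta>"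
proof (rule form_eqI)
  fix c x v assume c: "c \<in> charts M" "x \<in> chart_dom M c"
  have "frd (\<lambda>y. \<alpha> c (param M c y) w) (snd c x) = frd (\<lambda>y. \<beta> c (param M c y) w) (snd c x)" for w
    by (rule frd_cong[OF img_open[OF M c(1)] chart_in_img[OF c(2)]])
      (rule form_eqD[OF assms c(1) param_in_dom])
  then show "ext_d M \<alpha> c x v = ext_d M \<beta> c x v" by (simp add: ext_d_def case_prod_beta)
qed

lemma ext_d_smul:
  assumes f: "smooth_fun M f" and \<alpha>: "one_form M \<alpha>"
  shows "ext_d M (f \<odot> \<alpha>) \<doteq>\<^bsub>M\<^esub> dfun M f \<^bold>\<and> \<alpha> + f \<odot> ext_d M \<alpha>"
proof (rule form_eqI)
  fix c x v assume c: "c \<in> charts M" "x \<in> chart_dom M c"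
  have *: "frd (\<lambda>y. f (param M c y) * \<alpha> c (param M c y) w) (snd c x) u
      = f x * frd (\<lambda>y. \<alpha> c (param M c y) w) (snd c x) u + dfun M f c x u * \<alpha> c x w" for u w
    using frd_mult[OF smooth_fun_differentiable[OF f c, unfolded o_def] one_form_differentiable[OF \<alpha>
        c], of w u]
      param_chart[OF M c]
    by (simp add: dfun_def o_def)
  obtain u w :: 'e where v: "v = (u, w)" by (rule prod.exhaust)
  show "ext_d M (f \<odot> \<alpha>) c x v = (dfun M f \<^bold>\<and> \<alpha> + f \<odot> ext_d M \<alpha>) c x v"
    unfolding v ext_d_def smul_def plus_fun_def wedge_def case_prod_conv *
    by (simp add: algebra_simps)
qed

lemma ext_d_add:
  assumes \<alpha>: "one_form M \<alpha>" and \<beta>: "one_form M \<beta>"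
  shows "ext_d M (\<alpha> + \<beta>) \<doteq>\<^bsub>M\<^esub> ext_d M \<alpha> + ext_d M \<beta>"
proof (rule form_eqI)
  fix c x v assume c: "c \<in> charts M" "x \<in> chart_dom M c"
  have "frd (\<lambda>y. \<alpha> c (param M c y) w + \<beta> c (param M c y) w) (snd c x) u
      = frd (\<lambda>y. \<alpha> c (param M c y) w) (snd c x) u + frd (\<lambda>y. \<beta> c (param M c y) w) (snd c x) u" for u
          w
    by (rule frd_add[OF one_form_differentiable[OF \<alpha> c] one_form_differentiable[OF \<beta> c]])
  then show "ext_d M (\<alpha> + \<beta>) c x v = (ext_d M \<alpha> + ext_d M \<beta>) c x v"
    by (cases v) (simp add: ext_d_def form_simps)
qed

lemma ext_d_cconj:
  assumes \<alpha>: "one_form M \<alpha>"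
  shows "ext_d M (cconj \<alpha>) \<doteq>\<^bsub>M\<^esub> cconj (ext_d M \<alpha>)"
proof (rule form_eqI)
  fix c x v assume c: "c \<in> charts M" "x \<in> chart_dom M c"
  have "frd (\<lambda>y. cnj (\<alpha> c (param M c y) w)) (snd c x) u = cnj (frd (\<lambda>y. \<alpha> c (param M c y) w) (snd c
      x) u)" for u w
    by (rule frd_linear_comp[OF bounded_linear_cnj one_form_differentiable[OF \<alpha> c]])
  then show "ext_d M (cconj \<alpha>) c x v = cconj (ext_d M \<alpha>) c x v"
    by (cases v) (simp add: ext_d_def form_simps)
qed

text \<open>The two terms of the exterior derivative are the two mixed second derivatives of the
  chart expression of \<open>f\<close>.\<close>

lemma ext_d_dfun:
  assumes f: "smooth_fun M f"
  shows "ext_d M (dfun M f) \<doteq>\<^bsub>M\<^esub> 0"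
proof (rule form_eqI)
  fix c x v assume c: "c \<in> charts M" "x \<in> chart_dom M c"
  note op = img_open[OF M c(1)] chart_in_img[OF c(2)]
  have "frd (\<lambda>y. dfun M f c (param M c y) w) (snd c x) = frd (\<lambda>y. frd (f \<circ> param M c) y w) (snd c
      x)" for w
    by (rule frd_cong[OF op]) (simp add: dfun_param)
  moreover have "smooth_on (chart_img M c) (f \<circ> param M c)" using f c by (simp add: smooth_fun_def)
  moreover obtain u w :: 'e where "v = (u, w)" by (rule prod.exhaust)
  ultimately show "ext_d M (dfun M f) c x v = 0 c x v"
    using frd_symmetric[OF op, of "f \<circ> param M c" u w] by (simp add: ext_d_def form_simps)
qed

text \<open>The exterior derivative of a 2-form in one chart: the alternating sum over three vectors
  that are constant in the chart. It serves to evaluate d d = 0 at a point, inside a single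
  chart.\<close>

definition ext_d2 :: "('a, 'e, 'e \<times> 'e) form \<Rightarrow> ('a, 'e, 'e \<times> 'e \<times> 'e) form" where
  "ext_d2 \<theta> = (\<lambda>c x (u, v, w).
     frd (\<lambda>y. \<theta> c (param M c y) (v, w)) (snd c x) u
     - frd (\<lambda>y. \<theta> c (param M c y) (u, w)) (snd c x) v
     + frd (\<lambda>y. \<theta> c (param M c y) (u, v)) (snd c x) w)"

text \<open>The regularity under which \<open>ext_d2\<close> is additive; without it the derivative
  of a sum need not be the sum of the derivatives.\<close>

definition differentiable_2form :: "('a, 'e, 'e \<times> 'e) form \<Rightarrow> bool" where
  "differentiable_2form \<theta> \<longleftrightarrow> (\<forall>c\<in>charts M. \<forall>x\<in>chart_dom M c. \<forall>v.
     (\<lambda>y. \<theta> c (param M c y) v) differentiable (at (snd c x)))"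

lemma ext_d2_cong:
  assumes "\<alpha> \<doteq>\<^bsub>M\<^esub> \<beta>"
  shows "ext_d2 \<alpha> \<doteq>\<^bsub>M\<^esub> ext_d2 \<beta>"
proof (rule form_eqI)
  fix c x v assume c: "c \<in> charts M" "x \<in> chart_dom M c"
  have "frd (\<lambda>y. \<alpha> c (param M c y) w) (snd c x) = frd (\<lambda>y. \<beta> c (param M c y) w) (snd c x)" for w
    by (rule frd_cong[OF img_open[OF M c(1)] chart_in_img[OF c(2)]])
      (rule form_eqD[OF assms c(1) param_in_dom])
  then show "ext_d2 \<alpha> c x v = ext_d2 \<beta> c x v" by (simp add: ext_d2_def case_prod_beta)
qed

text \<open>The alternating sum consists of six second derivatives of the components, which cancel
  in pairs by symmetry.\<close>

lemma ext_d2_ext_d: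
  assumes \<alpha>: "one_form M \<alpha>"
  shows "ext_d2 (ext_d M \<alpha>) \<doteq>\<^bsub>M\<^esub> 0"
proof (rule form_eqI)
  fix c x v assume c: "c \<in> charts M" "x \<in> chart_dom M c"
  note op = img_open[OF M c(1)] chart_in_img[OF c(2)]
  let ?A = "\<lambda>v y. \<alpha> c (param M c y) v"
  have s: "smooth_on (chart_img M c) (?A v)" for v by (rule one_form_smooth[OF \<alpha> c(1)])
  have "frd (\<lambda>y. ext_d M \<alpha> c (param M c y) (v, w)) (snd c x) u
      = frd (\<lambda>y. frd (?A w) y v) (snd c x) u - frd (\<lambda>y. frd (?A v) y w) (snd c x) u" for u v w
  proof -
    have "frd (\<lambda>y. ext_d M \<alpha> c (param M c y) (v, w)) (snd c x) = frd (\<lambda>y. frd (?A w) y v - frd (?A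
        v) y w) (snd c x)"
      by (rule frd_cong[OF op]) (simp add: ext_d_def chart_param)
    then show ?thesis
      using frd_diff[OF smooth_on_differentiable[OF smooth_on_frd[OF s] op(2)]
          smooth_on_differentiable[OF smooth_on_frd[OF s] op(2)]]
      by metis
  qed
  moreover obtain u w z :: 'e where "v = (u, w, z)" by (rule prod_cases3)
  ultimately show "ext_d2 (ext_d M \<alpha>) c x v = 0 c x v"
    using frd_symmetric[OF op s, of z w u] frd_symmetric[OF op s, of w z u] frd_symmetric[OF op s,
        of u z w]
    by (simp add: ext_d2_def form_simps)
qed

text \<open>Serves twice: it shows that such a 2-form is differentiable, and its explicit derivative
  is the term from which the Leibniz rule for \<open>ext_d2\<close> is assembled.\<close>

lemma has_derivative_smul_wedge:
  assumes f: "smooth_fun M f" and \<beta>: "one_form M \<beta>" and \<gamma>: "one_form M \<gamma>"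
    and c: "c \<in> charts M" "x \<in> chart_dom M c"
  shows "((\<lambda>y. (f \<odot> (\<beta> \<^bold>\<and> \<gamma>)) c (param M c y) (v, w)) has_derivative
    (\<lambda>u. dfun M f c x u * (\<beta> c x v * \<gamma> c x w - \<beta> c x w * \<gamma> c x v)
      + f x * (frd (\<lambda>y. \<beta> c (param M c y) v) (snd c x) u * \<gamma> c x w + \<beta> c x v * frd (\<lambda>y. \<gamma> c (param M
          c y) w) (snd c x) u
        - frd (\<lambda>y. \<beta> c (param M c y) w) (snd c x) u * \<gamma> c x v - \<beta> c x w * frd (\<lambda>y. \<gamma> c (param M c y)
            v) (snd c x) u)))
    (at (snd c x))"
proof -
  let ?X = "param M c (snd c x)"
  have F: "((\<lambda>y. f (param M c y)) has_derivative dfun M f c x) (at (snd c x))"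
    using frd_has[OF smooth_fun_differentiable[OF f c]] by (simp add: o_def dfun_def)
  have "((\<lambda>y. f (param M c y) * (\<beta> c (param M c y) v * \<gamma> c (param M c y) w
      - \<beta> c (param M c y) w * \<gamma> c (param M c y) v)) has_derivative
    (\<lambda>u. f ?X * ((\<beta> c ?X v * frd (\<lambda>y. \<gamma> c (param M c y) w) (snd c x) u + frd (\<lambda>y. \<beta> c (param M c y)
        v) (snd c x) u * \<gamma> c ?X w)
       - (\<beta> c ?X w * frd (\<lambda>y. \<gamma> c (param M c y) v) (snd c x) u + frd (\<lambda>y. \<beta> c (param M c y) w) (snd
           c x) u * \<gamma> c ?X v))
       + dfun M f c x u * (\<beta> c ?X v * \<gamma> c ?X w - \<beta> c ?X w * \<gamma> c ?X v))) (at (snd c x))"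
    by (intro has_derivative_mult has_derivative_diff F frd_has one_form_differentiable[OF \<beta> c]
        one_form_differentiable[OF \<gamma> c])
  note * = has_derivative_eq_rhs[OF this]
  show ?thesis
    unfolding smul_def wedge_def case_prod_conv
    by (rule *) (simp add: fun_eq_iff param_chart[OF M c] algebra_simps)
qed

lemma differentiable_2form_smul_wedge:
  "smooth_fun M f \<Longrightarrow> one_form M \<beta> \<Longrightarrow> one_form M \<gamma> \<Longrightarrow> differentiable_2form (f \<odot> (\<beta> \<^bold>\<and> \<gamma>))"
  unfolding differentiable_2form_def differentiable_def split_paired_All
  by (intro ballI allI exI, rule has_derivative_smul_wedge)

lemma differentiable_2form_add:
  "differentiable_2form \<alpha> \<Longrightarrow> differentiable_2form \<beta> \<Longrightarrow> differentiable_2form (\<alpha> + \<beta>)"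
  unfolding differentiable_2form_def by (auto simp: plus_fun_def intro!: differentiable_add)

lemma ext_d2_add:
  assumes "differentiable_2form \<alpha>" "differentiable_2form \<beta>"
  shows "ext_d2 (\<alpha> + \<beta>) \<doteq>\<^bsub>M\<^esub> ext_d2 \<alpha> + ext_d2 \<beta>"
proof (rule form_eqI)
  fix c x v assume c: "c \<in> charts M" "x \<in> chart_dom M c"
  have "frd (\<lambda>y. \<alpha> c (param M c y) w + \<beta> c (param M c y) w) (snd c x) u
      = frd (\<lambda>y. \<alpha> c (param M c y) w) (snd c x) u + frd (\<lambda>y. \<beta> c (param M c y) w) (snd c x) u" for u
          w
    by (rule frd_add) (use assms c in \<open>simp_all add: differentiable_2form_def del:
        split_paired_All\<close>)
  then show "ext_d2 (\<alpha> + \<beta>) c x v = (ext_d2 \<alpha> + ext_d2 \<beta>) c x v"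
    by (cases v) (simp add: ext_d2_def form_simps)
qed

text \<open>The Leibniz rule in disguise: d\<beta> \<and> \<gamma> is written with
  \<open>\<gamma>\<close> on the left, because \<open>wedge12\<close> takes the 1-form first; a
  1-form and a 2-form commute.\<close>

lemma ext_d2_smul_wedge:
  assumes "smooth_fun M f" "one_form M \<beta>" "one_form M \<gamma>"
  shows "ext_d2 (f \<odot> (\<beta> \<^bold>\<and> \<gamma>)) \<doteq>\<^bsub>M\<^esub>
    dfun M f \<^bold>\<and>\<^bold>\<and> (\<beta> \<^bold>\<and> \<gamma>) + f \<odot> (\<gamma> \<^bold>\<and>\<^bold>\<and> ext_d M \<beta> - \<beta> \<^bold>\<and>\<^bold>\<and> ext_d M \<gamma>)"
proof (rule form_eqI)
  fix c x v assume c: "c \<in> charts M" "x \<in> chart_dom M c"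
  obtain u w z :: 'e where v: "v = (u, w, z)" by (rule prod_cases3)
  show "ext_d2 (f \<odot> (\<beta> \<^bold>\<and> \<gamma>)) c x v =
    (dfun M f \<^bold>\<and>\<^bold>\<and> (\<beta> \<^bold>\<and> \<gamma>) + f \<odot> (\<gamma> \<^bold>\<and>\<^bold>\<and> ext_d M \<beta> - \<beta> \<^bold>\<and>\<^bold>\<and> ext_d M \<gamma>)) c x v"
    unfolding v ext_d2_def case_prod_conv frd_eqI[OF has_derivative_smul_wedge[OF assms c]]
    by (simp add: ext_d_def smul_def wedge_def wedge12_def plus_fun_def fun_diff_def algebra_simps)
qed

end

section \<open>Pullback of forms\<close>

lemma pullback_smul: "pullback M N \<psi> (f \<odot> \<alpha>) = (\<lambda>x. f (\<psi> x)) \<odot> pullback M N \<psi> \<alpha>"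
  by (simp add: pullback_def smul_def Let_def)

lemma pullback_add: "pullback M N \<psi> (\<alpha> + \<beta>) = pullback M N \<psi> \<alpha> + pullback M N \<psi> \<beta>"
  by (simp add: pullback_def plus_fun_def Let_def)

lemma pullback_cconj: "pullback M N \<psi> (cconj \<alpha>) = cconj (pullback M N \<psi> \<alpha>)"
  by (simp add: pullback_def cconj_def Let_def)

context
  fixes M :: "('a, 'e::euclidean_space) mfd" and N :: "('b, 'g::euclidean_space) mfd" and \<psi> :: "'a \<Rightarrow>
      'b"
  assumes M: "smooth_atlas M" and N: "smooth_atlas N" and \<psi>: "smooth_map M N \<psi>"
begin

lemma exists_target_chart:
  assumes "x \<in> chart_dom M c"
  obtains c' where "c' \<in> charts N" "\<psi> x \<in> chart_dom N c'"
proof -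
  have "\<psi> x \<in> points N"
    by (rule smooth_map_points[OF M N \<psi> subsetD[OF dom_subset_points assms]])
  from atlas_cover[OF N this] that show thesis by auto
qed

lemma pullback_cong:
  assumes "\<alpha> \<doteq>\<^bsub>N\<^esub> \<beta>"
  shows "pullback M N \<psi> \<alpha> \<doteq>\<^bsub>M\<^esub> pullback M N \<psi> \<beta>"
proof (rule form_eqI)
  fix c x v assume c: "c \<in> charts M" "x \<in> chart_dom M c"
  define d where "d = (SOME c'. c' \<in> charts N \<and> \<psi> x \<in> chart_dom N c')"
  obtain c' where c': "c' \<in> charts N" "\<psi> x \<in> chart_dom N c'" using exists_target_chart[OF c(2)] .
  have "d \<in> charts N" "\<psi> x \<in> chart_dom N d"
    using someI[of "\<lambda>c'. c' \<in> charts N \<and> \<psi> x \<in> chart_dom N c'", OF conjI[OF c']]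
    unfolding d_def by auto
  then show "pullback M N \<psi> \<alpha> c x v = pullback M N \<psi> \<beta> c x v"
    using form_eqD[OF assms] by (simp add: pullback_def d_def[symmetric])
qed

text \<open>One target chart serves on the whole region, so the formula holds on an open set of
  coordinates and may be differentiated in \<open>y\<close>.\<close>

lemma pullback_local:
  assumes \<alpha>: "one_form N \<alpha>" and c: "c \<in> charts M" and c': "c' \<in> charts N"
    and y: "y \<in> snd c ` {x \<in> chart_dom M c. \<psi> x \<in> chart_dom N c'}"
  shows "pullback M N \<psi> \<alpha> c (param M c y) v =
    \<alpha> c' (param N c' ((snd c' \<circ> \<psi> \<circ> param M c) y)) (frd (snd c' \<circ> \<psi> \<circ> param M c) y v)"
proof -
  obtain x where x: "x \<in> chart_dom M c" "\<psi> x \<in> chart_dom N c'" "y = snd c x" using y by auto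
  have px: "param M c y = x" using param_chart[OF M c x(1)] x(3) by simp
  show ?thesis
    using pullback_eq[OF M N \<psi> \<alpha> c c' x(1,2), of v] param_chart[OF N c' x(2)] px
    by (simp add: tangent_map_def x(3))
qed

lemma pullback_linear:
  assumes \<alpha>: "one_form N \<alpha>" and c: "c \<in> charts M" "x \<in> chart_dom M c"
  shows "linear (pullback M N \<psi> \<alpha> c x)"
proof -
  obtain c' where c': "c' \<in> charts N" "\<psi> x \<in> chart_dom N c'" using exists_target_chart[OF c(2)] .
  have "pullback M N \<psi> \<alpha> c x = \<alpha> c' (\<psi> x) \<circ> tangent_map M \<psi> c c' x"
    by (rule ext) (simp add: pullback_eq[OF M N \<psi> \<alpha> c(1) c'(1) c(2) c'(2)])
  then show ?thesis
    using linear_compose[OF tangent_map_linear[OF M N \<psi> c(1) c'(1) c(2) c'(2)] one_form_linear[OF N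
        \<alpha> c']] by simp
qed

text \<open>In coordinates the base point and the vector \<open>frd ?g y v\<close> both move with
  \<open>y\<close>; \<open>smooth_on_linear_family\<close> is made for this situation.\<close>

lemma one_form_pullback:
  assumes \<alpha>: "one_form N \<alpha>"
  shows "one_form M (pullback M N \<psi> \<alpha>)"
proof (rule one_formI[OF M])
  fix c v assume c: "c \<in> charts M"
  show "smooth_on (chart_img M c) (\<lambda>y. pullback M N \<psi> \<alpha> c (param M c y) v)"
  proof (rule smooth_on_local)
    fix y assume y: "y \<in> chart_img M c"
    obtain c' where c': "c' \<in> charts N" "\<psi> (param M c y) \<in> chart_dom N c'"
      using exists_target_chart[OF param_in_dom[OF y]] .
    let ?R = "snd c ` {x \<in> chart_dom M c. \<psi> x \<in> chart_dom N c'}"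
    let ?g = "snd c' \<circ> \<psi> \<circ> param M c"
    have R: "open ?R" by (rule smooth_map_region_open[OF M N \<psi> c c'(1)])
    have g: "smooth_on ?R ?g" by (rule smooth_map_region_smooth[OF M N \<psi> c c'(1)])
    have "smooth_on ?R (\<lambda>y. \<alpha> c' (param N c' (?g y)) (frd ?g y v))"
    proof (rule smooth_on_linear_family[OF R img_open[OF N c'(1)]])
      show "?g ` ?R \<subseteq> chart_img N c'"
        by (auto simp: param_chart[OF M c] chart_in_img)
      show "linear (\<alpha> c' (param N c' z))" if "z \<in> chart_img N c'" for z
        by (rule one_form_linear[OF N \<alpha> c'(1) param_in_dom[OF that]])
      show "smooth_on (chart_img N c') (\<lambda>z. \<alpha> c' (param N c' z) w)" for w
        by (rule one_form_smooth[OF N \<alpha> c'(1)])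
    qed (rule g smooth_on_frd[OF g])+
    then have "smooth_on ?R (\<lambda>y. pullback M N \<psi> \<alpha> c (param M c y) v)"
      by (rule smooth_on_cong[OF R, rotated]) (rule pullback_local[OF \<alpha> c c'(1), symmetric])
    moreover have "y \<in> ?R"
      using param_in_dom[OF y] chart_param[OF y] c'(2)
      by (metis (mono_tags, lifting) image_eqI mem_Collect_eq)
    ultimately show "\<exists>T. open T \<and> y \<in> T \<and> smooth_on T (\<lambda>y. pullback M N \<psi> \<alpha> c (param M c y) v)"
      using R by auto
  qed
next
  fix c d x v assume c: "c \<in> charts M" "d \<in> charts M" "x \<in> chart_dom M c" "x \<in> chart_dom M d"
  obtain c' where c': "c' \<in> charts N" "\<psi> x \<in> chart_dom N c'" using exists_target_chart[OF c(3)] .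
  show "pullback M N \<psi> \<alpha> c x v = pullback M N \<psi> \<alpha> d x (frd (snd d \<circ> param M c) (snd c x) v)"
    using pullback_eq[OF M N \<psi> \<alpha> c(1) c'(1) c(3) c'(2)] pullback_eq[OF M N \<psi> \<alpha> c(2) c'(1) c(4)
        c'(2)]
      tangent_map_source[OF M N \<psi> c(1,2) c'(1) c(3,4) c'(2)] by simp
qed (rule pullback_linear[OF \<alpha>])

text \<open>Differentiating the pulled-back components produces an extra term with the second
  derivative of \<open>\<psi>\<close>. It is symmetric in \<open>u\<close> and \<open>v\<close>, so
  it disappears from the antisymmetric difference.\<close>

lemma ext_d_pullback:
  assumes \<alpha>: "one_form N \<alpha>" and c: "c \<in> charts M" and c': "c' \<in> charts N"
    and x: "x \<in> chart_dom M c" "\<psi> x \<in> chart_dom N c'"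
  shows "ext_d M (pullback M N \<psi> \<alpha>) c x (u, v) =
    ext_d N \<alpha> c' (\<psi> x) (tangent_map M \<psi> c c' x u, tangent_map M \<psi> c c' x v)"
proof -
  let ?R = "snd c ` {x \<in> chart_dom M c. \<psi> x \<in> chart_dom N c'}"
  let ?g = "snd c' \<circ> \<psi> \<circ> param M c" and ?y = "snd c x"
  let ?a = "\<lambda>z. \<alpha> c' (param N c' z)"
  have R: "open ?R" "?y \<in> ?R" using smooth_map_region_open[OF M N \<psi> c c'] x by auto
  have g: "smooth_on ?R ?g" by (rule smooth_map_region_smooth[OF M N \<psi> c c'])
  have gy: "?g ?y = snd c' (\<psi> x)" by (simp add: param_chart[OF M c x(1)])
  have *: "frd (\<lambda>y. pullback M N \<psi> \<alpha> c (param M c y) w) ?y u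
      = frd (\<lambda>z. ?a z (frd ?g ?y w)) (?g ?y) (frd ?g ?y u) + ?a (?g ?y) (frd (\<lambda>y. frd ?g y w) ?y u)"
          for u w
  proof -
    have "frd (\<lambda>y. pullback M N \<psi> \<alpha> c (param M c y) w) ?y = frd (\<lambda>y. ?a (?g y) (frd ?g y w)) ?y"
      by (rule frd_cong[OF R]) (rule pullback_local[OF \<alpha> c c'])
    moreover have "frd (\<lambda>y. ?a (?g y) (frd ?g y w)) ?y u
      = frd (\<lambda>z. ?a z (frd ?g ?y w)) (?g ?y) (frd ?g ?y u) + ?a (?g ?y) (frd (\<lambda>y. frd ?g y w) ?y u)"
    proof (rule frd_linear_family[OF img_open[OF N c']])
      show "?g ?y \<in> chart_img N c'" unfolding gy by (rule chart_in_img[OF x(2)])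
      show "linear (?a z)" if "z \<in> chart_img N c'" for z
        by (rule one_form_linear[OF N \<alpha> c' param_in_dom[OF that]])
      show "(\<lambda>z. ?a z w) differentiable (at (?g ?y))" for w
        unfolding gy by (rule one_form_differentiable[OF N \<alpha> c' x(2)])
    qed (rule smooth_on_differentiable[OF g R(2)] smooth_on_differentiable[OF smooth_on_frd[OF g]
        R(2)])+
    ultimately show ?thesis by simp
  qed
  show ?thesis
    unfolding ext_d_def case_prod_conv * tangent_map_def gy frd_symmetric[OF R g, of u v] by simp
qed

lemma dfun_pullback:
  assumes f: "smooth_fun N f" and c: "c \<in> charts M" and c': "c' \<in> charts N"
    and x: "x \<in> chart_dom M c" "\<psi> x \<in> chart_dom N c'"
  shows "dfun M (\<lambda>x. f (\<psi> x)) c x v = dfun N f c' (\<psi> x) (tangent_map M \<psi> c c' x v)"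
proof -
  let ?R = "snd c ` {x \<in> chart_dom M c. \<psi> x \<in> chart_dom N c'}"
  let ?g = "snd c' \<circ> \<psi> \<circ> param M c" and ?y = "snd c x"
  have R: "open ?R" "?y \<in> ?R" using smooth_map_region_open[OF M N \<psi> c c'] x by auto
  have gy: "?g ?y = snd c' (\<psi> x)" by (simp add: param_chart[OF M c x(1)])
  have "frd ((\<lambda>x. f (\<psi> x)) \<circ> param M c) ?y = frd (\<lambda>y. (f \<circ> param N c') (?g y)) ?y"
    by (rule frd_cong[OF R]) (auto simp: param_chart[OF M c] param_chart[OF N c'])
  moreover have "frd (\<lambda>y. (f \<circ> param N c') (?g y)) ?y v = frd (f \<circ> param N c') (?g ?y) (frd ?g ?y
      v)"
    by (rule frd_compose) (unfold gy, rule smooth_fun_differentiable[OF N f c' x(2)],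
      rule smooth_map_differentiable[OF M N \<psi> c c' x])
  ultimately show ?thesis by (simp add: dfun_def tangent_map_def param_chart[OF M c x(1)])
qed

end

lemma tangent_map_inverse:
  fixes M :: "('a, 'e::euclidean_space) mfd" and N :: "('b, 'g::euclidean_space) mfd"
  assumes M: "smooth_atlas M" and N: "smooth_atlas N" and \<psi>: "smooth_map M N \<psi>" and \<eta>: "smooth_map N
      M \<eta>"
    and inv: "\<And>x. x \<in> points M \<Longrightarrow> \<eta> (\<psi> x) = x"
    and c: "c \<in> charts M" and c': "c' \<in> charts N" and x: "x \<in> chart_dom M c" "\<psi> x \<in> chart_dom N c'"
  shows "tangent_map N \<eta> c' c (\<psi> x) (tangent_map M \<psi> c c' x v) = v"
proof -
  let ?R = "snd c ` {x \<in> chart_dom M c. \<psi> x \<in> chart_dom N c'}"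
  let ?g = "snd c' \<circ> \<psi> \<circ> param M c" and ?h = "snd c \<circ> \<eta> \<circ> param N c'" and ?y = "snd c x"
  have R: "open ?R" "?y \<in> ?R" using smooth_map_region_open[OF M N \<psi> c c'] x by auto
  have gy: "?g ?y = snd c' (\<psi> x)" by (simp add: param_chart[OF M c x(1)])
  have xx: "\<eta> (\<psi> x) = x" by (rule inv[OF subsetD[OF dom_subset_points x(1)]])
  have "frd (\<lambda>y. ?h (?g y)) ?y = frd (\<lambda>y. y) ?y"
    by (rule frd_cong[OF R])
      (auto simp: param_chart[OF M c] param_chart[OF N c'] inv subsetD[OF dom_subset_points])
  moreover have "frd (\<lambda>y. ?h (?g y)) ?y v = frd ?h (?g ?y) (frd ?g ?y v)"
    by (rule frd_compose) (unfold gy, rule smooth_map_differentiable[OF N M \<eta> c' c x(2)],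
      simp add: xx x(1), rule smooth_map_differentiable[OF M N \<psi> c c' x])
  ultimately show ?thesis by (simp add: tangent_map_def param_chart[OF M c x(1)])
qed

text \<open>A one-sided inverse is assumed and the two dimensions may differ. This covers a section
  of the half-line bundle composed with the projection as well as a diffeomorphism.\<close>

lemma pullback_inverse:
  fixes M :: "('a, 'e::euclidean_space) mfd" and N :: "('b, 'g::euclidean_space) mfd"
  assumes M: "smooth_atlas M" and N: "smooth_atlas N" and \<psi>: "smooth_map M N \<psi>" and \<eta>: "smooth_map N
      M \<eta>"
    and inv: "\<And>x. x \<in> points M \<Longrightarrow> \<eta> (\<psi> x) = x"
    and \<alpha>: "one_form M \<alpha>"
  shows "pullback M N \<psi> (pullback N M \<eta> \<alpha>) \<doteq>\<^bsub>M\<^esub> \<alpha>"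
proof (rule form_eqI)
  fix c x v assume c: "c \<in> charts M" "x \<in> chart_dom M c"
  obtain c' where c': "c' \<in> charts N" "\<psi> x \<in> chart_dom N c'" using exists_target_chart[OF M N \<psi>
      c(2)] .
  have xx: "\<eta> (\<psi> x) = x" by (rule inv[OF subsetD[OF dom_subset_points c(2)]])
  have "pullback M N \<psi> (pullback N M \<eta> \<alpha>) c x v = pullback N M \<eta> \<alpha> c' (\<psi> x) (tangent_map M \<psi> c c' x
      v)"
    by (rule pullback_eq[OF M N \<psi> one_form_pullback[OF N M \<eta> \<alpha>] c(1) c'(1) c(2) c'(2)])
  also have "\<dots> = \<alpha> c (\<eta> (\<psi> x)) (tangent_map N \<eta> c' c (\<psi> x) (tangent_map M \<psi> c c' x v))"
    by (rule pullback_eq[OF N M \<eta> \<alpha> c'(1) c(1) c'(2)]) (simp add: xx c(2))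
  also have "\<dots> = \<alpha> c x v"
    using tangent_map_inverse[OF M N \<psi> \<eta> inv c(1) c'(1) c(2) c'(2)] by (simp add: xx)
  finally show "pullback M N \<psi> (pullback N M \<eta> \<alpha>) c x v = \<alpha> c x v" .
qed

section \<open>Open submanifolds\<close>

lemma charts_submfd [simp]: "charts (M\<restriction>U) = charts M"
  by (simp add: submfd_def)

lemma mtop_submfd [simp]: "mtop (M\<restriction>U) = subtopology (mtop M) U"
  by (simp add: submfd_def)

lemma points_submfd [simp]: "points (M\<restriction>U) = points M \<inter> U"
  by (simp add: points_def)

lemma chart_dom_submfd [simp]: "chart_dom (M\<restriction>U) c = chart_dom M c \<inter> U"
  by (auto simp: chart_dom_def)

lemma submfd_submfd: "M\<restriction>U\<restriction>V = M\<restriction>(U \<inter> V)"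
  by (simp add: submfd_def subtopology_subtopology)

lemma submfd_points: "M\<restriction>points M = M"
  by (simp add: submfd_def points_def)

lemma smooth_map_ident:
  assumes M: "smooth_atlas M"
  shows "smooth_map M M (\<lambda>x. x)"
proof -
  have "{x \<in> chart_dom M c. x \<in> chart_dom M c'} = chart_dom M c \<inter> chart_dom M c'" for c c' by auto
  then show ?thesis
    using transition_smooth[OF M] by (simp add: smooth_map_def o_def)
qed

context
  fixes M :: "('a, 'e::euclidean_space) mfd" and U
  assumes M: "smooth_atlas M" and U: "openin (mtop M) U"
begin

text \<open>Shrinking the chart domain changes the set on which \<open>param\<close> inverts the
  chart; on the smaller image the two inverses agree by injectivity.\<close>

lemma param_submfd:
  assumes c: "c \<in> charts M" and y: "y \<in> chart_img (M\<restriction>U) c"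
  shows "param (M\<restriction>U) c y = param M c y"
proof -
  have a: "param (M\<restriction>U) c y \<in> chart_dom M c" "snd c (param (M\<restriction>U) c y) = y"
    using param_in_dom[OF y] chart_param[OF y] by auto
  show ?thesis using param_chart[OF M c a(1)] a(2) by simp
qed

lemma chart_img_submfd: "chart_img (M\<restriction>U) c = snd c ` (chart_dom M c \<inter> U)"
  by (simp add: chart_img_def)

lemma smooth_atlas_submfd: "smooth_atlas (M\<restriction>U)"
  unfolding smooth_atlas_def
proof (intro conjI ballI)
  show "points (M\<restriction>U) = (\<Union>c\<in>charts (M\<restriction>U). chart_dom (M\<restriction>U) c)"
    using M unfolding smooth_atlas_def by auto
next
  fix c assume "c \<in> charts (M\<restriction>U)"
  then have c: "c \<in> charts M" by simp
  show "openin (mtop (M\<restriction>U)) (chart_dom (M\<restriction>U) c)"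
    using dom_open[OF M c] by (simp add: openin_subtopology_Int)
  show "open (chart_img (M\<restriction>U) c)"
    unfolding chart_img_submfd by (rule chart_image_open[OF M c U])
  have s: "snd c ` (topspace (subtopology (mtop M) (chart_dom M c)) \<inter> (chart_dom M c \<inter> U))
      = topspace (top_of_set (chart_img M c)) \<inter> chart_img (M\<restriction>U) c"
    unfolding topspace_dom[OF M] by (auto simp: chart_img_def)
  have "homeomorphic_map (subtopology (subtopology (mtop M) (chart_dom M c)) (chart_dom M c \<inter> U))
     (subtopology (top_of_set (chart_img M c)) (chart_img (M\<restriction>U) c)) (snd c)"
    by (rule homeomorphic_map_subtopologies[OF chart_homeo[OF M c]])
      (use s in \<open>auto simp: chart_img_def topspace_dom[OF M]\<close>)
  moreover have "chart_dom M c \<inter> (chart_dom M c \<inter> U) = U \<inter> (chart_dom M c \<inter> U)"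
    "chart_img M c \<inter> chart_img (M\<restriction>U) c = chart_img (M\<restriction>U) c"
    by (auto simp: chart_img_def)
  ultimately show "homeomorphic_map (subtopology (mtop (M\<restriction>U)) (chart_dom (M\<restriction>U) c))
      (top_of_set (chart_img (M\<restriction>U) c)) (snd c)"
    by (simp add: subtopology_subtopology)
next
  fix c c' assume "c \<in> charts (M\<restriction>U)" "c' \<in> charts (M\<restriction>U)"
  then have c: "c \<in> charts M" "c' \<in> charts M" by auto
  let ?S = "snd c ` (chart_dom (M\<restriction>U) c \<inter> chart_dom (M\<restriction>U) c')"
  have S: "open ?S"
    using chart_image_open[OF M c(1) openin_Int[OF dom_open[OF M c(2)] U]]
    by (simp add: Int_ac)
  have "smooth_on ?S (snd c' \<circ> param M c)"
    by (rule smooth_on_subset[OF transition_smooth[OF M c]]) auto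
  then show "smooth_on ?S (snd c' \<circ> param (M\<restriction>U) c)"
    by (rule smooth_on_cong[OF S, rotated]) (auto simp: param_submfd[OF c(1)] chart_img_submfd)
qed

lemma smooth_map_submfd:
  assumes N: "smooth_atlas N" and \<psi>: "smooth_map M N \<psi>"
  shows "smooth_map (M\<restriction>U) N \<psi>"
  unfolding smooth_map_def
proof (intro conjI ballI)
  show "continuous_map (mtop (M\<restriction>U)) (mtop N) \<psi>"
    using \<psi> unfolding smooth_map_def by (auto intro: continuous_map_from_subtopology)
next
  fix c c' assume "c \<in> charts (M\<restriction>U)" and c': "c' \<in> charts N"
  then have c: "c \<in> charts M" by simp
  let ?R = "snd c ` {x \<in> chart_dom M c. \<psi> x \<in> chart_dom N c'}"
  let ?S = "snd c ` {x \<in> chart_dom (M\<restriction>U) c. \<psi> x \<in> chart_dom N c'}"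
  have "?S = ?R \<inter> snd c ` (chart_dom M c \<inter> U)"
    using chart_inj[OF M c] by (auto simp: inj_on_def)
  then have S: "open ?S"
    using smooth_map_region_open[OF M N \<psi> c c'] chart_image_open[OF M c U] by auto
  have "smooth_on ?S (snd c' \<circ> \<psi> \<circ> param M c)"
    by (rule smooth_on_subset[OF smooth_map_region_smooth[OF M N \<psi> c c']]) auto
  then show "smooth_on ?S (snd c' \<circ> \<psi> \<circ> param (M\<restriction>U) c)"
    by (rule smooth_on_cong[OF S, rotated]) (auto simp: param_submfd[OF c] chart_img_submfd)
qed

lemma smooth_map_inclusion: "smooth_map (M\<restriction>U) M (\<lambda>x. x)"
  by (rule smooth_map_submfd[OF M smooth_map_ident[OF M]])

lemma tangent_map_inclusion:
  assumes c: "c \<in> charts M" "x \<in> chart_dom (M\<restriction>U) c"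
  shows "tangent_map (M\<restriction>U) (\<lambda>x. x) c c x v = v"
proof -
  have "frd (snd c \<circ> (\<lambda>x. x) \<circ> param (M\<restriction>U) c) (snd c x) = frd (\<lambda>y. y) (snd c x)"
    by (rule frd_cong[OF img_open[OF smooth_atlas_submfd] chart_in_img[OF c(2)]])
      (use c in \<open>auto simp: chart_param\<close>)
  then show ?thesis by (simp add: tangent_map_def)
qed

text \<open>Restriction of a form is pullback along the inclusion, whose tangent map in one and the
  same chart is the identity. Facts about pullbacks thereby become facts about restrictions.\<close>

lemma pullback_inclusion:
  assumes \<alpha>: "one_form M \<alpha>"
  shows "pullback (M\<restriction>U) M (\<lambda>x. x) \<alpha> \<doteq>\<^bsub>M\<restriction>U\<^esub> \<alpha>"
proof (rule form_eqI)
  fix c x v assume "c \<in> charts (M\<restriction>U)" and x: "x \<in> chart_dom (M\<restriction>U) c"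
  then have c: "c \<in> charts M" by simp
  show "pullback (M\<restriction>U) M (\<lambda>x. x) \<alpha> c x v = \<alpha> c x v"
    using pullback_eq[OF smooth_atlas_submfd M smooth_map_inclusion \<alpha> _ c x, of v]
        tangent_map_inclusion[OF c x, of v] c x
    by simp
qed

lemma one_form_submfd: "one_form M \<alpha> \<Longrightarrow> one_form (M\<restriction>U) \<alpha>"
  by (rule one_form_cong[OF smooth_atlas_submfd
      one_form_pullback[OF smooth_atlas_submfd M smooth_map_inclusion] pullback_inclusion])

lemma smooth_fun_submfd: "smooth_fun M f \<Longrightarrow> smooth_fun (M\<restriction>U) f"
  by (rule smooth_fun_compose[OF smooth_atlas_submfd M smooth_map_inclusion])

lemma ext_d_submfd:
  assumes \<alpha>: "one_form M \<alpha>" and c: "c \<in> charts M" and x: "x \<in> chart_dom (M\<restriction>U) c"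
  shows "ext_d (M\<restriction>U) \<alpha> c x v = ext_d M \<alpha> c x v"
proof -
  obtain u w :: 'e where v: "v = (u, w)" by (rule prod.exhaust)
  have "ext_d (M\<restriction>U) \<alpha> c x v = ext_d (M\<restriction>U) (pullback (M\<restriction>U) M (\<lambda>x. x) \<alpha>) c x v"
    using form_eqD[OF ext_d_cong[OF smooth_atlas_submfd pullback_inclusion[OF \<alpha>]], of c x v] c x by
        simp
  also have "\<dots> = ext_d M \<alpha> c x v"
    using ext_d_pullback[OF smooth_atlas_submfd M smooth_map_inclusion \<alpha> _ c x, of u w]
        tangent_map_inclusion[OF c x] c x v
    by simp
  finally show ?thesis .
qed

lemma form_eq_submfd: "\<alpha> \<doteq>\<^bsub>M\<^esub> \<beta> \<Longrightarrow> \<alpha> \<doteq>\<^bsub>M\<restriction>U\<^esub> \<beta>"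
  by (auto simp: form_eq_def)

lemma real_form_submfd: "real_form M \<alpha> \<Longrightarrow> real_form (M\<restriction>U) \<alpha>"
  by (auto simp: real_form_def)

end

lemma smooth_manifold_submfd:
  assumes M: "smooth_manifold M" and U: "openin (mtop M) U"
  shows "smooth_manifold (M\<restriction>U)"
proof -
  have "smooth_atlas (M\<restriction>U)" by (rule smooth_atlas_submfd[OF smooth_manifold_atlas[OF M] U])
  moreover have "Hausdorff_space (mtop (M\<restriction>U))" "second_countable (mtop (M\<restriction>U))"
    using M by (auto simp: smooth_manifold_def Hausdorff_space_subtopology
        second_countable_subtopology)
  ultimately show ?thesis unfolding smooth_manifold_def smooth_atlas_def by simp
qed

section \<open>The half-line bundle\<close>

definition lift_chart :: "('a, 'e) chart \<Rightarrow> ('a \<times> real, 'e \<times> real) chart" where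
  "lift_chart c = (fst c \<times> {0<..}, map_prod (snd c) (\<lambda>\<rho>. \<rho>))"

lemma charts_bundle: "charts (half_line_bundle M) = lift_chart ` charts M"
  by (simp add: half_line_bundle_def lift_chart_def[abs_def])

lemma points_bundle [simp]: "points (half_line_bundle M) = points M \<times> {0<..}"
  by (simp add: half_line_bundle_def points_def)

lemma chart_dom_bundle [simp]: "chart_dom (half_line_bundle M) (lift_chart c) = chart_dom M c \<times>
    {0<..}"
  by (auto simp: chart_dom_def lift_chart_def)

lemma snd_lift_chart [simp]: "snd (lift_chart c) (x, \<rho>) = (snd c x, \<rho>)"
  by (simp add: lift_chart_def)

lemma chart_img_bundle: "chart_img (half_line_bundle M) (lift_chart c) = chart_img M c \<times> {0<..}"
  by (force simp: chart_img_def)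

context
  fixes M :: "('a, 'e::euclidean_space) mfd"
  assumes M: "smooth_atlas M"
begin

abbreviation ray_bundle where "ray_bundle \<equiv> half_line_bundle M"

lemma param_bundle:
  assumes c: "c \<in> charts M" and y: "y \<in> chart_img M c" and \<rho>: "\<rho> > 0"
  shows "param ray_bundle (lift_chart c) (y, \<rho>) = (param M c y, \<rho>)"
proof -
  have z: "(y, \<rho>) \<in> chart_img ray_bundle (lift_chart c)" using y \<rho> by (simp add: chart_img_bundle)
  obtain x \<rho>' where x: "param ray_bundle (lift_chart c) (y, \<rho>) = (x, \<rho>')" by (rule prod.exhaust)
  have "x \<in> chart_dom M c" using param_in_dom[OF z] x by simp
  moreover have "snd c x = y" "\<rho>' = \<rho>" using chart_param[OF z] x by auto
  ultimately show ?thesis using param_chart[OF M c] x by auto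
qed

lemma bundle_region:
  "snd (lift_chart c) ` (chart_dom ray_bundle (lift_chart c) \<inter> chart_dom ray_bundle (lift_chart c'))
     = (snd c ` (chart_dom M c \<inter> chart_dom M c')) \<times> {0<..}"
  by force

lemma smooth_on_compose_fst:
  assumes S: "open S" and f: "smooth_on S f"
  shows "smooth_on (S \<times> {0::real<..}) (\<lambda>z. f (fst z))"
  by (rule smooth_on_compose[OF _ S _ f smooth_on_linear_comp[OF bounded_linear_fst _
      smooth_on_ident]])
    (use S in \<open>auto intro: open_Times\<close>)

lemma smooth_atlas_bundle: "smooth_atlas ray_bundle"
  unfolding smooth_atlas_def
proof (intro conjI ballI)
  show "points ray_bundle = (\<Union>c\<in>charts ray_bundle. chart_dom ray_bundle c)"
    using M by (auto simp: charts_bundle smooth_atlas_def)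
next
  fix d assume "d \<in> charts ray_bundle"
  then obtain c where c: "c \<in> charts M" and d: "d = lift_chart c" by (auto simp: charts_bundle)
  show "openin (mtop ray_bundle) (chart_dom ray_bundle d)"
    using dom_open[OF M c] by (simp add: d half_line_bundle_def[of M] openin_prod_Times_iff del:
        chart_dom_bundle)
      (simp add: half_line_bundle_def[of M, symmetric] openin_prod_Times_iff)
  show "open (chart_img ray_bundle d)"
    using img_open[OF M c] by (simp add: d chart_img_bundle open_Times)
  \<comment> \<open>With an explicit inverse at hand the homeomorphism of the product can be
    assembled factor by factor.\<close>
  obtain g where g: "homeomorphic_maps (subtopology (mtop M) (chart_dom M c)) (top_of_set (chart_img
      M c)) (snd c) g"
    using chart_homeo[OF M c] homeomorphic_map_maps by blast
  have "homeomorphic_maps (top_of_set {0::real<..}) (top_of_set {0<..}) (\<lambda>\<rho>. \<rho>) (\<lambda>\<rho>. \<rho>)"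
    by (simp add: homeomorphic_maps_def)
  with g have "homeomorphic_maps
      (prod_topology (subtopology (mtop M) (chart_dom M c)) (top_of_set {0::real<..}))
      (prod_topology (top_of_set (chart_img M c)) (top_of_set {0<..}))
      (\<lambda>(x, \<rho>). (snd c x, \<rho>)) (\<lambda>(x, \<rho>). (g x, \<rho>))"
    unfolding homeomorphic_maps_prod by simp
  then have h: "homeomorphic_map (prod_topology (subtopology (mtop M) (chart_dom M c)) (top_of_set
      {0::real<..}))
      (prod_topology (top_of_set (chart_img M c)) (top_of_set {0<..})) (\<lambda>(x, \<rho>). (snd c x, \<rho>))"
    using homeomorphic_map_maps by blast
  have "subtopology (mtop ray_bundle) (chart_dom M c \<times> {0<..})
      = prod_topology (subtopology (mtop M) (chart_dom M c)) (top_of_set {0::real<..})"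
    by (simp add: half_line_bundle_def subtopology_Times subtopology_subtopology)
  moreover have "(\<lambda>(x, \<rho>). (snd c x, \<rho>)) = snd d" by (auto simp: d lift_chart_def)
  ultimately show "homeomorphic_map (subtopology (mtop ray_bundle) (chart_dom ray_bundle d))
      (top_of_set (chart_img ray_bundle d)) (snd d)"
    using h by (simp add: d chart_img_bundle)
next
  fix d d' assume "d \<in> charts ray_bundle" "d' \<in> charts ray_bundle"
  then obtain c c' where c: "c \<in> charts M" "c' \<in> charts M" and d: "d = lift_chart c" "d' =
      lift_chart c'"
    by (auto simp: charts_bundle)
  let ?S = "snd c ` (chart_dom M c \<inter> chart_dom M c')"
  have S: "open ?S" by (rule chart_image_open[OF M c(1) dom_open[OF M c(2)]])
  have S': "open (?S \<times> {0::real<..})" using S by (simp add: open_Times)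
  have "smooth_on (?S \<times> {0::real<..}) (\<lambda>z. ((snd c' \<circ> param M c) (fst z), snd z))"
  proof (rule smooth_on_Pair[OF S'])
    show "smooth_on (?S \<times> {0::real<..}) (\<lambda>z. (snd c' \<circ> param M c) (fst z))"
      by (rule smooth_on_compose_fst[OF S transition_smooth[OF M c]])
    show "smooth_on (?S \<times> {0::real<..}) (snd :: 'e \<times> real \<Rightarrow> real)"
      by (rule smooth_on_linear_comp[OF bounded_linear_snd S' smooth_on_ident])
  qed
  then show "smooth_on (snd d ` (chart_dom ray_bundle d \<inter> chart_dom ray_bundle d')) (snd d' \<circ> param
      ray_bundle d)"
    unfolding d bundle_region
    by (rule smooth_on_cong[OF S', rotated]) (auto simp: param_bundle[OF c(1)] chart_in_img)
qed

lemma smooth_map_fst: "smooth_map ray_bundle M fst"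
  unfolding smooth_map_def
proof (intro conjI ballI)
  show "continuous_map (mtop ray_bundle) (mtop M) fst"
    by (simp add: half_line_bundle_def continuous_map_fst)
next
  fix d c' assume "d \<in> charts ray_bundle" and c': "c' \<in> charts M"
  then obtain c where c: "c \<in> charts M" and d: "d = lift_chart c" by (auto simp: charts_bundle)
  let ?S = "snd c ` (chart_dom M c \<inter> chart_dom M c')"
  have S: "open ?S" by (rule chart_image_open[OF M c dom_open[OF M c']])
  have S': "open (?S \<times> {0::real<..})" using S by (simp add: open_Times)
  have eq: "snd d ` {x \<in> chart_dom ray_bundle d. fst x \<in> chart_dom M c'} = ?S \<times> {0<..}"
    unfolding d by force
  show "smooth_on (snd d ` {x \<in> chart_dom ray_bundle d. fst x \<in> chart_dom M c'}) (snd c' \<circ> fst \<circ>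
      param ray_bundle d)"
    unfolding eq
    by (rule smooth_on_cong[OF S' _ smooth_on_compose_fst[OF S transition_smooth[OF M c c']]])
      (auto simp: d param_bundle[OF c] chart_in_img)
qed

lemma smooth_fun_snd: "smooth_fun ray_bundle snd"
  unfolding smooth_fun_def
proof
  fix d assume "d \<in> charts ray_bundle"
  then obtain c where c: "c \<in> charts M" and d: "d = lift_chart c" by (auto simp: charts_bundle)
  have S': "open (chart_img M c \<times> {0::real<..})" using img_open[OF M c] by (simp add: open_Times)
  show "smooth_on (chart_img ray_bundle d) (snd \<circ> param ray_bundle d)"
    unfolding d chart_img_bundle
    by (rule smooth_on_cong[OF S' _ smooth_on_linear_comp[OF bounded_linear_snd S'
        smooth_on_ident]])
      (auto simp: param_bundle[OF c])
qed

text \<open>Positivity of \<open>r\<close> enters both in continuity into the open half-line and in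
  the region on which the product chart is defined.\<close>

lemma smooth_map_section:
  assumes r: "smooth_fun M r" "\<And>x. x \<in> points M \<Longrightarrow> r x > 0"
  shows "smooth_map M ray_bundle (\<lambda>x. (x, r x))"
  unfolding smooth_map_def
proof (intro conjI ballI)
  have "continuous_map (mtop M) (top_of_set {0<..}) r"
    using smooth_fun_continuous[OF M r(1)] r(2)
    by (auto simp: continuous_map_in_subtopology points_def)
  then show "continuous_map (mtop M) (mtop ray_bundle) (\<lambda>x. (x, r x))"
    by (simp add: half_line_bundle_def continuous_map_pairedI)
next
  fix c d assume c: "c \<in> charts M" and "d \<in> charts ray_bundle"
  then obtain c' where c': "c' \<in> charts M" and d: "d = lift_chart c'" by (auto simp: charts_bundle)
  let ?S = "snd c ` (chart_dom M c \<inter> chart_dom M c')"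
  have S: "open ?S" by (rule chart_image_open[OF M c dom_open[OF M c']])
  have rp: "x \<in> chart_dom M c \<Longrightarrow> r x > 0" for x
    by (rule r(2)[OF subsetD[OF dom_subset_points]])
  have eq: "snd c ` {x \<in> chart_dom M c. (x, r x) \<in> chart_dom ray_bundle d} = ?S"
    unfolding d using rp by auto
  have "smooth_on ?S (r \<circ> param M c)"
    using r(1) c smooth_on_subset[of "chart_img M c" "r \<circ> param M c" ?S]
    by (auto simp: smooth_fun_def chart_img_def)
  then have "smooth_on ?S (\<lambda>y. ((snd c' \<circ> param M c) y, (r \<circ> param M c) y))"
    by (rule smooth_on_Pair[OF S transition_smooth[OF M c c']])
  then show "smooth_on (snd c ` {x \<in> chart_dom M c. (x, r x) \<in> chart_dom ray_bundle d}) (snd d \<circ>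
      (\<lambda>x. (x, r x)) \<circ> param M c)"
    unfolding eq by (simp add: d o_def)
qed

end

section \<open>Structure equations\<close>

text \<open>One predicate for two situations: a lift on the four-dimensional half-line bundle, and
  its trace on the three-dimensional base. Hence the general manifold, the function \<open>k\<close>
  in place of a constant, and no coframe condition; \<open>\<beta>\<close> plays the part of
  \<Omega>.\<close>

definition struct_eqs ::
  "('a, 'e::euclidean_space) mfd \<Rightarrow> ('a, 'e, 'e) form \<Rightarrow> ('a, 'e, 'e) form \<Rightarrow> ('a, 'e, 'e) form \<Rightarrow>
   ('a \<Rightarrow> real) \<Rightarrow> ('a \<Rightarrow> real) \<Rightarrow> bool" where
  "struct_eqs M \<omega> \<theta> \<beta> T k \<longleftrightarrow>
     one_form M \<omega> \<and> real_form M \<omega> \<and> one_form M \<theta> \<and> one_form M \<beta> \<and> real_form M \<beta> \<and>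
     smooth_fun M T \<and> smooth_fun M k \<and>
     (ext_d M \<omega> \<doteq>\<^bsub>M\<^esub> 0) \<and>
     (ext_d M \<theta> \<doteq>\<^bsub>M\<^esub> \<beta> \<^bold>\<and> \<theta> + (\<theta> + cconj \<theta>) \<^bold>\<and> \<omega>
        + (\<lambda>x. \<i> * complex_of_real (T x)) \<odot> (\<theta> \<^bold>\<and> \<omega>)) \<and>
     (ext_d M \<beta> \<doteq>\<^bsub>M\<^esub> (\<lambda>x. \<i> * complex_of_real (k x)) \<odot> (\<theta> \<^bold>\<and> cconj \<theta>))"

lemma struct_eqsD:
  assumes "struct_eqs M \<omega> \<theta> \<beta> T k"
  shows "one_form M \<omega>" "real_form M \<omega>" "one_form M \<theta>" "one_form M \<beta>" "real_form M \<beta>"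
    "smooth_fun M T" "smooth_fun M k" "ext_d M \<omega> \<doteq>\<^bsub>M\<^esub> 0"
    "ext_d M \<theta> \<doteq>\<^bsub>M\<^esub> \<beta> \<^bold>\<and> \<theta> + (\<theta> + cconj \<theta>) \<^bold>\<and> \<omega>
        + (\<lambda>x. \<i> * complex_of_real (T x)) \<odot> (\<theta> \<^bold>\<and> \<omega>)"
    "ext_d M \<beta> \<doteq>\<^bsub>M\<^esub> (\<lambda>x. \<i> * complex_of_real (k x)) \<odot> (\<theta> \<^bold>\<and> cconj \<theta>)"
  using assms unfolding struct_eqs_def by auto

lemma real_form_cong: "real_form M \<alpha> \<Longrightarrow> \<alpha> \<doteq>\<^bsub>M\<^esub> \<beta> \<Longrightarrow> real_form M \<beta>"
  by (simp add: real_form_def form_eq_def)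

lemma real_form_smul: "real_form M \<alpha> \<Longrightarrow> real_form M ((\<lambda>x. complex_of_real (f x)) \<odot> \<alpha>)"
  by (simp add: real_form_def smul_def)

lemma real_form_add: "real_form M \<alpha> \<Longrightarrow> real_form M \<beta> \<Longrightarrow> real_form M (\<alpha> + \<beta>)"
  by (simp add: real_form_def plus_fun_def)

lemma form_eq_wedge_cong:
  "\<alpha> \<doteq>\<^bsub>M\<^esub> \<alpha>' \<Longrightarrow> \<beta> \<doteq>\<^bsub>M\<^esub> \<beta>' \<Longrightarrow> \<alpha> \<^bold>\<and> \<beta> \<doteq>\<^bsub>M\<^esub> \<alpha>' \<^bold>\<and> \<beta>'"
  by (simp add: form_eq_def wedge_def)

lemma form_eq_add_cong:
  "\<alpha> \<doteq>\<^bsub>M\<^esub> \<alpha>' \<Longrightarrow> \<beta> \<doteq>\<^bsub>M\<^esub> \<beta>' \<Longrightarrow> \<alpha> + \<beta> \<doteq>\<^bsub>M\<^esub> \<alpha>' + \<beta>'"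
  by (simp add: form_eq_def plus_fun_def)

lemma form_eq_smul:
  "\<alpha> \<doteq>\<^bsub>M\<^esub> \<alpha>' \<Longrightarrow> (\<And>x. x \<in> points M \<Longrightarrow> f x = f' x) \<Longrightarrow> f \<odot> \<alpha> \<doteq>\<^bsub>M\<^esub> f' \<odot> \<alpha>'"
  using subsetD[OF dom_subset_points] by (fastforce simp: form_eq_def smul_def)

lemma form_eq_cconj_cong: "\<alpha> \<doteq>\<^bsub>M\<^esub> \<alpha>' \<Longrightarrow> cconj \<alpha> \<doteq>\<^bsub>M\<^esub> cconj \<alpha>'"
  by (simp add: form_eq_def cconj_def)

lemmas form_eq_congs = form_eq_wedge_cong form_eq_add_cong form_eq_smul form_eq_cconj_cong
    form_eq_refl

lemma struct_eqs_cong: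
  assumes M: "smooth_atlas M" and s: "struct_eqs M \<omega> \<theta> \<beta> T k"
    and eq: "\<omega> \<doteq>\<^bsub>M\<^esub> \<omega>'" "\<theta> \<doteq>\<^bsub>M\<^esub> \<theta>'" "\<beta> \<doteq>\<^bsub>M\<^esub> \<beta>'"
      "\<And>x. x \<in> points M \<Longrightarrow> T x = T' x" "\<And>x. x \<in> points M \<Longrightarrow> k x = k' x"
  shows "struct_eqs M \<omega>' \<theta>' \<beta>' T' k'"
proof -
  note D = struct_eqsD[OF s]
  have "ext_d M \<omega>' \<doteq>\<^bsub>M\<^esub> 0"
    by (rule form_eq_trans[OF form_eq_sym[OF ext_d_cong[OF M eq(1)]] D(8)])
  moreover have "ext_d M \<theta>' \<doteq>\<^bsub>M\<^esub> \<beta>' \<^bold>\<and> \<theta>' + (\<theta>' + cconj \<theta>') \<^bold>\<and> \<omega>'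
        + (\<lambda>x. \<i> * complex_of_real (T' x)) \<odot> (\<theta>' \<^bold>\<and> \<omega>')"
    by (rule form_eq_trans[OF form_eq_sym[OF ext_d_cong[OF M eq(2)]] form_eq_trans[OF D(9)]])
      (intro form_eq_congs eq, simp add: eq)
  moreover have "ext_d M \<beta>' \<doteq>\<^bsub>M\<^esub> (\<lambda>x. \<i> * complex_of_real (k' x)) \<odot> (\<theta>' \<^bold>\<and> cconj \<theta>')"
    by (rule form_eq_trans[OF form_eq_sym[OF ext_d_cong[OF M eq(3)]] form_eq_trans[OF D(10)]])
      (intro form_eq_congs eq, simp add: eq)
  ultimately show ?thesis
    unfolding struct_eqs_def
    using one_form_cong[OF M D(1) eq(1)] one_form_cong[OF M D(3) eq(2)] one_form_cong[OF M D(4)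
        eq(3)]
      real_form_cong[OF D(2) eq(1)] real_form_cong[OF D(5) eq(3)]
      smooth_fun_cong[OF M D(6) eq(4)] smooth_fun_cong[OF M D(7) eq(5)]
    by simp
qed

lemma real_form_pullback:
  assumes "smooth_atlas M" "smooth_atlas N" "smooth_map M N \<psi>" "one_form N \<alpha>" "real_form N \<alpha>"
  shows "real_form M (pullback M N \<psi> \<alpha>)"
  unfolding real_form_def
proof (intro ballI allI)
  fix c x v assume c: "c \<in> charts M" "x \<in> chart_dom M c"
  obtain c' where c': "c' \<in> charts N" "\<psi> x \<in> chart_dom N c'" using exists_target_chart[OF assms(1-3)
      c(2)] .
  show "pullback M N \<psi> \<alpha> c x v \<in> \<real>"
    unfolding pullback_eq[OF assms(1-4) c(1) c'(1) c(2) c'(2)]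
    using assms(5) c' by (simp add: real_form_def)
qed

text \<open>All forms are evaluated in one target chart on the images of the vectors, where the
  equations hold literally.\<close>

lemma struct_eqs_pullback:
  fixes M :: "('a, 'e::euclidean_space) mfd" and N :: "('b, 'g::euclidean_space) mfd"
  assumes M: "smooth_atlas M" and N: "smooth_atlas N" and \<psi>: "smooth_map M N \<psi>"
    and s: "struct_eqs N \<omega> \<theta> \<beta> T k"
  shows "struct_eqs M (pullback M N \<psi> \<omega>) (pullback M N \<psi> \<theta>) (pullback M N \<psi> \<beta>)
    (\<lambda>x. T (\<psi> x)) (\<lambda>x. k (\<psi> x))"
proof -
  note D = struct_eqsD[OF s]
  note pe = pullback_eq[OF M N \<psi>] and de = ext_d_pullback[OF M N \<psi>]
  have "ext_d M (pullback M N \<psi> \<omega>) \<doteq>\<^bsub>M\<^esub> 0"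
    "ext_d M (pullback M N \<psi> \<theta>) \<doteq>\<^bsub>M\<^esub> pullback M N \<psi> \<beta> \<^bold>\<and> pullback M N \<psi> \<theta>
      + (pullback M N \<psi> \<theta> + cconj (pullback M N \<psi> \<theta>)) \<^bold>\<and> pullback M N \<psi> \<omega>
      + (\<lambda>x. \<i> * complex_of_real (T (\<psi> x))) \<odot> (pullback M N \<psi> \<theta> \<^bold>\<and> pullback M N \<psi> \<omega>)"
    "ext_d M (pullback M N \<psi> \<beta>) \<doteq>\<^bsub>M\<^esub>
      (\<lambda>x. \<i> * complex_of_real (k (\<psi> x))) \<odot> (pullback M N \<psi> \<theta> \<^bold>\<and> cconj (pullback M N \<psi> \<theta>))"
  proof (rule_tac [!] form_eqI)
    fix c x and v :: "'e \<times> 'e" assume c: "c \<in> charts M" "x \<in> chart_dom M c"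
    obtain c' where c': "c' \<in> charts N" "\<psi> x \<in> chart_dom N c'" using exists_target_chart[OF M N \<psi>
        c(2)] .
    obtain u w :: 'e where v: "v = (u, w)" by (rule prod.exhaust)
    note r = c(1) c'(1) c(2) c'(2)
    show "ext_d M (pullback M N \<psi> \<omega>) c x v = 0 c x v"
      unfolding v de[OF D(1) r] form_eqD[OF D(8) c'] by (simp add: zero_fun_def)
    show "ext_d M (pullback M N \<psi> \<theta>) c x v = (pullback M N \<psi> \<beta> \<^bold>\<and> pullback M N \<psi> \<theta>
      + (pullback M N \<psi> \<theta> + cconj (pullback M N \<psi> \<theta>)) \<^bold>\<and> pullback M N \<psi> \<omega>
      + (\<lambda>x. \<i> * complex_of_real (T (\<psi> x))) \<odot> (pullback M N \<psi> \<theta> \<^bold>\<and> pullback M N \<psi> \<omega>)) c x v"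
      unfolding v de[OF D(3) r] form_eqD[OF D(9) c']
      by (simp add: smul_def cconj_def wedge_def plus_fun_def pe[OF D(1) r] pe[OF D(3) r] pe[OF D(4)
          r])
    show "ext_d M (pullback M N \<psi> \<beta>) c x v =
      ((\<lambda>x. \<i> * complex_of_real (k (\<psi> x))) \<odot> (pullback M N \<psi> \<theta> \<^bold>\<and> cconj (pullback M N \<psi> \<theta>))) c x v"
      unfolding v de[OF D(4) r] form_eqD[OF D(10) c']
      by (simp add: smul_def cconj_def wedge_def plus_fun_def pe[OF D(3) r])
  qed
  then show ?thesis
    unfolding struct_eqs_def
    using one_form_pullback[OF M N \<psi> D(1)] one_form_pullback[OF M N \<psi> D(3)] one_form_pullback[OF M N
        \<psi> D(4)]
      real_form_pullback[OF M N \<psi> D(1,2)] real_form_pullback[OF M N \<psi> D(4,5)]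
      smooth_fun_compose[OF M N \<psi> D(6)] smooth_fun_compose[OF M N \<psi> D(7)]
    by simp
qed

text \<open>In d(g \<theta>) the term dg \<and> \<theta> equals (dg / g) \<and> (g \<theta>) and is
  absorbed into \<open>\<beta>\<close>. Reality of \<open>g\<close> makes
  \<open>cconj \<theta>\<close> scale by the same factor. A negative \<open>g\<close> is allowed,
  since dg / g is d ln |g|.\<close>

lemma struct_eqs_scale:
  fixes g :: "'a \<Rightarrow> real" and M :: "('a, 'e::euclidean_space) mfd"
  assumes M: "smooth_atlas M" and s: "struct_eqs M \<omega> \<theta> \<beta> T k"
    and g: "smooth_fun M g" "\<And>x. x \<in> points M \<Longrightarrow> g x \<noteq> 0"
  defines "G \<equiv> \<lambda>x. complex_of_real (g x)"
  shows "struct_eqs M \<omega> (G \<odot> \<theta>) (\<beta> + (\<lambda>x. inverse (G x)) \<odot> dfun M G) T (\<lambda>x. k x / (g x)\<^sup>2)"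
proof -
  note D = struct_eqsD[OF s]
  have G: "smooth_fun M G" unfolding G_def by (rule smooth_fun_of_real[OF M g(1)])
  have G0: "G x \<noteq> 0" if "x \<in> points M" for x using g(2)[OF that] by (simp add: G_def)
  have iG: "smooth_fun M (\<lambda>x. inverse (G x))" by (rule smooth_fun_inverse[OF M G G0])
  have dG: "one_form M (dfun M G)" by (rule one_form_dfun[OF M G])
  have fs: "one_form M ((\<lambda>x. inverse (G x)) \<odot> dfun M G)" by (rule one_form_smul[OF M iG dG])
  have rdG: "real_form M (dfun M G)"
    unfolding real_form_def G_def by (auto intro: dfun_of_real_Reals[OF M g(1)])
  have rf: "real_form M ((\<lambda>x. inverse (G x)) \<odot> dfun M G)"
    using real_form_smul[OF rdG, of "\<lambda>x. inverse (g x)"] by (simp add: G_def)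
  have k: "smooth_fun M (\<lambda>x. k x / (g x)\<^sup>2)"
    unfolding power2_eq_square
    by (rule smooth_fun_divide[OF M D(7) smooth_fun_mult[OF M g(1) g(1)]]) (use g(2) in simp)
  have e1: "ext_d M (G \<odot> \<theta>) \<doteq>\<^bsub>M\<^esub> (\<beta> + (\<lambda>x. inverse (G x)) \<odot> dfun M G) \<^bold>\<and> (G \<odot> \<theta>)
      + (G \<odot> \<theta> + cconj (G \<odot> \<theta>)) \<^bold>\<and> \<omega> + (\<lambda>x. \<i> * complex_of_real (T x)) \<odot> ((G \<odot> \<theta>) \<^bold>\<and> \<omega>)"
  proof (rule form_eqI)
    fix c x and v :: "'e \<times> 'e" assume c: "c \<in> charts M" "x \<in> chart_dom M c"
    obtain u w :: 'e where v: "v = (u, w)" by (rule prod.exhaust)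
    have "G x \<noteq> 0" by (rule G0[OF subsetD[OF dom_subset_points c(2)]])
    moreover have "cnj (G x) = G x" by (simp add: G_def)
    ultimately show "ext_d M (G \<odot> \<theta>) c x v = ((\<beta> + (\<lambda>x. inverse (G x)) \<odot> dfun M G) \<^bold>\<and> (G \<odot> \<theta>)
      + (G \<odot> \<theta> + cconj (G \<odot> \<theta>)) \<^bold>\<and> \<omega> + (\<lambda>x. \<i> * complex_of_real (T x)) \<odot> ((G \<odot> \<theta>) \<^bold>\<and> \<omega>)) c x v"
      unfolding form_eqD[OF ext_d_smul[OF M G D(3)] c]
      unfolding plus_fun_def smul_def form_eqD[OF D(9) c] v wedge_def cconj_def case_prod_conv
      by (simp add: field_simps)
  qed
  have e2: "ext_d M (\<beta> + (\<lambda>x. inverse (G x)) \<odot> dfun M G) \<doteq>\<^bsub>M\<^esub>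
      (\<lambda>x. \<i> * complex_of_real (k x / (g x)\<^sup>2)) \<odot> ((G \<odot> \<theta>) \<^bold>\<and> cconj (G \<odot> \<theta>))"
  proof (rule form_eqI)
    fix c x and v :: "'e \<times> 'e" assume c: "c \<in> charts M" "x \<in> chart_dom M c"
    obtain u w :: 'e where v: "v = (u, w)" by (rule prod.exhaust)
    have "g x \<noteq> 0" by (rule g(2)[OF subsetD[OF dom_subset_points c(2)]])
    moreover have "ext_d M (dfun M G) c x v = 0"
      using form_eqD[OF ext_d_dfun[OF M G] c] by (simp add: zero_fun_def)
    moreover have "ext_d M ((\<lambda>x. inverse (G x)) \<odot> dfun M G) c x v
        = (dfun M (\<lambda>x. inverse (G x)) \<^bold>\<and> dfun M G + (\<lambda>x. inverse (G x)) \<odot> ext_d M (dfun M G)) c x v"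
      by (rule form_eqD[OF ext_d_smul[OF M iG dG] c])
    moreover have "ext_d M (\<beta> + (\<lambda>x. inverse (G x)) \<odot> dfun M G) c x v
        = ext_d M \<beta> c x v + ext_d M ((\<lambda>x. inverse (G x)) \<odot> dfun M G) c x v"
      using form_eqD[OF ext_d_add[OF M D(4) fs] c] by (simp add: plus_fun_def)
    moreover have "ext_d M \<beta> c x v = \<i> * complex_of_real (k x) * (\<theta> c x u * cnj (\<theta> c x w) - \<theta> c x w
        * cnj (\<theta> c x u))"
      unfolding form_eqD[OF D(10) c] by (simp add: v smul_def wedge_def cconj_def)
    \<comment> \<open>Since d(1 / G) is proportional to dG, its wedge product with dG vanishes: the
      correction dG / G is closed and only d\<beta> remains.\<close>
    moreover have "dfun M (\<lambda>x. inverse (G x)) c x u = - (dfun M G c x u / (G x)\<^sup>2)" for u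
      by (rule dfun_inverse[OF M G G0 c])
    ultimately show "ext_d M (\<beta> + (\<lambda>x. inverse (G x)) \<odot> dfun M G) c x v =
      ((\<lambda>x. \<i> * complex_of_real (k x / (g x)\<^sup>2)) \<odot> ((G \<odot> \<theta>) \<^bold>\<and> cconj (G \<odot> \<theta>))) c x v"
      unfolding v by (simp add: plus_fun_def smul_def wedge_def cconj_def) (simp add: G_def
          field_simps power2_eq_square)
  qed
  show ?thesis
    unfolding struct_eqs_def
    using D(1,2,6,8) one_form_smul[OF M G D(3)] one_form_add[OF M D(4) fs] real_form_add[OF D(5) rf]
        k e1 e2
    by simp
qed

section \<open>Lifts and their sections\<close>

text \<open>The shape that the existential part of \<open>adapted_lift\<close> takes on the section
  where the fibre coordinate equals \<open>r\<close>: the fibre coordinate becomes the modulus of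
  the factor in front of \<open>\<mu>\<close>.\<close>

definition adapted_base ::
  "('a, 'e::euclidean_space) mfd \<Rightarrow> ('a, 'e, 'e) form \<Rightarrow> ('a, 'e, 'e) form \<Rightarrow>
   ('a, 'e, 'e) form \<Rightarrow> ('a, 'e, 'e) form \<Rightarrow> ('a \<Rightarrow> real) \<Rightarrow> bool" where
  "adapted_base M lam \<mu> \<omega> \<theta> r \<longleftrightarrow> (\<exists>s (\<sigma>::real) (\<phi> :: 'a \<Rightarrow> real).
     no_twist_shear M lam \<mu> s \<and> \<sigma> \<in> {1, -1} \<and> smooth_fun M \<phi> \<and>
     \<omega> \<doteq>\<^bsub>M\<^esub> (\<lambda>x. complex_of_real (\<sigma> * cmod (s x))) \<odot> lam \<and>
     \<theta> \<doteq>\<^bsub>M\<^esub> (\<lambda>x. complex_of_real (r x) * cis (\<phi> x)) \<odot> \<mu>)"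

lemma adapted_base_cong:
  assumes "adapted_base M lam \<mu> \<omega> \<theta> r" "\<omega> \<doteq>\<^bsub>M\<^esub> \<omega>'" "\<theta> \<doteq>\<^bsub>M\<^esub> \<theta>'"
  shows "adapted_base M lam \<mu> \<omega>' \<theta>' r"
  using assms unfolding adapted_base_def by (meson form_eq_sym form_eq_trans)

context
  fixes M :: "('a, 'e::euclidean_space) mfd" and lam \<mu> :: "('a, 'e, 'e) form"
  assumes M: "smooth_atlas M" and lam: "one_form M lam" "real_form M lam" and \<mu>: "one_form M \<mu>"
begin

lemma pullback_section_fst:
  assumes r: "smooth_fun M r" "\<And>x. x \<in> points M \<Longrightarrow> r x > 0" and \<alpha>: "one_form M \<alpha>"
  shows "pullback M (ray_bundle M) (\<lambda>x. (x, r x)) (pullback (ray_bundle M) M fst \<alpha>) \<doteq>\<^bsub>M\<^esub> \<alpha>"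
  by (rule pullback_inverse[OF M smooth_atlas_bundle[OF M] smooth_map_section[OF M r]
      smooth_map_fst[OF M] _ \<alpha>])
    simp_all

text \<open>The section is arbitrary. It is used at radius 1 before normalization, and along the
  normalizing section when an invariant coframe is analysed.\<close>

lemma adapted_lift_section:
  assumes L: "adapted_lift M lam \<mu> \<omega> \<theta> \<beta> T K0 T1 K1" and cond: "lift_conditions M K0 T1 K1"
    and r: "smooth_fun M r" "\<And>x. x \<in> points M \<Longrightarrow> r x > 0"
  defines "S \<equiv> pullback M (ray_bundle M) (\<lambda>x. (x, r x))"
  shows "struct_eqs M (S \<omega>) (S \<theta>) (S \<beta>) (\<lambda>x. T (x, r x)) (\<lambda>x. K0 (x, r x))"
    and "adapted_base M lam \<mu> (S \<omega>) (S \<theta>) r"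
proof -
  note P = smooth_atlas_bundle[OF M] and sec = smooth_map_section[OF M r]
  obtain s \<sigma> \<phi> where s: "no_twist_shear M lam \<mu> s" "\<sigma> \<in> {1, -1::real}" "smooth_fun M \<phi>"
    and \<omega>: "\<omega> \<doteq>\<^bsub>ray_bundle M\<^esub> pullback (ray_bundle M) M fst ((\<lambda>x. complex_of_real (\<sigma> * cmod (s x)))
        \<odot> lam)"
    and \<theta>: "\<theta> \<doteq>\<^bsub>ray_bundle M\<^esub> (\<lambda>(x, \<rho>). complex_of_real \<rho>) \<odot> pullback (ray_bundle M) M fst ((\<lambda>x. cis
        (\<phi> x)) \<odot> \<mu>)"
    using L unfolding adapted_lift_def Let_def by (elim conjE exE) (rule that)
  have D: "one_form (ray_bundle M) \<omega>" "one_form (ray_bundle M) \<theta>" "one_form (ray_bundle M) \<beta>"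
      "real_form (ray_bundle M) \<beta>"
    "smooth_fun (ray_bundle M) T" "smooth_fun (ray_bundle M) K0"
    "ext_d (ray_bundle M) \<omega> \<doteq>\<^bsub>ray_bundle M\<^esub> T1 \<odot> (\<theta> \<^bold>\<and> \<omega>) + (\<lambda>z. cnj (T1 z)) \<odot> (cconj \<theta> \<^bold>\<and> \<omega>)"
    "ext_d (ray_bundle M) \<theta> \<doteq>\<^bsub>ray_bundle M\<^esub> \<beta> \<^bold>\<and> \<theta> + (\<theta> + cconj \<theta>) \<^bold>\<and> \<omega>
       + (\<lambda>z. \<i> * complex_of_real (T z)) \<odot> (\<theta> \<^bold>\<and> \<omega>)"
    "ext_d (ray_bundle M) \<beta> \<doteq>\<^bsub>ray_bundle M\<^esub> (\<lambda>z. \<i> * complex_of_real (K0 z)) \<odot> (\<theta> \<^bold>\<and> cconj \<theta>)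
       + K1 \<odot> (\<theta> \<^bold>\<and> \<omega>) + (\<lambda>z. cnj (K1 z)) \<odot> (cconj \<theta> \<^bold>\<and> \<omega>)"
    using L unfolding adapted_lift_def Let_def by auto
  have z: "T1 z = 0" "K1 z = 0" if "z \<in> points (ray_bundle M)" for z
    using cond that unfolding lift_conditions_def by auto
  have "T1 \<odot> (\<theta> \<^bold>\<and> \<omega>) + (\<lambda>z. cnj (T1 z)) \<odot> (cconj \<theta> \<^bold>\<and> \<omega>) \<doteq>\<^bsub>ray_bundle M\<^esub> 0"
    by (rule form_eqI) (simp add: form_simps z subsetD[OF dom_subset_points] case_prod_beta del:
        points_bundle)
  then have e1: "ext_d (ray_bundle M) \<omega> \<doteq>\<^bsub>ray_bundle M\<^esub> 0" by (rule form_eq_trans[OF D(7)])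
  have "(\<lambda>z. \<i> * complex_of_real (K0 z)) \<odot> (\<theta> \<^bold>\<and> cconj \<theta>)
       + K1 \<odot> (\<theta> \<^bold>\<and> \<omega>) + (\<lambda>z. cnj (K1 z)) \<odot> (cconj \<theta> \<^bold>\<and> \<omega>)
     \<doteq>\<^bsub>ray_bundle M\<^esub> (\<lambda>z. \<i> * complex_of_real (K0 z)) \<odot> (\<theta> \<^bold>\<and> cconj \<theta>)"
    by (rule form_eqI) (simp add: form_simps z subsetD[OF dom_subset_points] case_prod_beta del:
        points_bundle)
  then have e2: "ext_d (ray_bundle M) \<beta> \<doteq>\<^bsub>ray_bundle M\<^esub> (\<lambda>z. \<i> * complex_of_real (K0 z)) \<odot> (\<theta> \<^bold>\<and>
      cconj \<theta>)"
    by (rule form_eq_trans[OF D(9)])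
  \<comment> \<open>Reality of \<open>\<omega>\<close> is not listed in \<open>adapted_lift\<close>;
    it is inherited from \<open>lam\<close> through a real factor.\<close>
  have "real_form (ray_bundle M) (pullback (ray_bundle M) M fst ((\<lambda>x. complex_of_real (\<sigma> * cmod (s
      x))) \<odot> lam))"
    unfolding pullback_smul
    by (intro real_form_smul real_form_pullback[OF P M smooth_map_fst[OF M] lam])
  then have "real_form (ray_bundle M) \<omega>" using real_form_cong form_eq_sym[OF \<omega>] by auto
  then have "struct_eqs (ray_bundle M) \<omega> \<theta> \<beta> T K0"
    using D e1 e2 unfolding struct_eqs_def by simp
  from struct_eqs_pullback[OF M P sec this]
  show "struct_eqs M (S \<omega>) (S \<theta>) (S \<beta>) (\<lambda>x. T (x, r x)) (\<lambda>x. K0 (x, r x))"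
    by (simp add: S_def)
  have "S \<omega> \<doteq>\<^bsub>M\<^esub> (\<lambda>x. complex_of_real (\<sigma> * cmod (s x))) \<odot> lam"
    using form_eq_trans[OF pullback_cong[OF M P sec \<omega>]] form_eq_smul[OF pullback_section_fst[OF r
        lam(1)]]
    unfolding S_def pullback_smul by simp
  moreover have "S \<theta> \<doteq>\<^bsub>M\<^esub> (\<lambda>x. complex_of_real (r x) * cis (\<phi> x)) \<odot> \<mu>"
  proof -
    have "S \<theta> \<doteq>\<^bsub>M\<^esub> (\<lambda>x. complex_of_real (r x)) \<odot> (\<lambda>x. cis (\<phi> x)) \<odot> S (pullback (ray_bundle M) M fst
        \<mu>)"
      using pullback_cong[OF M P sec \<theta>] unfolding S_def pullback_smul by simp
    also have "(\<lambda>x. complex_of_real (r x)) \<odot> (\<lambda>x. cis (\<phi> x)) \<odot> S (pullback (ray_bundle M) M fst \<mu>)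
      = (\<lambda>x. complex_of_real (r x) * cis (\<phi> x)) \<odot> S (pullback (ray_bundle M) M fst \<mu>)"
      by (simp add: smul_def mult.assoc)
    finally have 1: "S \<theta> \<doteq>\<^bsub>M\<^esub> (\<lambda>x. complex_of_real (r x) * cis (\<phi> x)) \<odot> S (pullback (ray_bundle M) M
        fst \<mu>)" .
    show ?thesis
      by (rule form_eq_trans[OF 1 form_eq_smul]) (simp_all add: S_def pullback_section_fst[OF r \<mu>])
  qed
  ultimately show "adapted_base M lam \<mu> (S \<omega>) (S \<theta>) r"
    unfolding adapted_base_def using s by blast
qed

text \<open>The lift is \<open>\<omega>1 = (\<rho> / r) \<theta>\<close>, \<open>\<Omega> = \<beta> + d ln (\<rho> / r)\<close> and \<open>K0 = \<epsilon> r\<^sup>2 / \<rho>\<^sup>2\<close>.\<close>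

lemma invariant_coframeI:
  assumes s: "struct_eqs M \<omega> \<theta> \<beta> T (\<lambda>_. \<epsilon>)" and b: "adapted_base M lam \<mu> \<omega> \<theta> r"
    and r: "smooth_fun M r" "\<And>x. x \<in> points M \<Longrightarrow> r x > 0" and \<epsilon>: "\<epsilon> \<in> {1, -1::real}"
  shows "invariant_coframe M lam \<mu> \<epsilon> \<omega> \<theta> \<beta> T"
proof -
  note P = smooth_atlas_bundle[OF M] and sec = smooth_map_section[OF M r] and F = smooth_map_fst[OF
      M]
  note D = struct_eqsD[OF s]
  define g where "g = (\<lambda>z :: 'a \<times> real. snd z / r (fst z))"
  define G where "G = (\<lambda>z. complex_of_real (g z))"
  let ?pb = "pullback (ray_bundle M) M fst" and ?S = "pullback M (ray_bundle M) (\<lambda>x. (x, r x))"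
  define \<beta>P where "\<beta>P = ?pb \<beta> + (\<lambda>z. inverse (G z)) \<odot> dfun (ray_bundle M) G"
  have rp: "r (fst z) > 0" "snd z > 0" if "z \<in> points (ray_bundle M)" for z using that r(2) by auto
  have g: "smooth_fun (ray_bundle M) g" unfolding g_def
  proof (rule smooth_fun_divide[OF P smooth_fun_snd[OF M] smooth_fun_compose[OF P M F r(1)]])
    show "r (fst z) \<noteq> 0" if "z \<in> points (ray_bundle M)" for z using rp[OF that] by simp
  qed
  have g0: "g z > 0" if "z \<in> points (ray_bundle M)" for z using rp[OF that] by (simp add: g_def)
  have g0': "g z \<noteq> 0" if "z \<in> points (ray_bundle M)" for z using g0[OF that] by simp
  have SP: "struct_eqs (ray_bundle M) (?pb \<omega>) (G \<odot> ?pb \<theta>) \<beta>P (\<lambda>z. T (fst z)) (\<lambda>z. \<epsilon> / (g z)\<^sup>2)"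
    unfolding \<beta>P_def G_def
    by (rule struct_eqs_scale[OF P struct_eqs_pullback[OF P M F s] g g0'])
  note E = struct_eqsD[OF SP]
  obtain sh \<sigma> \<phi> where sh: "no_twist_shear M lam \<mu> sh" "\<sigma> \<in> {1, -1::real}" "smooth_fun M \<phi>"
    and \<omega>: "\<omega> \<doteq>\<^bsub>M\<^esub> (\<lambda>x. complex_of_real (\<sigma> * cmod (sh x))) \<odot> lam"
    and \<theta>: "\<theta> \<doteq>\<^bsub>M\<^esub> (\<lambda>x. complex_of_real (r x) * cis (\<phi> x)) \<odot> \<mu>"
    using b unfolding adapted_base_def by (elim conjE exE) (rule that)
  have \<omega>P: "?pb \<omega> \<doteq>\<^bsub>ray_bundle M\<^esub> ?pb ((\<lambda>x. complex_of_real (\<sigma> * cmod (sh x))) \<odot> lam)"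
    by (rule pullback_cong[OF P M F \<omega>])
  have \<theta>P: "G \<odot> ?pb \<theta> \<doteq>\<^bsub>ray_bundle M\<^esub> (\<lambda>(x, \<rho>). complex_of_real \<rho>) \<odot> ?pb ((\<lambda>x. cis (\<phi> x)) \<odot> \<mu>)"
  proof (rule form_eq_trans[OF form_eq_smul[OF pullback_cong[OF P M F \<theta>] refl]], rule form_eqI)
    fix c z v assume "z \<in> chart_dom (ray_bundle M) c"
    then have "r (fst z) > 0" by (intro rp subsetD[OF dom_subset_points])
    then show "(G \<odot> ?pb ((\<lambda>x. complex_of_real (r x) * cis (\<phi> x)) \<odot> \<mu>)) c z v =
        ((\<lambda>(x, \<rho>). complex_of_real \<rho>) \<odot> ?pb ((\<lambda>x. cis (\<phi> x)) \<odot> \<mu>)) c z v"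
      unfolding pullback_smul by (simp add: smul_def G_def g_def case_prod_beta)
  qed
  have AL: "adapted_lift M lam \<mu> (?pb \<omega>) (G \<odot> ?pb \<theta>) \<beta>P (\<lambda>z. T (fst z)) (\<lambda>z. \<epsilon> / (g z)\<^sup>2) (\<lambda>_. 0)
      (\<lambda>_. 0)"
    unfolding adapted_lift_def Let_def
  proof (intro conjI)
    show "\<exists>s \<sigma> \<phi>. no_twist_shear M lam \<mu> s \<and> \<sigma> \<in> {1, -1::real} \<and> smooth_fun M \<phi> \<and>
        ?pb \<omega> \<doteq>\<^bsub>ray_bundle M\<^esub> ?pb ((\<lambda>x. complex_of_real (\<sigma> * cmod (s x))) \<odot> lam) \<and>
        G \<odot> ?pb \<theta> \<doteq>\<^bsub>ray_bundle M\<^esub> (\<lambda>(x, \<rho>). complex_of_real \<rho>) \<odot> ?pb ((\<lambda>x. cis (\<phi> x)) \<odot> \<mu>)"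
      using sh \<omega>P \<theta>P by blast
    show "ext_d (ray_bundle M) (?pb \<omega>) \<doteq>\<^bsub>ray_bundle M\<^esub> (\<lambda>_. 0) \<odot> ((G \<odot> ?pb \<theta>) \<^bold>\<and> ?pb \<omega>)
        + (\<lambda>z. cnj 0) \<odot> (cconj (G \<odot> ?pb \<theta>) \<^bold>\<and> ?pb \<omega>)"
      by (rule form_eq_trans[OF E(8)], rule form_eqI) (simp add: smul_def plus_fun_def zero_fun_def)
    show "ext_d (ray_bundle M) \<beta>P \<doteq>\<^bsub>ray_bundle M\<^esub>
        (\<lambda>z. \<i> * complex_of_real (\<epsilon> / (g z)\<^sup>2)) \<odot> ((G \<odot> ?pb \<theta>) \<^bold>\<and> cconj (G \<odot> ?pb \<theta>))
        + (\<lambda>_. 0) \<odot> ((G \<odot> ?pb \<theta>) \<^bold>\<and> ?pb \<omega>) + (\<lambda>z. cnj 0) \<odot> (cconj (G \<odot> ?pb \<theta>) \<^bold>\<and> ?pb \<omega>)"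
      by (rule form_eq_trans[OF E(10)], rule form_eqI) (simp add: smul_def plus_fun_def)
  qed (use E smooth_fun_const in auto)
  have gs: "g (x, r x) = 1" if "x \<in> points M" for x using r(2)[OF that] by (simp add: g_def)
  have S1: "\<omega> \<doteq>\<^bsub>M\<^esub> ?S (?pb \<omega>)" by (rule form_eq_sym[OF pullback_section_fst[OF r D(1)]])
  have S2: "\<theta> \<doteq>\<^bsub>M\<^esub> ?S (G \<odot> ?pb \<theta>)"
  proof -
    have "?S (G \<odot> ?pb \<theta>) \<doteq>\<^bsub>M\<^esub> (\<lambda>_. 1) \<odot> \<theta>"
      unfolding pullback_smul
      by (rule form_eq_smul[OF pullback_section_fst[OF r D(3)]]) (simp_all add: G_def gs)
    also have "(\<lambda>_. 1) \<odot> \<theta> = \<theta>" by (simp add: smul_def)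
    finally show ?thesis by (rule form_eq_sym)
  qed
  \<comment> \<open>Along the section the rescaling factor is constantly 1, so its differential
    pulls back to zero and the correction term of \<open>\<beta>P\<close> vanishes.\<close>
  have SG: "?S (dfun (ray_bundle M) G) \<doteq>\<^bsub>M\<^esub> 0"
  proof (rule form_eqI)
    fix c x v assume c: "c \<in> charts M" "x \<in> chart_dom M c"
    have G: "smooth_fun (ray_bundle M) G" unfolding G_def by (rule smooth_fun_of_real[OF P g])
    obtain c' where c': "c' \<in> charts (ray_bundle M)" "(x, r x) \<in> chart_dom (ray_bundle M) c'"
      using exists_target_chart[OF M P sec c(2)] .
    have "?S (dfun (ray_bundle M) G) c x v = dfun M (\<lambda>x. G (x, r x)) c x v"
      using pullback_eq[OF M P sec one_form_dfun[OF P G] c(1) c'(1) c(2) c'(2)]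
        dfun_pullback[OF M P sec G c(1) c'(1) c(2) c'(2)] by simp
    also have "\<dots> = dfun M (\<lambda>_. 1) c x v"
      by (rule form_eqD[OF dfun_cong[OF M] c]) (simp add: G_def gs)
    also have "\<dots> = 0 c x v" by (simp add: dfun_const[OF M] zero_fun_def)
    finally show "?S (dfun (ray_bundle M) G) c x v = 0 c x v" .
  qed
  have S3: "\<beta> \<doteq>\<^bsub>M\<^esub> ?S \<beta>P"
  proof (rule form_eqI)
    fix c x v assume c: "c \<in> charts M" "x \<in> chart_dom M c"
    show "\<beta> c x v = ?S \<beta>P c x v"
      unfolding \<beta>P_def pullback_add pullback_smul
      using form_eqD[OF SG c] form_eqD[OF pullback_section_fst[OF r D(4)] c]
      by (simp add: smul_def plus_fun_def zero_fun_def)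
  qed
  have sgn: "sgn (\<epsilon> / (g z)\<^sup>2) = \<epsilon>" if "z \<in> points (ray_bundle M)" for z
    using \<epsilon> g0[OF that] by auto
  show ?thesis
    unfolding invariant_coframe_def Let_def
  proof (intro conjI exI)
    show "lift_conditions M (\<lambda>z. \<epsilon> / (g z)\<^sup>2) (\<lambda>_. 0) (\<lambda>_. 0)"
      unfolding lift_conditions_def using \<epsilon> g0' by auto
    show "\<forall>x\<in>points M. r x > 0 \<and> \<epsilon> / (g (x, r x))\<^sup>2 = \<epsilon>" using r(2) gs by simp
    show "\<forall>x\<in>points M. T x = T (fst (x, r x))" by simp
  qed (use \<epsilon> AL r(1) S1 S2 S3 sgn in blast)+
qed

text \<open>Reads an invariant coframe as data on the base. The radius \<open>r\<close> of the
  section is retained because \<open>adapted_base\<close> expresses \<open>\<theta>\<close> through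
  it.\<close>

lemma invariant_coframeD:
  assumes "invariant_coframe M lam \<mu> \<epsilon> \<omega> \<theta> \<beta> T"
  obtains r where "smooth_fun M r" "\<forall>x\<in>points M. r x > 0" "\<epsilon> \<in> {1, -1}"
    "struct_eqs M \<omega> \<theta> \<beta> T (\<lambda>_. \<epsilon>)" "adapted_base M lam \<mu> \<omega> \<theta> r"
proof -
  have "\<epsilon> \<in> {1, -1}" using assms unfolding invariant_coframe_def Let_def by (elim conjE)
  moreover obtain \<omega>P \<omega>1P \<Omega>P T0P K0 T1 K1 r where
     L: "adapted_lift M lam \<mu> \<omega>P \<omega>1P \<Omega>P T0P K0 T1 K1" "lift_conditions M K0 T1 K1"
     and r: "smooth_fun M r" "\<forall>x\<in>points M. r x > 0 \<and> K0 (x, r x) = \<epsilon>"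
     and e: "\<omega> \<doteq>\<^bsub>M\<^esub> pullback M (ray_bundle M) (\<lambda>x. (x, r x)) \<omega>P" "\<theta> \<doteq>\<^bsub>M\<^esub> pullback M (ray_bundle M)
         (\<lambda>x. (x, r x)) \<omega>1P"
       "\<beta> \<doteq>\<^bsub>M\<^esub> pullback M (ray_bundle M) (\<lambda>x. (x, r x)) \<Omega>P" "\<forall>x\<in>points M. T x = T0P (x, r x)"
    using assms unfolding invariant_coframe_def Let_def by (elim conjE exE) (rule that)
  have r0: "r x > 0" if "x \<in> points M" for x using r(2) that by simp
  have "struct_eqs M \<omega> \<theta> \<beta> T (\<lambda>_. \<epsilon>)"
    by (rule struct_eqs_cong[OF M adapted_lift_section(1)[OF L r(1) r0] form_eq_sym[OF e(1)]
        form_eq_sym[OF e(2)]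
        form_eq_sym[OF e(3)]]) (use e(4) r(2) in auto)
  moreover have "adapted_base M lam \<mu> \<omega> \<theta> r"
    by (rule adapted_base_cong[OF adapted_lift_section(2)[OF L r(1) r0] form_eq_sym[OF e(1)]
        form_eq_sym[OF e(2)]])
  ultimately show thesis using r(1) r0 that by blast
qed

end

lemma oriented_congruenceD:
  assumes "oriented_congruence M lam \<mu>"
  shows "one_form M lam" "real_form M lam" "one_form M \<mu>" "coframe M lam \<mu>"
  using assms unfolding oriented_congruence_def by auto

section \<open>Restriction of structures to open submanifolds\<close>

context
  fixes M :: "('a, 'e::euclidean_space) mfd" and U
  assumes M: "smooth_atlas M" and U: "openin (mtop M) U"
begin

lemma no_twist_shear_submfd:
  assumes lam: "one_form M lam" and \<mu>: "one_form M \<mu>" and s: "no_twist_shear M lam \<mu> s"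
  shows "no_twist_shear (M\<restriction>U) lam \<mu> s"
proof -
  obtain a b p q where *: "structure_functions M lam \<mu> a b p q s" "\<forall>x\<in>points M. a x = 0 \<and> s x \<noteq> 0"
    using s unfolding no_twist_shear_def by blast
  have E: "ext_d (M\<restriction>U) \<alpha> \<doteq>\<^bsub>M\<restriction>U\<^esub> \<gamma>" if "one_form M \<alpha>" "ext_d M \<alpha> \<doteq>\<^bsub>M\<^esub> \<gamma>" for \<alpha> \<gamma>
  proof (rule form_eqI)
    fix c x v assume "c \<in> charts (M\<restriction>U)" and x: "x \<in> chart_dom (M\<restriction>U) c"
    then have c: "c \<in> charts M" "x \<in> chart_dom M c" by auto
    show "ext_d (M\<restriction>U) \<alpha> c x v = \<gamma> c x v"
      using ext_d_submfd[OF M U that(1) c(1) x] form_eqD[OF that(2) c] by simp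
  qed
  have "structure_functions (M\<restriction>U) lam \<mu> a b p q s"
    using * E[OF lam] E[OF \<mu>] unfolding structure_functions_def by blast
  then show ?thesis using * unfolding no_twist_shear_def by auto
qed

lemma oriented_congruence_submfd:
  fixes lam \<mu> :: "('a, 'e, 'e) form"
  assumes "one_form M lam" "real_form M lam" "one_form M \<mu>" "coframe M lam \<mu>"
  shows "one_form (M\<restriction>U) lam" "real_form (M\<restriction>U) lam" "one_form (M\<restriction>U) \<mu>" "coframe (M\<restriction>U) lam \<mu>"
  using one_form_submfd[OF M U assms(1)] one_form_submfd[OF M U assms(3)] real_form_submfd[OF M U
      assms(2)] assms(4)
  by (auto simp: coframe_def)

lemma struct_eqs_submfd:
  assumes s: "struct_eqs M \<omega> \<theta> \<beta> T k"
  shows "struct_eqs (M\<restriction>U) \<omega> \<theta> \<beta> T k"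
  by (rule struct_eqs_cong[OF smooth_atlas_submfd[OF M U]
        struct_eqs_pullback[OF smooth_atlas_submfd[OF M U] M smooth_map_inclusion[OF M U] s]])
    (simp_all add: pullback_inclusion[OF M U] struct_eqsD[OF s])

lemma adapted_base_submfd:
  assumes lam: "one_form M lam" and \<mu>: "one_form M \<mu>" and b: "adapted_base M lam \<mu> \<omega> \<theta> r"
  shows "adapted_base (M\<restriction>U) lam \<mu> \<omega> \<theta> r"
proof -
  obtain s \<sigma> \<phi> where "no_twist_shear M lam \<mu> s" "\<sigma> \<in> {1, -1::real}" "smooth_fun M \<phi>"
    "\<omega> \<doteq>\<^bsub>M\<^esub> (\<lambda>x. complex_of_real (\<sigma> * cmod (s x))) \<odot> lam"
    "\<theta> \<doteq>\<^bsub>M\<^esub> (\<lambda>x. complex_of_real (r x) * cis (\<phi> x)) \<odot> \<mu>"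
    using b unfolding adapted_base_def by (elim conjE exE) (rule that)
  then show ?thesis
    unfolding adapted_base_def
    using no_twist_shear_submfd[OF lam \<mu>] smooth_fun_submfd[OF M U] form_eq_submfd[OF M U] by meson
qed

end

lemma smooth_fun_sqrt:
  assumes M: "smooth_atlas M" and f: "smooth_fun M f" "\<And>x. x \<in> points M \<Longrightarrow> f x > 0"
  shows "smooth_fun M (\<lambda>x. sqrt (f x))"
  unfolding smooth_fun_def o_def
  by (intro ballI smooth_on_sqrt img_open[OF M])
    (use f in \<open>simp_all add: smooth_fun_def o_def param_in_points\<close>)

lemma smooth_fun_vimage_open:
  assumes M: "smooth_atlas M" and f: "smooth_fun M f" and V: "open V"
  shows "openin (mtop M) {x \<in> points M. f x \<in> V}"
  using smooth_fun_continuous[OF M f] V unfolding continuous_map_def points_def by simp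

text \<open>The equation \<open>K0 (x, \<rho>) = \<epsilon>\<close> is never solved in the given
  lift. The lift is read off at radius 1 and rescaled on the base, and
  \<open>invariant_coframeI\<close> then builds a lift adapted to the rescaled forms.\<close>

lemma special_congruence_local:
  assumes M: "smooth_atlas M" and sp: "special_congruence M lam \<mu>" and x: "x \<in> points M"
  shows "\<exists>U \<epsilon> \<omega> \<theta> \<Omega> T. openin (mtop M) U \<and> x \<in> U \<and> invariant_coframe (M\<restriction>U) lam \<mu> \<epsilon> \<omega> \<theta> \<Omega> T"
proof -
  have oc: "oriented_congruence M lam \<mu>" using sp unfolding special_congruence_def by blast
  note O = oriented_congruenceD[OF oc]
  obtain U \<omega>P \<omega>1P \<Omega>P T0P K0 T1 K1 where U: "openin (mtop M) U" "x \<in> U"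
    and L: "adapted_lift (M\<restriction>U) lam \<mu> \<omega>P \<omega>1P \<Omega>P T0P K0 T1 K1" "lift_conditions (M\<restriction>U) K0 T1 K1"
    using sp x unfolding special_congruence_def by (elim conjE) (drule bspec, assumption, elim exE
        conjE, rule that)
  let ?M = "M\<restriction>U"
  note MU = smooth_atlas_submfd[OF M U(1)] and OU = oriented_congruence_submfd[OF M U(1) O]
  let ?S = "pullback ?M (ray_bundle ?M) (\<lambda>x. (x, 1))"
  define k where "k = (\<lambda>x. K0 (x, 1))"
  have one: "smooth_fun ?M (\<lambda>_. 1::real)" by (rule smooth_fun_const)
  have se: "struct_eqs ?M (?S \<omega>P) (?S \<omega>1P) (?S \<Omega>P) (\<lambda>x. T0P (x, 1)) k"
    unfolding k_def by (rule adapted_lift_section(1)[OF MU OU(1-3) L one]) simp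
  have ab: "adapted_base ?M lam \<mu> (?S \<omega>P) (?S \<omega>1P) (\<lambda>_. 1)"
    by (rule adapted_lift_section(2)[OF MU OU(1-3) L one]) simp
  have k0: "k y \<noteq> 0" if "y \<in> points ?M" for y
    using L(2) that unfolding lift_conditions_def k_def by simp
  have xU: "x \<in> points ?M" using x U by simp
  define \<epsilon> where "\<epsilon> = sgn (k x)"
  have \<epsilon>: "\<epsilon> \<in> {1, -1}" using k0[OF xU] by (auto simp: \<epsilon>_def sgn_if)
  \<comment> \<open>On \<open>V\<close> the sign of \<open>k\<close> is frozen, so that
    \<open>\<epsilon>\<close> is a constant and \<open>\<epsilon> * k y\<close> is the modulus whose
    square root rescales the coframe.\<close>
  define V where "V = {y \<in> points ?M. \<epsilon> * k y \<in> {0<..}}"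
  have sk: "smooth_fun ?M (\<lambda>y. \<epsilon> * k y)"
    by (rule smooth_fun_mult[OF MU smooth_fun_const struct_eqsD(7)[OF se]])
  have V: "openin (mtop ?M) V" unfolding V_def by (rule smooth_fun_vimage_open[OF MU sk]) simp
  have xV: "x \<in> V" using xU k0[OF xU] by (auto simp: V_def \<epsilon>_def sgn_if zero_less_mult_iff)
  note MV = smooth_atlas_submfd[OF MU V] and OV = oriented_congruence_submfd[OF MU V OU]
  define g where "g = (\<lambda>y. sqrt (\<epsilon> * k y))"
  have pos: "\<epsilon> * k y > 0" if "y \<in> points (?M\<restriction>V)" for y using that by (auto simp: V_def)
  have g: "smooth_fun (?M\<restriction>V) g"
    unfolding g_def by (rule smooth_fun_sqrt[OF MV smooth_fun_submfd[OF MU V sk] pos])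
  have g0: "g y > 0" if "y \<in> points (?M\<restriction>V)" for y using pos[OF that] by (simp add: g_def)
  have g0': "g y \<noteq> 0" if "y \<in> points (?M\<restriction>V)" for y using g0[OF that] by simp
  let ?\<theta> = "(\<lambda>y. complex_of_real (g y)) \<odot> ?S \<omega>1P"
  let ?\<beta> = "?S \<Omega>P + (\<lambda>y. inverse (complex_of_real (g y))) \<odot> dfun (?M\<restriction>V) (\<lambda>y. complex_of_real (g y))"
  have "struct_eqs (?M\<restriction>V) (?S \<omega>P) ?\<theta> ?\<beta> (\<lambda>x. T0P (x, 1)) (\<lambda>y. k y / (g y)\<^sup>2)"
    by (rule struct_eqs_scale[OF MV struct_eqs_submfd[OF MU V se] g g0'])
  then have s1: "struct_eqs (?M\<restriction>V) (?S \<omega>P) ?\<theta> ?\<beta> (\<lambda>x. T0P (x, 1)) (\<lambda>_. \<epsilon>)"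
  proof (rule struct_eqs_cong[OF MV])
    fix y assume y: "y \<in> points (?M\<restriction>V)"
    then have "k y \<noteq> 0" using pos by fastforce
    then show "k y / (g y)\<^sup>2 = \<epsilon>" using pos[OF y] \<epsilon> by (auto simp: g_def)
  qed (rule form_eq_refl refl)+
  have "adapted_base (?M\<restriction>V) lam \<mu> (?S \<omega>P) (?S \<omega>1P) (\<lambda>_. 1)"
    by (rule adapted_base_submfd[OF MU V OU(1,3) ab])
  then obtain s \<sigma> \<phi> where b: "no_twist_shear (?M\<restriction>V) lam \<mu> s" "\<sigma> \<in> {1, -1::real}" "smooth_fun (?M\<restriction>V)
      \<phi>"
    "?S \<omega>P \<doteq>\<^bsub>?M\<restriction>V\<^esub> (\<lambda>x. complex_of_real (\<sigma> * cmod (s x))) \<odot> lam"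
    "?S \<omega>1P \<doteq>\<^bsub>?M\<restriction>V\<^esub> (\<lambda>x. complex_of_real 1 * cis (\<phi> x)) \<odot> \<mu>"
    unfolding adapted_base_def by (elim conjE exE) (rule that)
  have "?\<theta> \<doteq>\<^bsub>?M\<restriction>V\<^esub> (\<lambda>y. complex_of_real (g y) * cis (\<phi> y)) \<odot> \<mu>"
    using b(5) by (simp add: form_eq_def smul_def)
  then have b1: "adapted_base (?M\<restriction>V) lam \<mu> (?S \<omega>P) ?\<theta> g"
    unfolding adapted_base_def using b(1-4) by blast
  have "invariant_coframe (?M\<restriction>V) lam \<mu> \<epsilon> (?S \<omega>P) ?\<theta> ?\<beta> (\<lambda>x. T0P (x, 1))"
    by (rule invariant_coframeI[OF MV OV(1-3) s1 b1 g g0 \<epsilon>])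
  moreover have "?M\<restriction>V = M\<restriction>V"
    using xV V by (simp add: submfd_submfd) (metis inf.absorb_iff2 inf_commute openin_imp_subset
        mtop_submfd)
  moreover have "openin (mtop M) V" using V U by (simp add: openin_open_subtopology)
  ultimately show ?thesis using xV by metis
qed

text \<open>An invariant coframe contains a lift together with the conditions on it; only the global
  shear has to be supplied separately.\<close>

lemma special_congruenceI:
  assumes "oriented_congruence M lam \<mu>" "no_twist_shear M lam \<mu> s"
    and "\<And>x. x \<in> points M \<Longrightarrow> \<exists>U \<epsilon> \<omega> \<theta> \<Omega> T. openin (mtop M) U \<and> x \<in> U \<and>
      invariant_coframe (M\<restriction>U) lam \<mu> \<epsilon> \<omega> \<theta> \<Omega> T"
  shows "special_congruence M lam \<mu>"
  unfolding special_congruence_def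
proof (intro conjI ballI)
  fix x assume "x \<in> points M"
  from assms(3)[OF this] show "\<exists>U \<omega> \<omega>1 \<Omega> T0 K0 T1 K1. openin (mtop M) U \<and> x \<in> U \<and>
        adapted_lift (M\<restriction>U) lam \<mu> \<omega> \<omega>1 \<Omega> T0 K0 T1 K1 \<and> lift_conditions (M\<restriction>U) K0 T1 K1"
    unfolding invariant_coframe_def Let_def by blast
qed (use assms in auto)

section \<open>Coframes in dimension three\<close>

lemma form_plus: "(\<alpha> + \<beta>) c x v = \<alpha> c x v + \<beta> c x v" for \<alpha> \<beta> :: "('a, 'e, 'v) form"
  by (simp add: plus_fun_def)

lemma form_minus: "(\<alpha> - \<beta>) c x v = \<alpha> c x v - \<beta> c x v" for \<alpha> \<beta> :: "('a, 'e, 'v) form"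
  by (simp add: fun_diff_def)

lemma form_zero: "(0 :: ('a, 'e, 'v) form) c x v = 0"
  by (simp add: zero_fun_def)

lemma form_smul: "(f \<odot> \<alpha>) c x v = f x * \<alpha> c x v"
  by (simp add: smul_def)

lemma form_cconj: "cconj \<alpha> c x v = cnj (\<alpha> c x v)"
  by (simp add: cconj_def)

lemma form_wedge: "(\<alpha> \<^bold>\<and> \<beta>) c x (u, v) = \<alpha> c x u * \<beta> c x v - \<alpha> c x v * \<beta> c x u"
  by (simp add: wedge_def)

lemma form_wedge12: "(\<alpha> \<^bold>\<and>\<^bold>\<and> \<theta>) c x (u, v, w) =
    \<alpha> c x u * \<theta> c x (v, w) - \<alpha> c x v * \<theta> c x (u, w) + \<alpha> c x w * \<theta> c x (u, v)"
  by (simp add: wedge12_def)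

lemmas form_apply = form_plus form_minus form_zero form_smul form_cconj form_wedge form_wedge12

text \<open>Cramer's rule: each coefficient of the relation times the determinant is a combination
  of the three equations, and some coefficient is nonzero.\<close>

lemma det3_zero:
  fixes a b c :: complex
  assumes "a * x1 + b * y1 + c * z1 = 0" "a * x2 + b * y2 + c * z2 = 0" "a * x3 + b * y3 + c * z3 =
      0"
    and "a \<noteq> 0 \<or> b \<noteq> 0 \<or> c \<noteq> 0"
  shows "x1 * (y2 * z3 - y3 * z2) - x2 * (y1 * z3 - y3 * z1) + x3 * (y1 * z2 - y2 * z1) = 0" (is "?D
      = 0")
proof -
  have "a * ?D = 0" using assms(1-3) by algebra
  moreover have "b * ?D = 0" using assms(1-3) by algebra
  moreover have "c * ?D = 0" using assms(1-3) by algebra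
  ultimately show ?thesis using assms(4) by auto
qed

text \<open>A real basis dual to \<open>w\<close>, \<open>Re t\<close>, \<open>Im t\<close>; no real vectors are dual to \<open>t\<close> and its conjugate.\<close>

definition dual_frame :: "('e::real_vector \<Rightarrow> complex) \<Rightarrow> ('e \<Rightarrow> complex) \<Rightarrow> 'e \<Rightarrow> 'e \<Rightarrow> 'e \<Rightarrow> bool" where
  "dual_frame w t e0 e1 e2 \<longleftrightarrow> w e0 = 1 \<and> w e1 = 0 \<and> w e2 = 0 \<and> t e0 = 0 \<and> t e1 = 1 \<and> t e2 = \<i> \<and>
     (\<forall>z. z = Re (w z) *\<^sub>R e0 + Re (t z) *\<^sub>R e1 + Im (t z) *\<^sub>R e2)"

text \<open>The frame is the preimage of (1, 0), (0, 1), (0, \<i>) under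
  \<open>v \<mapsto> (Re (w v), t v)\<close>. If this map missed a value, its range would lie in a
  hyperplane, and the resulting linear relation would annihilate the determinant.\<close>

lemma dual_frame_exists:
  fixes w t :: "real^3 \<Rightarrow> complex"
  assumes w: "linear w" "\<And>v. w v \<in> \<real>" and t: "linear t"
    and D: "w u * (t v * cnj (t z) - t z * cnj (t v)) - w v * (t u * cnj (t z) - t z * cnj (t u))
      + w z * (t u * cnj (t v) - t v * cnj (t u)) \<noteq> 0"
  obtains e0 e1 e2 where "dual_frame w t e0 e1 e2"
proof -
  define L where "L = (\<lambda>v. (Re (w v), t v))"
  have L: "linear L"
    using w(1) t by (auto simp: L_def linear_iff)
  have wr: "w v = complex_of_real (Re (w v))" for v using w(2)[of v] by (simp add:
      complex_is_Real_iff complex_eq_iff)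
  have surj: "surj L"
  proof (rule ccontr)
    assume "\<not> surj L"
    moreover have "span (range L) = range L"
      by (rule span_eq_iff[THEN iffD2, OF linear_subspace_image[OF L subspace_UNIV]])
    ultimately have "span (range L) \<noteq> UNIV" by metis
    then obtain a where a: "a \<noteq> 0" "span (range L) \<subseteq> {x. a \<bullet> x = 0}"
      using span_not_univ_subset_hyperplane by blast
    obtain p q where pq: "a = (p, q)" by (rule prod.exhaust)
    \<comment> \<open>Twice the hyperplane equation p Re w + Re (cnj q t) = 0, written through
      \<open>t\<close> and its conjugate so that \<open>det3_zero\<close> applies.\<close>
    have 0: "2 * complex_of_real p * w v + cnj q * t v + q * cnj (t v) = 0" for v
    proof -
      have "a \<bullet> L v = 0" using a(2) span_base[of "L v" "range L"] by blast
      then have "p * Re (w v) + (Re q * Re (t v) + Im q * Im (t v)) = 0"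
        by (simp add: pq L_def inner_complex_def)
      then have "2 * complex_of_real p * complex_of_real (Re (w v)) + cnj q * t v + q * cnj (t v) =
          0"
        by (simp add: complex_eq_iff algebra_simps)
      then show ?thesis using wr by simp
    qed
    have "2 * complex_of_real p \<noteq> 0 \<or> cnj q \<noteq> 0 \<or> q \<noteq> 0" using a(1) pq by (auto simp: zero_prod_def)
    from det3_zero[OF 0 0 0 this] D show False by auto
  qed
  \<comment> \<open>Source and target both have real dimension three.\<close>
  then have inj: "inj L"
    by (intro eucl.linear_surjective_imp_injective L) (simp_all add: dim_UNIV)
  obtain e0 e1 e2 where e: "L e0 = (1, 0)" "L e1 = (0, 1)" "L e2 = (0, \<i>)"
    using surj by (metis surj_def)
  have "z = Re (w z) *\<^sub>R e0 + Re (t z) *\<^sub>R e1 + Im (t z) *\<^sub>R e2" for z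
  proof (rule injD[OF inj])
    have "L (Re (w z) *\<^sub>R e0 + Re (t z) *\<^sub>R e1 + Im (t z) *\<^sub>R e2)
      = Re (w z) *\<^sub>R L e0 + Re (t z) *\<^sub>R L e1 + Im (t z) *\<^sub>R L e2"
      using L by (simp add: linear_add linear_cmul)
    also have "\<dots> = L z" unfolding e by (simp add: L_def complex_eq_iff)
    finally show "L z = L (Re (w z) *\<^sub>R e0 + Re (t z) *\<^sub>R e1 + Im (t z) *\<^sub>R e2)" by simp
  qed
  moreover have "w e0 = 1" "w e1 = 0" "w e2 = 0" "t e0 = 0" "t e1 = 1" "t e2 = \<i>"
    using e wr[of e0] wr[of e1] wr[of e2] by (auto simp: L_def)
  ultimately show thesis using that unfolding dual_frame_def by blast
qed

lemma dual_frame_expand: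
  assumes "dual_frame w t e0 e1 e2" "linear \<eta>"
  shows "\<eta> z = complex_of_real (Re (w z)) * \<eta> e0 + complex_of_real (Re (t z)) * \<eta> e1 +
      complex_of_real (Im (t z)) * \<eta> e2"
proof -
  have "\<eta> z = \<eta> (Re (w z) *\<^sub>R e0 + Re (t z) *\<^sub>R e1 + Im (t z) *\<^sub>R e2)"
    using assms(1) unfolding dual_frame_def by metis
  then show ?thesis using assms(2) by (simp add: linear_add linear_cmul scaleR_conv_of_real)
qed

text \<open>The expansion over Re t and Im t rewritten over \<open>t\<close> and its conjugate, as
  for Wirtinger derivatives: this accounts for the halves and for the factors \<i>.\<close>

lemma dual_frame_coeffs:
  assumes d: "dual_frame w t e0 e1 e2" and l: "linear \<eta>" and w: "w z \<in> \<real>"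
  shows "\<eta> z = \<eta> e0 * w z + (\<eta> e1 - \<i> * \<eta> e2) / 2 * t z + (\<eta> e1 + \<i> * \<eta> e2) / 2 * cnj (t z)"
proof -
  have wz: "complex_of_real (Re (w z)) = w z" using w by (simp add: complex_is_Real_iff
      complex_eq_iff)
  define r j where r: "r = complex_of_real (Re (t z))" and j: "j = complex_of_real (Im (t z))"
  have tz: "t z = r + \<i> * j" and cr: "cnj r = r" "cnj j = j"
    by (simp_all add: r j complex_eq_iff)
  show ?thesis
    unfolding dual_frame_expand[OF d l, of z] wz r[symmetric] j[symmetric]
    unfolding tz
    by (simp add: cr field_simps)
qed

text \<open>For coefficient functions obtained by pointwise choice: near a point where
  \<open>d\<close> does not vanish, the function coincides with the smooth quotient
  \<open>n / d\<close>.\<close>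

lemma smooth_fun_ratio:
  fixes f :: "'a \<Rightarrow> complex" and M :: "('a, 'e::euclidean_space) mfd"
  assumes M: "smooth_atlas M"
    and ex: "\<And>c x. c \<in> charts M \<Longrightarrow> x \<in> chart_dom M c \<Longrightarrow> \<exists>n d. smooth_on (chart_img M c) n \<and>
      smooth_on (chart_img M c) d \<and> d (snd c x) \<noteq> 0 \<and> (\<forall>y\<in>chart_img M c. f (param M c y) * d y = n
          y)"
  shows "smooth_fun M f"
  unfolding smooth_fun_def
proof (intro ballI smooth_on_local)
  fix c y assume c: "c \<in> charts M" and y: "y \<in> chart_img M c"
  let ?I = "chart_img M c"
  obtain n d where nd: "smooth_on ?I n" "smooth_on ?I d" "d y \<noteq> 0" "\<forall>y\<in>?I. f (param M c y) * d y = n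
      y"
    using ex[OF c param_in_dom[OF y]] chart_param[OF y] by auto
  let ?T = "?I \<inter> d -` (- {0})"
  have T: "open ?T" "?T \<subseteq> ?I"
    by (auto intro!: continuous_open_preimage smooth_on_continuous[OF nd(2)] img_open[OF M c])
  have "smooth_on ?T (\<lambda>y. n y / d y)"
    by (rule smooth_on_divide[OF T(1) smooth_on_subset[OF nd(1) T(2)] smooth_on_subset[OF nd(2)
        T(2)]]) auto
  then have "smooth_on ?T (f \<circ> param M c)"
    by (rule smooth_on_cong[OF T(1), rotated]) (use nd(4) in \<open>auto simp: field_simps\<close>)
  then show "\<exists>T. open T \<and> y \<in> T \<and> smooth_on T (f \<circ> param M c)"
    using T y nd(3) by (intro exI[of _ ?T]) simp
qed

lemma smooth_wedge3:
  assumes M: "smooth_atlas M" and f: "one_form M \<alpha>" "one_form M \<beta>" "one_form M \<gamma>" and c: "c \<in> charts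
      M"
  shows "smooth_on (chart_img M c) (\<lambda>y. (\<alpha> \<^bold>\<and>\<^bold>\<and> \<beta> \<^bold>\<and> \<gamma>) c (param M c y) (u, v, z))"
  unfolding wedge12_def wedge_def case_prod_conv
  by (intro smooth_on_add smooth_on_diff smooth_on_mult img_open[OF M c] one_form_smooth[OF M _ c]
      f)

lemma coframe_dual_frame:
  fixes M :: "('a, real^3) mfd"
  assumes M: "smooth_atlas M" and \<omega>: "one_form M \<omega>" "real_form M \<omega>" and \<theta>: "one_form M \<theta>"
    and cf: "coframe M \<omega> \<theta>" and c: "c \<in> charts M" "x \<in> chart_dom M c"
  obtains e0 e1 e2 where "dual_frame (\<omega> c x) (\<theta> c x) e0 e1 e2"
proof -
  obtain u v z where D: "(\<omega> \<^bold>\<and>\<^bold>\<and> \<theta> \<^bold>\<and> cconj \<theta>) c x (u, v, z) \<noteq> 0"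
    using cf c unfolding coframe_def by blast
  show thesis
    by (rule dual_frame_exists[OF one_form_linear[OF M \<omega>(1) c] _ one_form_linear[OF M \<theta> c]])
      (use D \<omega>(2) c that in \<open>auto simp: form_simps real_form_def\<close>)
qed

text \<open>Existence is pointwise, by a dual frame. Smoothness follows afterwards from Cramer's
  rule, as the values of the coefficients are determined by the forms.\<close>

lemma coframe_coeffs:
  fixes M :: "('a, real^3) mfd"
  assumes M: "smooth_atlas M" and \<omega>: "one_form M \<omega>" "real_form M \<omega>" and \<theta>: "one_form M \<theta>"
    and cf: "coframe M \<omega> \<theta>" and \<eta>: "one_form M \<eta>"
  obtains a0 a1 a2 where "smooth_fun M a0" "smooth_fun M a1" "smooth_fun M a2"
    "\<eta> \<doteq>\<^bsub>M\<^esub> a0 \<odot> \<omega> + a1 \<odot> \<theta> + a2 \<odot> cconj \<theta>"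
proof -
  \<comment> \<open>The coefficients are functions on \<open>M\<close>, so one triple must work in
    all charts around \<open>x\<close>; the common transition law of the three forms provides
    this.\<close>
  have "\<exists>a0 a1 a2. \<forall>c\<in>charts M. x \<in> chart_dom M c \<longrightarrow>
      (\<forall>v. \<eta> c x v = a0 * \<omega> c x v + a1 * \<theta> c x v + a2 * cnj (\<theta> c x v))" if x: "x \<in> points M" for x
  proof -
    obtain d where d: "d \<in> charts M" "x \<in> chart_dom M d" using atlas_cover[OF M x] by blast
    obtain e0 e1 e2 where e: "dual_frame (\<omega> d x) (\<theta> d x) e0 e1 e2"
      using coframe_dual_frame[OF M \<omega> \<theta> cf d] .
    have 1: "\<omega> d x v \<in> \<real>" for v using \<omega>(2) d by (simp add: real_form_def)
    have "\<eta> c x v = \<eta> d x e0 * \<omega> c x v + (\<eta> d x e1 - \<i> * \<eta> d x e2) / 2 * \<theta> c x v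
        + (\<eta> d x e1 + \<i> * \<eta> d x e2) / 2 * cnj (\<theta> c x v)" if c: "c \<in> charts M" "x \<in> chart_dom M c"
            for c v
      unfolding one_form_transition[OF M \<eta> c(1) d(1) c(2) d(2), of v] one_form_transition[OF M \<omega>(1)
          c(1) d(1) c(2) d(2), of v]
        one_form_transition[OF M \<theta> c(1) d(1) c(2) d(2), of v]
      by (rule dual_frame_coeffs[OF e one_form_linear[OF M \<eta> d] 1])
    then show ?thesis by blast
  qed
  then obtain a0 a1 a2 where a: "\<And>x c v. x \<in> points M \<Longrightarrow> c \<in> charts M \<Longrightarrow> x \<in> chart_dom M c \<Longrightarrow>
      \<eta> c x v = a0 x * \<omega> c x v + a1 x * \<theta> c x v + a2 x * cnj (\<theta> c x v)"
    by metis
  have a': "\<eta> c x v = a0 x * \<omega> c x v + a1 x * \<theta> c x v + a2 x * cnj (\<theta> c x v)"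
    if "c \<in> charts M" "x \<in> chart_dom M c" for c x v
    by (rule a[OF subsetD[OF dom_subset_points that(2)] that])
  note c\<theta> = one_form_cconj[OF M \<theta>]
  \<comment> \<open>Cramer's rule: a coefficient times the volume form equals the 3-form in which
    \<open>\<eta>\<close> replaces the corresponding member of the coframe.\<close>
  have ratio: "smooth_fun M f" if N: "\<And>c x u v z. c \<in> charts M \<Longrightarrow> x \<in> chart_dom M c \<Longrightarrow>
      f x * (\<omega> \<^bold>\<and>\<^bold>\<and> \<theta> \<^bold>\<and> cconj \<theta>) c x (u, v, z) = (\<alpha> \<^bold>\<and>\<^bold>\<and> \<beta> \<^bold>\<and> \<gamma>) c x (u, v, z)"
      and o: "one_form M \<alpha>" "one_form M \<beta>" "one_form M \<gamma>" for f \<alpha> \<beta> \<gamma>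
  proof (rule smooth_fun_ratio[OF M])
    fix c x assume c: "c \<in> charts M" "x \<in> chart_dom M c"
    obtain u v z where D: "(\<omega> \<^bold>\<and>\<^bold>\<and> \<theta> \<^bold>\<and> cconj \<theta>) c x (u, v, z) \<noteq> 0"
      using cf c unfolding coframe_def by blast
    show "\<exists>n d. smooth_on (chart_img M c) n \<and> smooth_on (chart_img M c) d \<and> d (snd c x) \<noteq> 0 \<and>
        (\<forall>y\<in>chart_img M c. f (param M c y) * d y = n y)"
    proof (intro exI conjI)
      show "smooth_on (chart_img M c) (\<lambda>y. (\<alpha> \<^bold>\<and>\<^bold>\<and> \<beta> \<^bold>\<and> \<gamma>) c (param M c y) (u, v, z))"
        by (rule smooth_wedge3[OF M o c(1)])
      show "smooth_on (chart_img M c) (\<lambda>y. (\<omega> \<^bold>\<and>\<^bold>\<and> \<theta> \<^bold>\<and> cconj \<theta>) c (param M c y) (u, v, z))"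
        by (rule smooth_wedge3[OF M \<omega>(1) \<theta> c\<theta> c(1)])
      show "(\<omega> \<^bold>\<and>\<^bold>\<and> \<theta> \<^bold>\<and> cconj \<theta>) c (param M c (snd c x)) (u, v, z) \<noteq> 0"
        unfolding param_chart[OF M c] by (rule D)
    qed (intro ballI N c(1) param_in_dom)
  qed
  have "smooth_fun M a0"
    by (rule ratio[OF _ \<eta> \<theta> c\<theta>]) (simp add: form_simps a' algebra_simps)
  moreover have "smooth_fun M a1"
    by (rule ratio[OF _ \<omega>(1) \<eta> c\<theta>]) (simp add: form_simps a' algebra_simps)
  moreover have "smooth_fun M a2"
    by (rule ratio[OF _ \<omega>(1) \<theta> \<eta>]) (simp add: form_simps a' algebra_simps)
  moreover have "\<eta> \<doteq>\<^bsub>M\<^esub> a0 \<odot> \<omega> + a1 \<odot> \<theta> + a2 \<odot> cconj \<theta>"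
    by (rule form_eqI) (simp add: form_simps a')
  ultimately show thesis by (rule that)
qed

text \<open>The value on \<open>e0\<close> shows that the first coefficient is real; the values on
  \<open>e1\<close> and \<open>e2\<close> show that the other two are conjugate to each
  other.\<close>

lemma coframe_coeffs_real:
  fixes M :: "('a, real^3) mfd"
  assumes M: "smooth_atlas M" and \<omega>: "one_form M \<omega>" "real_form M \<omega>" and \<theta>: "one_form M \<theta>"
    and cf: "coframe M \<omega> \<theta>" and \<eta>: "one_form M \<eta>" "real_form M \<eta>"
  obtains a0 a1 where "smooth_fun M a0" "smooth_fun M a1"
    "\<eta> \<doteq>\<^bsub>M\<^esub> (\<lambda>x. complex_of_real (a0 x)) \<odot> \<omega> + a1 \<odot> \<theta> + (\<lambda>x. cnj (a1 x)) \<odot> cconj \<theta>"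
proof -
  obtain b0 b1 b2 where b: "smooth_fun M b0" "smooth_fun M b1" "smooth_fun M b2"
    "\<eta> \<doteq>\<^bsub>M\<^esub> b0 \<odot> \<omega> + b1 \<odot> \<theta> + b2 \<odot> cconj \<theta>"
    using coframe_coeffs[OF M \<omega> \<theta> cf \<eta>(1)] .
  show thesis
  proof (rule that[OF smooth_fun_Re[OF M b(1)] b(2) form_eqI])
    fix c x v assume c: "c \<in> charts M" "x \<in> chart_dom M c"
    obtain e0 e1 e2 where e: "dual_frame (\<omega> c x) (\<theta> c x) e0 e1 e2" using coframe_dual_frame[OF M \<omega> \<theta>
        cf c] .
    have eq: "\<eta> c x v = b0 x * \<omega> c x v + b1 x * \<theta> c x v + b2 x * cnj (\<theta> c x v)" for v
      using form_eqD[OF b(4) c] by (simp add: form_simps)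
    have im: "Im (\<eta> c x v) = 0" for v using \<eta>(2) c by (simp add: real_form_def complex_is_Real_iff)
    have "Im (b0 x) = 0" using im[of e0] eq[of e0] e by (simp add: dual_frame_def)
    then have 1: "b0 x = complex_of_real (Re (b0 x))" by (simp add: complex_eq_iff)
    have "Im (b1 x + b2 x) = 0" using im[of e1] eq[of e1] e by (simp add: dual_frame_def)
    moreover have "Re (b1 x) - Re (b2 x) = 0" using im[of e2] eq[of e2] e by (simp add:
        dual_frame_def)
    ultimately have 2: "b2 x = cnj (b1 x)" by (simp add: complex_eq_iff)
    show "\<eta> c x v = ((\<lambda>x. complex_of_real (Re (b0 x))) \<odot> \<omega> + b1 \<odot> \<theta> + (\<lambda>x. cnj (b1 x)) \<odot> cconj \<theta>) c
        x v"
      using eq[of v] 1 2 by (simp add: form_simps)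
  qed
qed

section \<open>Consequences of the structure equations in dimension three\<close>

context
  fixes M :: "('a, real^3) mfd" and \<omega> \<theta> :: "('a, real^3, real^3) form"
  assumes M: "smooth_atlas M" and cf: "coframe M \<omega> \<theta>"
begin

text \<open>Evaluates \<open>d(d\<Omega>) = 0\<close> on the dual frame.\<close>

lemma struct_eqs_Omega_coeff:
  assumes s: "struct_eqs M \<omega> \<theta> \<Omega> T (\<lambda>_. \<epsilon>)" and \<epsilon>: "\<epsilon> \<in> {1, -1::real}"
    and c: "c \<in> charts M" "x \<in> chart_dom M c" and d: "dual_frame (\<omega> c x) (\<theta> c x) e0 e1 e2"
  shows "\<Omega> c x e0 = 1"
proof -
  note D = struct_eqsD[OF s]
  note c\<theta> = one_form_cconj[OF M D(3)]
  let ?F = "\<lambda>_::'a. \<i> * complex_of_real \<epsilon>"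
  have F: "smooth_fun M ?F" by (rule smooth_fun_const)
  have "ext_d2 M (?F \<odot> (\<theta> \<^bold>\<and> cconj \<theta>)) c x (e1, e2, e0) = 0"
    using form_eqD[OF ext_d2_cong[OF M D(10)] c, of "(e1, e2, e0)"] form_eqD[OF ext_d2_ext_d[OF M
        D(4)] c, of "(e1, e2, e0)"]
    by (simp add: zero_fun_def)
  then have 0: "(dfun M ?F \<^bold>\<and>\<^bold>\<and> (\<theta> \<^bold>\<and> cconj \<theta>)
      + ?F \<odot> (cconj \<theta> \<^bold>\<and>\<^bold>\<and> ext_d M \<theta> - \<theta> \<^bold>\<and>\<^bold>\<and> ext_d M (cconj \<theta>))) c x (e1, e2, e0) = 0"
    using form_eqD[OF ext_d2_smul_wedge[OF M F D(3) c\<theta>] c, of "(e1, e2, e0)"] by simp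
  have e: "ext_d M (cconj \<theta>) c x v = cnj (ext_d M \<theta> c x v)" for v
    using form_eqD[OF ext_d_cconj[OF M D(3)] c] by (simp add: cconj_def)
  have r: "cnj (\<Omega> c x v) = \<Omega> c x v" for v
    using D(5) c by (simp add: real_form_def complex_is_Real_iff complex_eq_iff)
  note f = d[unfolded dual_frame_def]
  \<comment> \<open>The T terms of d\<theta> and of its conjugate cancel; what is left is a nonzero
    multiple of \<open>\<epsilon>\<close> times \<open>\<Omega> c x e0 - 1\<close>.\<close>
  have "\<epsilon> \<noteq> 0" using \<epsilon> by auto
  with 0[unfolded wedge12_def smul_def plus_fun_def fun_diff_def case_prod_conv e] show ?thesis
    by (simp add: form_simps form_eqD[OF D(9) c] dfun_const[OF M] f r algebra_simps)
qed

lemma Omega_form_apply: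
  "Omega_form \<omega> \<theta> A B c x v = Complex (A x) (B x) * \<theta> c x v + cnj (Complex (A x) (B x) * \<theta> c x v) +
      \<omega> c x v"
  by (simp add: Omega_form_def form_simps Complex_eq)

lemma struct_eqs_Omega:
  assumes s: "struct_eqs M \<omega> \<theta> \<Omega> T (\<lambda>_. \<epsilon>)" and \<epsilon>: "\<epsilon> \<in> {1, -1::real}"
  obtains A B where "smooth_fun M A" "smooth_fun M B" "\<Omega> \<doteq>\<^bsub>M\<^esub> Omega_form \<omega> \<theta> A B"
proof -
  note D = struct_eqsD[OF s]
  obtain a0 a where a: "smooth_fun M a0" "smooth_fun M a"
    "\<Omega> \<doteq>\<^bsub>M\<^esub> (\<lambda>x. complex_of_real (a0 x)) \<odot> \<omega> + a \<odot> \<theta> + (\<lambda>x. cnj (a x)) \<odot> cconj \<theta>"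
    using coframe_coeffs_real[OF M D(1,2,3) cf D(4,5)] .
  show thesis
  proof (rule that[OF smooth_fun_Re[OF M a(2)] smooth_fun_Im[OF M a(2)] form_eqI])
    fix c x v assume c: "c \<in> charts M" "x \<in> chart_dom M c"
    obtain e0 e1 e2 where e: "dual_frame (\<omega> c x) (\<theta> c x) e0 e1 e2"
      using coframe_dual_frame[OF M D(1,2,3) cf c] .
    have "complex_of_real (a0 x) = 1"
      using struct_eqs_Omega_coeff[OF s \<epsilon> c e] form_eqD[OF a(3) c, of e0] e by (simp add:
          dual_frame_def form_apply)
    then show "\<Omega> c x v = Omega_form \<omega> \<theta> (\<lambda>x. Re (a x)) (\<lambda>x. Im (a x)) c x v"
      unfolding Omega_form_apply form_eqD[OF a(3) c] by (simp add: form_apply)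
  qed
qed

text \<open>The \<omega> term of \<Omega> contributes \<omega> \<and> \<theta>, which cancels
  \<theta> \<and> \<omega> from the shear term. Its \<open>cconj \<theta>\<close> term, wedged with
  \<theta>, becomes the first summand after a change of order.\<close>

lemma structure_equation_AB:
  assumes s: "struct_eqs M \<omega> \<theta> \<Omega> T (\<lambda>_. \<epsilon>)" and O: "\<Omega> \<doteq>\<^bsub>M\<^esub> Omega_form \<omega> \<theta> A B"
  shows "ext_d M \<theta> \<doteq>\<^bsub>M\<^esub>
         (\<lambda>x. \<i> * complex_of_real (B x) - complex_of_real (A x)) \<odot> (\<theta> \<^bold>\<and> cconj \<theta>)
       + (\<lambda>x. \<i> * complex_of_real (T x)) \<odot> (\<theta> \<^bold>\<and> \<omega>) + cconj \<theta> \<^bold>\<and> \<omega>"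
proof (rule form_eqI)
  note D = struct_eqsD[OF s]
  fix c x and v :: "(real^3) \<times> (real^3)" assume c: "c \<in> charts M" "x \<in> chart_dom M c"
  obtain u w :: "real^3" where v: "v = (u, w)" by (rule prod.exhaust)
  show "ext_d M \<theta> c x v = ((\<lambda>x. \<i> * complex_of_real (B x) - complex_of_real (A x)) \<odot> (\<theta> \<^bold>\<and> cconj \<theta>)
       + (\<lambda>x. \<i> * complex_of_real (T x)) \<odot> (\<theta> \<^bold>\<and> \<omega>) + cconj \<theta> \<^bold>\<and> \<omega>) c x v"
    unfolding form_eqD[OF D(9) c] v
    by (simp add: form_simps form_eqD[OF O c] Omega_form_apply Complex_eq algebra_simps)
qed

lemma structure_equation_cconj:
  assumes \<theta>: "one_form M \<theta>" and r: "real_form M \<omega>" and e: "ext_d M \<theta> \<doteq>\<^bsub>M\<^esub>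
         (\<lambda>x. \<i> * complex_of_real (B x) - complex_of_real (A x)) \<odot> (\<theta> \<^bold>\<and> cconj \<theta>)
       + (\<lambda>x. \<i> * complex_of_real (T x)) \<odot> (\<theta> \<^bold>\<and> \<omega>) + cconj \<theta> \<^bold>\<and> \<omega>"
  shows "ext_d M (cconj \<theta>) \<doteq>\<^bsub>M\<^esub>
         (\<lambda>x. \<i> * complex_of_real (B x) + complex_of_real (A x)) \<odot> (\<theta> \<^bold>\<and> cconj \<theta>)
       + \<theta> \<^bold>\<and> \<omega> - (\<lambda>x. \<i> * complex_of_real (T x)) \<odot> (cconj \<theta> \<^bold>\<and> \<omega>)"
proof (rule form_eqI)
  fix c x and v :: "(real^3) \<times> (real^3)" assume c: "c \<in> charts M" "x \<in> chart_dom M c"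
  obtain u w :: "real^3" where v: "v = (u, w)" by (rule prod.exhaust)
  have r: "cnj (\<omega> c x v) = \<omega> c x v" for v
    using r c by (simp add: real_form_def complex_is_Real_iff complex_eq_iff)
  have "ext_d M (cconj \<theta>) c x v = cnj (ext_d M \<theta> c x v)"
    using form_eqD[OF ext_d_cconj[OF M \<theta>] c] by (simp add: cconj_def)
  then show "ext_d M (cconj \<theta>) c x v = ((\<lambda>x. \<i> * complex_of_real (B x) + complex_of_real (A x)) \<odot> (\<theta>
      \<^bold>\<and> cconj \<theta>)
       + \<theta> \<^bold>\<and> \<omega> - (\<lambda>x. \<i> * complex_of_real (T x)) \<odot> (cconj \<theta> \<^bold>\<and> \<omega>)) c x v"
    unfolding form_eqD[OF e c] v
    by (simp add: form_simps r algebra_simps)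
qed

text \<open>The Leibniz rule with \<open>ext_d M \<theta>\<close> left unevaluated, so that the
  structure equation can be inserted afterwards; the summand \<open>\<omega>\<close> is
  closed.\<close>

lemma ext_d_Omega_form:
  assumes \<omega>: "one_form M \<omega>" "ext_d M \<omega> \<doteq>\<^bsub>M\<^esub> 0" and \<theta>: "one_form M \<theta>"
    and A: "smooth_fun M A" and B: "smooth_fun M B" and c: "c \<in> charts M" "x \<in> chart_dom M c"
  defines "a \<equiv> complex_of_real (A x) + \<i> * complex_of_real (B x)"
    and "dA \<equiv> dfun M (\<lambda>x. complex_of_real (A x)) c x" and "dB \<equiv> dfun M (\<lambda>x. complex_of_real (B x)) c
        x"
    and "t \<equiv> \<theta> c x"
  shows "ext_d M (Omega_form \<omega> \<theta> A B) c x (u, v) =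
    (dA u + \<i> * dB u) * t v - (dA v + \<i> * dB v) * t u + a * ext_d M \<theta> c x (u, v)
    + ((dA u - \<i> * dB u) * cnj (t v) - (dA v - \<i> * dB v) * cnj (t u) + cnj a * cnj (ext_d M \<theta> c x
        (u, v)))"
proof -
  let ?a = "\<lambda>x. complex_of_real (A x) + \<i> * complex_of_real (B x)"
  let ?b = "\<lambda>x. complex_of_real (A x) - \<i> * complex_of_real (B x)"
  note cA = smooth_fun_of_real[OF M A] and cB = smooth_fun_of_real[OF M B]
  have iB: "smooth_fun M (\<lambda>x. k * complex_of_real (B x))" for k
    by (rule smooth_fun_mult[OF M smooth_fun_const cB])
  have diB: "dfun M (\<lambda>x. k * complex_of_real (B x)) c x v = k * dB v" for k v
    unfolding dB_def by (rule dfun_linear[OF M bounded_linear_mult_right cB c])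
  have a: "smooth_fun M ?a" by (rule smooth_fun_add[OF M cA iB])
  have bb: "?b = (\<lambda>x. complex_of_real (A x) + (- \<i>) * complex_of_real (B x))" by simp
  have b: "smooth_fun M ?b" unfolding bb by (rule smooth_fun_add[OF M cA iB])
  have da: "dfun M ?a c x v = dA v + \<i> * dB v" for v
    unfolding dfun_add[OF M cA iB c] diB dA_def ..
  have db: "dfun M ?b c x v = dA v - \<i> * dB v" for v
    unfolding bb dfun_add[OF M cA iB c] diB dA_def by simp
  note c\<theta> = one_form_cconj[OF M \<theta>]
  note o = one_form_smul[OF M a \<theta>] one_form_smul[OF M b c\<theta>]
  have "ext_d M (Omega_form \<omega> \<theta> A B) c x (u, v)
    = ext_d M (?a \<odot> \<theta>) c x (u, v) + ext_d M (?b \<odot> cconj \<theta>) c x (u, v)"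
    unfolding Omega_form_def form_eqD[OF ext_d_add[OF M one_form_add[OF M o] \<omega>(1)] c] form_plus
      form_eqD[OF ext_d_add[OF M o] c] form_eqD[OF \<omega>(2) c] form_zero add_0_right ..
  also have "ext_d M (?a \<odot> \<theta>) c x (u, v) =
    (dA u + \<i> * dB u) * t v - (dA v + \<i> * dB v) * t u + a * ext_d M \<theta> c x (u, v)"
    unfolding form_eqD[OF ext_d_smul[OF M a \<theta>] c]
    unfolding form_apply da t_def a_def ..
  also have "ext_d M (?b \<odot> cconj \<theta>) c x (u, v) =
    (dA u - \<i> * dB u) * cnj (t v) - (dA v - \<i> * dB v) * cnj (t u) + cnj a * cnj (ext_d M \<theta> c x (u,
        v))"
    unfolding form_eqD[OF ext_d_smul[OF M b c\<theta>] c]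
    unfolding form_apply db form_eqD[OF ext_d_cconj[OF M \<theta>] c] t_def a_def by simp
  finally show ?thesis .
qed

text \<open>Evaluates \<open>d(d\<theta>) = 0\<close> on the dual frame.\<close>

lemma dT_wedge:
  assumes f: "one_form M \<omega>" "real_form M \<omega>" "ext_d M \<omega> \<doteq>\<^bsub>M\<^esub> 0" "one_form M \<theta>"
    and A: "smooth_fun M A" and B: "smooth_fun M B" and T: "smooth_fun M T"
    and e: "ext_d M \<theta> \<doteq>\<^bsub>M\<^esub>
         (\<lambda>x. \<i> * complex_of_real (B x) - complex_of_real (A x)) \<odot> (\<theta> \<^bold>\<and> cconj \<theta>)
       + (\<lambda>x. \<i> * complex_of_real (T x)) \<odot> (\<theta> \<^bold>\<and> \<omega>) + cconj \<theta> \<^bold>\<and> \<omega>"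
    and dAB: "\<And>c x e0 e1 e2. c \<in> charts M \<Longrightarrow> x \<in> chart_dom M c \<Longrightarrow> dual_frame (\<omega> c x) (\<theta> c x) e0 e1 e2
        \<Longrightarrow>
      dfun M (\<lambda>x. complex_of_real (A x)) c x e0 = complex_of_real (A x - B x * T x) \<and>
      dfun M (\<lambda>x. complex_of_real (B x)) c x e0 = complex_of_real (A x * T x - B x)"
  shows "dfun M (\<lambda>x. complex_of_real (T x)) \<^bold>\<and> \<omega> \<doteq>\<^bsub>M\<^esub> 0"
proof (rule form_eqI)
  fix c x and vv :: "(real^3) \<times> (real^3)" assume c: "c \<in> charts M" "x \<in> chart_dom M c"
  obtain u v :: "real^3" where vv: "vv = (u, v)" by (rule prod.exhaust)
  obtain e0 e1 e2 where d: "dual_frame (\<omega> c x) (\<theta> c x) e0 e1 e2"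
    using coframe_dual_frame[OF M f(1,2,4) cf c] .
  note fr = d[unfolded dual_frame_def]
  note cA = smooth_fun_of_real[OF M A] and cB = smooth_fun_of_real[OF M B] and cT =
      smooth_fun_of_real[OF M T]
  note c\<theta> = one_form_cconj[OF M f(4)]
  let ?a = "\<lambda>x. \<i> * complex_of_real (B x) - complex_of_real (A x)" and ?t = "\<lambda>x. \<i> * complex_of_real
      (T x)"
  let ?dT = "dfun M (\<lambda>x. complex_of_real (T x)) c x"
  have iB: "smooth_fun M (\<lambda>x. \<i> * complex_of_real (B x))" by (rule smooth_fun_mult[OF M
      smooth_fun_const cB])
  have nA: "smooth_fun M (\<lambda>x. - 1 * complex_of_real (A x))" by (rule smooth_fun_mult[OF M
      smooth_fun_const cA])
  have aa: "?a = (\<lambda>x. \<i> * complex_of_real (B x) + - 1 * complex_of_real (A x))" by simp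
  have a: "smooth_fun M ?a" unfolding aa by (rule smooth_fun_add[OF M iB nA])
  have t: "smooth_fun M ?t" by (rule smooth_fun_mult[OF M smooth_fun_const cT])
  have da: "dfun M ?a c x z = \<i> * dfun M (\<lambda>x. complex_of_real (B x)) c x z - dfun M (\<lambda>x.
      complex_of_real (A x)) c x z" for z
    unfolding aa dfun_add[OF M iB nA c] dfun_linear[OF M bounded_linear_mult_right cB c]
      dfun_linear[OF M bounded_linear_mult_right cA c] by simp
  have dt: "dfun M ?t c x z = \<i> * ?dT z" for z
    by (rule dfun_linear[OF M bounded_linear_mult_right cT c])
  \<comment> \<open>The constant factor 1 brings the third term into the shape to which
    \<open>ext_d2_smul_wedge\<close> applies.\<close>
  let ?X = "?a \<odot> (\<theta> \<^bold>\<and> cconj \<theta>)" and ?Y = "?t \<odot> (\<theta> \<^bold>\<and> \<omega>)" and ?Z = "(\<lambda>_. 1) \<odot> (cconj \<theta> \<^bold>\<and> \<omega>)"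
  have one: "smooth_fun M (\<lambda>_. 1::complex)" by (rule smooth_fun_const)
  have "ext_d M \<theta> \<doteq>\<^bsub>M\<^esub> ?X + ?Y + ?Z"
    using e by (simp add: smul_def)
  note E = form_eq_trans[OF form_eq_sym[OF ext_d2_cong[OF M this]] ext_d2_ext_d[OF M f(4)]]
  note x = differentiable_2form_smul_wedge[OF M a f(4) c\<theta>] and y =
      differentiable_2form_smul_wedge[OF M t f(4,1)]
    and z = differentiable_2form_smul_wedge[OF M one c\<theta> f(1)]
  have "ext_d2 M ?X c x (e1, e2, e0) + ext_d2 M ?Y c x (e1, e2, e0) + ext_d2 M ?Z c x (e1, e2, e0) =
      0"
    using form_eqD[OF E c, of "(e1, e2, e0)"]
      form_eqD[OF ext_d2_add[OF M differentiable_2form_add[OF M x y] z] c, of "(e1, e2, e0)"]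
      form_eqD[OF ext_d2_add[OF M x y] c, of "(e1, e2, e0)"]
    by (simp add: plus_fun_def zero_fun_def)
  note 0 = this[unfolded form_eqD[OF ext_d2_smul_wedge[OF M a f(4) c\<theta>] c]
    form_eqD[OF ext_d2_smul_wedge[OF M t f(4,1)] c] form_eqD[OF ext_d2_smul_wedge[OF M one c\<theta> f(1)]
        c]]
  have ec: "ext_d M (cconj \<theta>) c x v = cnj (ext_d M \<theta> c x v)" for v
    using form_eqD[OF ext_d_cconj[OF M f(4)] c] by (simp add: cconj_def)
  have e\<omega>: "ext_d M \<omega> c x v = 0" for v using form_eqD[OF f(3) c] by (simp add: zero_fun_def)
  have rT: "\<exists>r. ?dT z = complex_of_real r" for z
    using dfun_of_real_Reals[OF M T c] by (auto elim: Reals_cases)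
  obtain r1 where r1: "?dT e1 = complex_of_real r1" using rT by blast
  obtain r2 where r2: "?dT e2 = complex_of_real r2" using rT by blast
  obtain r0 where r0: "?dT e0 = complex_of_real r0" using rT by blast
  note 1 = 0[unfolded form_apply ec e\<omega> form_eqD[OF e c] da dt r0 r1 r2
        conjunct1[OF dAB[OF c d]] conjunct2[OF dAB[OF c d]]]
  \<comment> \<open>The values of dA and dB on \<open>e0\<close> cancel all terms except the
    \<open>cconj \<theta>\<close> coefficient of dT. Since \<open>r1\<close> and \<open>r2\<close>
    are real, both vanish, and dT is a multiple of \<open>\<omega>\<close>.\<close>
  have "complex_of_real r1 + \<i> * complex_of_real r2 = 0"
    using 1 by (simp add: form_apply fr dfun_const[OF M] algebra_simps)
  then have "r1 = 0 \<and> r2 = 0" by (simp add: complex_eq_iff)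
  then have "?dT z = complex_of_real (Re (\<omega> c x z)) * ?dT e0" for z
    using dual_frame_expand[OF d one_form_linear[OF M one_form_dfun[OF M cT] c], of z] r1 r2 by simp
  moreover have "complex_of_real (Re (\<omega> c x z)) = \<omega> c x z" for z
    using f(2) c by (simp add: real_form_def complex_is_Real_iff complex_eq_iff)
  ultimately have dTz: "?dT z = \<omega> c x z * ?dT e0" for z by metis
  show "(dfun M (\<lambda>x. complex_of_real (T x)) \<^bold>\<and> \<omega>) c x vv = 0 c x vv"
    unfolding vv form_wedge form_zero dTz[of u] dTz[of v] by simp
qed

end

section \<open>Passing between the structure equations and the invariant system\<close>

lemma one_form_Omega_form:
  assumes M: "smooth_atlas M" and \<omega>: "one_form M \<omega>" and \<theta>: "one_form M \<theta>"
    and A: "smooth_fun M A" and B: "smooth_fun M B"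
  shows "one_form M (Omega_form \<omega> \<theta> A B)"
  unfolding Omega_form_def
  by (intro one_form_add[OF M] one_form_smul[OF M] one_form_cconj[OF M] smooth_fun_add[OF M]
      smooth_fun_diff[OF M]
      smooth_fun_mult[OF M] smooth_fun_of_real[OF M] smooth_fun_const assms)

lemma real_form_Omega_form:
  assumes "real_form M \<omega>"
  shows "real_form M (Omega_form \<omega> \<theta> A B)"
  unfolding real_form_def
proof (intro ballI allI)
  fix c x v assume "c \<in> charts M" "x \<in> chart_dom M c"
  then have "\<omega> c x v \<in> \<real>" using assms by (simp add: real_form_def)
  then show "Omega_form \<omega> \<theta> A B c x v \<in> \<real>"
    by (simp add: Omega_form_def form_apply complex_is_Real_iff)
qed

lemma pullback_Omega_form:
  "pullback M N \<psi> (Omega_form \<omega> \<theta> A B) =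
    Omega_form (pullback M N \<psi> \<omega>) (pullback M N \<psi> \<theta>) (\<lambda>x. A (\<psi> x)) (\<lambda>x. B (\<psi> x))"
  unfolding Omega_form_def pullback_add pullback_smul pullback_cconj ..

lemma invariant_systemD:
  assumes "invariant_system M \<epsilon> \<omega> \<theta> A B T A1 B1"
  shows "\<epsilon> \<in> {1, -1}" "one_form M \<omega>" "real_form M \<omega>" "one_form M \<theta>" "coframe M \<omega> \<theta>"
    "smooth_fun M A" "smooth_fun M B" "smooth_fun M T" "smooth_fun M A1" "smooth_fun M B1"
    "ext_d M \<omega> \<doteq>\<^bsub>M\<^esub> 0"
    "ext_d M \<theta> \<doteq>\<^bsub>M\<^esub>
         (\<lambda>x. \<i> * complex_of_real (B x) - complex_of_real (A x)) \<odot> (\<theta> \<^bold>\<and> cconj \<theta>)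
       + (\<lambda>x. \<i> * complex_of_real (T x)) \<odot> (\<theta> \<^bold>\<and> \<omega>) + cconj \<theta> \<^bold>\<and> \<omega>"
    "ext_d M (Omega_form \<omega> \<theta> A B) \<doteq>\<^bsub>M\<^esub> (\<lambda>x. complex_of_real \<epsilon> * \<i>) \<odot> (\<theta> \<^bold>\<and> cconj \<theta>)"
    "dfun M (\<lambda>x. complex_of_real (A x)) \<doteq>\<^bsub>M\<^esub>
         (\<lambda>x. complex_of_real (A1 x) + \<i> / 2 * (B1 x + cnj (B1 x) + complex_of_real \<epsilon>)) \<odot> \<theta>
       + (\<lambda>x. complex_of_real (A1 x) - \<i> / 2 * (B1 x + cnj (B1 x) + complex_of_real \<epsilon>)) \<odot> cconj \<theta>
       + (\<lambda>x. complex_of_real (A x - B x * T x)) \<odot> \<omega>"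
    "dfun M (\<lambda>x. complex_of_real (B x)) \<doteq>\<^bsub>M\<^esub>
         B1 \<odot> \<theta> + (\<lambda>x. cnj (B1 x)) \<odot> cconj \<theta>
       + (\<lambda>x. complex_of_real (A x * T x - B x)) \<odot> \<omega>"
    "dfun M (\<lambda>x. complex_of_real (T x)) \<^bold>\<and> \<omega> \<doteq>\<^bsub>M\<^esub> 0"
  using assms unfolding invariant_system_def by auto

lemma invariant_system_struct_eqs:
  fixes M :: "('a, real^3) mfd"
  assumes M: "smooth_atlas M" and s: "invariant_system M \<epsilon> \<omega> \<theta> A B T A1 B1"
  shows "struct_eqs M \<omega> \<theta> (Omega_form \<omega> \<theta> A B) T (\<lambda>_. \<epsilon>)"
proof -
  note D = invariant_systemD[OF s]
  have "ext_d M \<theta> \<doteq>\<^bsub>M\<^esub> Omega_form \<omega> \<theta> A B \<^bold>\<and> \<theta> + (\<theta> + cconj \<theta>) \<^bold>\<and> \<omega>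
        + (\<lambda>x. \<i> * complex_of_real (T x)) \<odot> (\<theta> \<^bold>\<and> \<omega>)"
  proof (rule form_eqI)
    fix c x and v :: "(real^3) \<times> (real^3)" assume c: "c \<in> charts M" "x \<in> chart_dom M c"
    obtain u w :: "real^3" where v: "v = (u, w)" by (rule prod.exhaust)
    show "ext_d M \<theta> c x v = (Omega_form \<omega> \<theta> A B \<^bold>\<and> \<theta> + (\<theta> + cconj \<theta>) \<^bold>\<and> \<omega>
        + (\<lambda>x. \<i> * complex_of_real (T x)) \<odot> (\<theta> \<^bold>\<and> \<omega>)) c x v"
      unfolding form_eqD[OF D(12) c] v
      by (simp add: form_apply Omega_form_def algebra_simps)
  qed
  moreover have "ext_d M (Omega_form \<omega> \<theta> A B) \<doteq>\<^bsub>M\<^esub> (\<lambda>x. \<i> * complex_of_real \<epsilon>) \<odot> (\<theta> \<^bold>\<and> cconj \<theta>)"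
    using D(13) by (simp add: mult.commute)
  ultimately show ?thesis
    unfolding struct_eqs_def
    using D(2,3,4,8,11) one_form_Omega_form[OF M D(2,4,6,7)] real_form_Omega_form[OF D(3)]
        smooth_fun_const
    by auto
qed

text \<open>The equation for d\<Omega> amounts to three scalar conditions. Those on
  \<open>(e1, e0)\<close> and \<open>(e2, e0)\<close> fix both \<omega> coefficients; the one on
  \<open>(e1, e2)\<close> ties the imaginary part of the \<theta> coefficient of dA to the real part
  of that of dB. The real part of the former and all of the latter stay free: they are
  \<open>A1\<close> and \<open>B1\<close>.\<close>

lemma struct_eqs_dA_dB:
  fixes M :: "('a, real^3) mfd"
  assumes M: "smooth_atlas M" and cf: "coframe M \<omega> \<theta>"
    and s: "struct_eqs M \<omega> \<theta> (Omega_form \<omega> \<theta> A B) T (\<lambda>_. \<epsilon>)"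
    and A: "smooth_fun M A" and B: "smooth_fun M B"
  obtains A1 B1 where "smooth_fun M A1" "smooth_fun M B1"
    "dfun M (\<lambda>x. complex_of_real (A x)) \<doteq>\<^bsub>M\<^esub>
         (\<lambda>x. complex_of_real (A1 x) + \<i> / 2 * (B1 x + cnj (B1 x) + complex_of_real \<epsilon>)) \<odot> \<theta>
       + (\<lambda>x. complex_of_real (A1 x) - \<i> / 2 * (B1 x + cnj (B1 x) + complex_of_real \<epsilon>)) \<odot> cconj \<theta>
       + (\<lambda>x. complex_of_real (A x - B x * T x)) \<odot> \<omega>"
    "dfun M (\<lambda>x. complex_of_real (B x)) \<doteq>\<^bsub>M\<^esub>
         B1 \<odot> \<theta> + (\<lambda>x. cnj (B1 x)) \<odot> cconj \<theta>
       + (\<lambda>x. complex_of_real (A x * T x - B x)) \<odot> \<omega>"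
proof -
  note D = struct_eqsD[OF s]
  note cA = smooth_fun_of_real[OF M A] and cB = smooth_fun_of_real[OF M B]
  have rA: "real_form M (dfun M (\<lambda>x. complex_of_real (A x)))" and rB: "real_form M (dfun M (\<lambda>x.
      complex_of_real (B x)))"
    unfolding real_form_def by (auto intro: dfun_of_real_Reals[OF M A] dfun_of_real_Reals[OF M B])
  obtain a0 a1 where a: "smooth_fun M a0" "smooth_fun M a1"
    "dfun M (\<lambda>x. complex_of_real (A x)) \<doteq>\<^bsub>M\<^esub> (\<lambda>x. complex_of_real (a0 x)) \<odot> \<omega> + a1 \<odot> \<theta> + (\<lambda>x. cnj
        (a1 x)) \<odot> cconj \<theta>"
    using coframe_coeffs_real[OF M D(1,2,3) cf one_form_dfun[OF M cA] rA] .
  obtain b0 b1 where b: "smooth_fun M b0" "smooth_fun M b1"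
    "dfun M (\<lambda>x. complex_of_real (B x)) \<doteq>\<^bsub>M\<^esub> (\<lambda>x. complex_of_real (b0 x)) \<odot> \<omega> + b1 \<odot> \<theta> + (\<lambda>x. cnj
        (b1 x)) \<odot> cconj \<theta>"
    using coframe_coeffs_real[OF M D(1,2,3) cf one_form_dfun[OF M cB] rB] .
  have key: "Im (a1 x) = Re (b1 x) + \<epsilon> / 2" "a0 x = A x - B x * T x" "b0 x = A x * T x - B x"
    if c: "c \<in> charts M" "x \<in> chart_dom M c" for c x
  proof -
    obtain e0 e1 e2 where d: "dual_frame (\<omega> c x) (\<theta> c x) e0 e1 e2"
      using coframe_dual_frame[OF M D(1,2,3) cf c] .
    note fr = d[unfolded dual_frame_def]
    have R: "(dfun M (\<lambda>x. complex_of_real (A x)) c x u + \<i> * dfun M (\<lambda>x. complex_of_real (B x)) c x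
        u) * \<theta> c x v
      - (dfun M (\<lambda>x. complex_of_real (A x)) c x v + \<i> * dfun M (\<lambda>x. complex_of_real (B x)) c x v) *
          \<theta> c x u
      + (complex_of_real (A x) + \<i> * complex_of_real (B x)) * ext_d M \<theta> c x (u, v)
      + ((dfun M (\<lambda>x. complex_of_real (A x)) c x u - \<i> * dfun M (\<lambda>x. complex_of_real (B x)) c x u) *
          cnj (\<theta> c x v)
      - (dfun M (\<lambda>x. complex_of_real (A x)) c x v - \<i> * dfun M (\<lambda>x. complex_of_real (B x)) c x v) *
          cnj (\<theta> c x u)
      + cnj (complex_of_real (A x) + \<i> * complex_of_real (B x)) * cnj (ext_d M \<theta> c x (u, v)))
      = \<i> * complex_of_real \<epsilon> * (\<theta> c x u * cnj (\<theta> c x v) - \<theta> c x v * cnj (\<theta> c x u))" for u v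
      unfolding ext_d_Omega_form[OF M cf D(1,8,3) A B c, symmetric]
      unfolding form_eqD[OF D(10) c] form_apply ..
    note S = structure_equation_AB[OF M cf s form_eq_refl]
    note R' = R[unfolded form_eqD[OF a(3) c] form_eqD[OF b(3) c] form_eqD[OF S c] form_apply]
    show "Im (a1 x) = Re (b1 x) + \<epsilon> / 2"
      using R'[of e1 e2] by (simp add: fr complex_eq_iff algebra_simps)
    show "a0 x = A x - B x * T x"
      using R'[of e1 e0] R'[of e2 e0] by (simp add: fr complex_eq_iff algebra_simps)
    show "b0 x = A x * T x - B x"
      using R'[of e1 e0] R'[of e2 e0] by (simp add: fr complex_eq_iff algebra_simps)
  qed
  show thesis
  proof (rule that[OF smooth_fun_Re[OF M a(2)] b(2) form_eqI form_eqI])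
    fix c x and v :: "real^3" assume c: "c \<in> charts M" "x \<in> chart_dom M c"
    have "complex_of_real (Re (a1 x)) + \<i> / 2 * (b1 x + cnj (b1 x) + complex_of_real \<epsilon>) = a1 x"
      "complex_of_real (Re (a1 x)) - \<i> / 2 * (b1 x + cnj (b1 x) + complex_of_real \<epsilon>) = cnj (a1 x)"
      using key(1)[OF c] by (simp_all add: complex_eq_iff field_simps)
    then show "dfun M (\<lambda>x. complex_of_real (A x)) c x v =
         ((\<lambda>x. complex_of_real (Re (a1 x)) + \<i> / 2 * (b1 x + cnj (b1 x) + complex_of_real \<epsilon>)) \<odot> \<theta>
       + (\<lambda>x. complex_of_real (Re (a1 x)) - \<i> / 2 * (b1 x + cnj (b1 x) + complex_of_real \<epsilon>)) \<odot> cconj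
           \<theta>
       + (\<lambda>x. complex_of_real (A x - B x * T x)) \<odot> \<omega>) c x v"
      unfolding form_eqD[OF a(3) c] form_apply key(2)[OF c] by simp
    show "dfun M (\<lambda>x. complex_of_real (B x)) c x v =
         (b1 \<odot> \<theta> + (\<lambda>x. cnj (b1 x)) \<odot> cconj \<theta> + (\<lambda>x. complex_of_real (A x * T x - B x)) \<odot> \<omega>) c x v"
      unfolding form_eqD[OF b(3) c] form_apply key(3)[OF c] by simp
  qed
qed

lemma struct_eqs_invariant_system_AB:
  fixes M :: "('a, real^3) mfd"
  assumes M: "smooth_atlas M" and cf: "coframe M \<omega> \<theta>"
    and s: "struct_eqs M \<omega> \<theta> (Omega_form \<omega> \<theta> A B) T (\<lambda>_. \<epsilon>)" and \<epsilon>: "\<epsilon> \<in> {1, -1::real}"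
    and A: "smooth_fun M A" and B: "smooth_fun M B"
  obtains A1 B1 where "invariant_system M \<epsilon> \<omega> \<theta> A B T A1 B1"
proof -
  note D = struct_eqsD[OF s]
  obtain A1 B1 where 1: "smooth_fun M A1" "smooth_fun M B1"
    and dA: "dfun M (\<lambda>x. complex_of_real (A x)) \<doteq>\<^bsub>M\<^esub>
         (\<lambda>x. complex_of_real (A1 x) + \<i> / 2 * (B1 x + cnj (B1 x) + complex_of_real \<epsilon>)) \<odot> \<theta>
       + (\<lambda>x. complex_of_real (A1 x) - \<i> / 2 * (B1 x + cnj (B1 x) + complex_of_real \<epsilon>)) \<odot> cconj \<theta>
       + (\<lambda>x. complex_of_real (A x - B x * T x)) \<odot> \<omega>"
    and dB: "dfun M (\<lambda>x. complex_of_real (B x)) \<doteq>\<^bsub>M\<^esub>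
         B1 \<odot> \<theta> + (\<lambda>x. cnj (B1 x)) \<odot> cconj \<theta>
       + (\<lambda>x. complex_of_real (A x * T x - B x)) \<odot> \<omega>"
    using struct_eqs_dA_dB[OF M cf s A B] .
  note S = structure_equation_AB[OF M cf s form_eq_refl]
  have dT: "dfun M (\<lambda>x. complex_of_real (T x)) \<^bold>\<and> \<omega> \<doteq>\<^bsub>M\<^esub> 0"
    by (rule dT_wedge[OF M cf D(1,2,8,3) A B D(6) S])
      (simp add: form_eqD[OF dA] form_eqD[OF dB] form_apply dual_frame_def)
  have "ext_d M (Omega_form \<omega> \<theta> A B) \<doteq>\<^bsub>M\<^esub> (\<lambda>x. complex_of_real \<epsilon> * \<i>) \<odot> (\<theta> \<^bold>\<and> cconj \<theta>)"
    using D(10) by (simp add: mult.commute)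
  then have "invariant_system M \<epsilon> \<omega> \<theta> A B T A1 B1"
    unfolding invariant_system_def
    using \<epsilon> D(1,2,3,6,8) cf A B 1 S structure_equation_cconj[OF M cf D(3,2) S] dA dB dT by blast
  then show thesis by (rule that)
qed

lemma struct_eqs_invariant_system:
  fixes M :: "('a, real^3) mfd"
  assumes M: "smooth_atlas M" and cf: "coframe M \<omega> \<theta>"
    and s: "struct_eqs M \<omega> \<theta> \<Omega> T (\<lambda>_. \<epsilon>)" and \<epsilon>: "\<epsilon> \<in> {1, -1::real}"
  obtains A B A1 B1 where "\<Omega> \<doteq>\<^bsub>M\<^esub> Omega_form \<omega> \<theta> A B" "invariant_system M \<epsilon> \<omega> \<theta> A B T A1 B1"
proof -
  obtain A B where AB: "smooth_fun M A" "smooth_fun M B" "\<Omega> \<doteq>\<^bsub>M\<^esub> Omega_form \<omega> \<theta> A B"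
    using struct_eqs_Omega[OF M cf s \<epsilon>] .
  have "struct_eqs M \<omega> \<theta> (Omega_form \<omega> \<theta> A B) T (\<lambda>_. \<epsilon>)"
    by (rule struct_eqs_cong[OF M s form_eq_refl form_eq_refl AB(3)]) simp_all
  from struct_eqs_invariant_system_AB[OF M cf this \<epsilon> AB(1,2)] AB(3) that show thesis by metis
qed

text \<open>The map \<open>\<eta>\<close> inverts \<open>\<psi>\<close>, so every tangent vector at \<open>\<psi> x\<close> comes from one at \<open>x\<close>.\<close>

lemma coframe_pullback:
  fixes M :: "('a, real^3) mfd" and N :: "('b, real^3) mfd"
  assumes M: "smooth_atlas M" and N: "smooth_atlas N" and \<psi>: "smooth_map M N \<psi>" and \<eta>: "smooth_map N
      M \<eta>"
    and inv: "\<And>x. x \<in> points M \<Longrightarrow> \<eta> (\<psi> x) = x" "\<And>y. y \<in> points N \<Longrightarrow> \<psi> (\<eta> y) = y"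
    and f: "one_form N \<omega>" "one_form N \<theta>" and cf: "coframe N \<omega> \<theta>"
  shows "coframe M (pullback M N \<psi> \<omega>) (pullback M N \<psi> \<theta>)"
  unfolding coframe_def
proof (intro ballI)
  fix c x assume c: "c \<in> charts M" "x \<in> chart_dom M c"
  obtain c' where c': "c' \<in> charts N" "\<psi> x \<in> chart_dom N c'" using exists_target_chart[OF M N \<psi>
      c(2)] .
  have xx: "\<eta> (\<psi> x) = x" by (rule inv(1)[OF subsetD[OF dom_subset_points c(2)]])
  obtain u v w where D: "(\<omega> \<^bold>\<and>\<^bold>\<and> \<theta> \<^bold>\<and> cconj \<theta>) c' (\<psi> x) (u, v, w) \<noteq> 0"
    using cf c' unfolding coframe_def by blast
  let ?t = "tangent_map N \<eta> c' c (\<psi> x)"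
  have t: "tangent_map M \<psi> c c' x (?t z) = z" for z
    using tangent_map_inverse[OF N M \<eta> \<psi> inv(2) c'(1) c(1) c'(2)] c(2) by (simp add: xx)
  note pe = pullback_eq[OF M N \<psi> _ c(1) c'(1) c(2) c'(2)]
  have "(pullback M N \<psi> \<omega> \<^bold>\<and>\<^bold>\<and> pullback M N \<psi> \<theta> \<^bold>\<and> cconj (pullback M N \<psi> \<theta>)) c x (?t u, ?t v, ?t w)
      \<noteq> 0"
    using D unfolding form_apply pe[OF f(1)] pe[OF f(2)] t .
  then show "\<exists>u v w. (pullback M N \<psi> \<omega> \<^bold>\<and>\<^bold>\<and> pullback M N \<psi> \<theta> \<^bold>\<and> cconj (pullback M N \<psi> \<theta>)) c x (u, v,
      w) \<noteq> 0"
    by blast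
qed

lemma dfun_pullback_combination:
  fixes M :: "('a, 'e::euclidean_space) mfd" and N :: "('b, 'g::euclidean_space) mfd"
  assumes M: "smooth_atlas M" and N: "smooth_atlas N" and \<psi>: "smooth_map M N \<psi>"
    and f: "smooth_fun N f" "one_form N \<omega>" "one_form N \<theta>"
    and e: "dfun N f \<doteq>\<^bsub>N\<^esub> a \<odot> \<theta> + b \<odot> cconj \<theta> + d \<odot> \<omega>"
  shows "dfun M (\<lambda>x. f (\<psi> x)) \<doteq>\<^bsub>M\<^esub> (\<lambda>x. a (\<psi> x)) \<odot> pullback M N \<psi> \<theta>
     + (\<lambda>x. b (\<psi> x)) \<odot> cconj (pullback M N \<psi> \<theta>) + (\<lambda>x. d (\<psi> x)) \<odot> pullback M N \<psi> \<omega>"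
proof (rule form_eqI)
  fix c x v assume c: "c \<in> charts M" "x \<in> chart_dom M c"
  obtain c' where c': "c' \<in> charts N" "\<psi> x \<in> chart_dom N c'" using exists_target_chart[OF M N \<psi>
      c(2)] .
  show "dfun M (\<lambda>x. f (\<psi> x)) c x v = ((\<lambda>x. a (\<psi> x)) \<odot> pullback M N \<psi> \<theta>
     + (\<lambda>x. b (\<psi> x)) \<odot> cconj (pullback M N \<psi> \<theta>) + (\<lambda>x. d (\<psi> x)) \<odot> pullback M N \<psi> \<omega>) c x v"
    unfolding dfun_pullback[OF M N \<psi> f(1) c(1) c'(1) c(2) c'(2)] form_eqD[OF e c'] form_apply
      pullback_eq[OF M N \<psi> f(2) c(1) c'(1) c(2) c'(2)] pullback_eq[OF M N \<psi> f(3) c(1) c'(1) c(2)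
          c'(2)] ..
qed

text \<open>The system is not pulled back equation by equation. The structure equations are, the
  system is derived from them anew with some coefficients \<open>A1'\<close> and \<open>B1'\<close>,
  and the equations for dA and dB are then replaced by the pulled-back ones.\<close>

lemma invariant_system_pullback:
  fixes M :: "('a, real^3) mfd" and N :: "('b, real^3) mfd"
  assumes M: "smooth_atlas M" and N: "smooth_atlas N" and \<psi>: "smooth_map M N \<psi>" and \<eta>: "smooth_map N
      M \<eta>"
    and inv: "\<And>x. x \<in> points M \<Longrightarrow> \<eta> (\<psi> x) = x" "\<And>y. y \<in> points N \<Longrightarrow> \<psi> (\<eta> y) = y"
    and s: "invariant_system N \<epsilon> \<omega> \<theta> A B T A1 B1"
  shows "invariant_system M \<epsilon> (pullback M N \<psi> \<omega>) (pullback M N \<psi> \<theta>) (\<lambda>x. A (\<psi> x)) (\<lambda>x. B (\<psi> x))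
    (\<lambda>x. T (\<psi> x)) (\<lambda>x. A1 (\<psi> x)) (\<lambda>x. B1 (\<psi> x))"
proof -
  note D = invariant_systemD[OF s]
  let ?\<omega> = "pullback M N \<psi> \<omega>" and ?\<theta> = "pullback M N \<psi> \<theta>"
  have cf: "coframe M ?\<omega> ?\<theta>" by (rule coframe_pullback[OF M N \<psi> \<eta> inv D(2,4,5)])
  have se: "struct_eqs M ?\<omega> ?\<theta> (Omega_form ?\<omega> ?\<theta> (\<lambda>x. A (\<psi> x)) (\<lambda>x. B (\<psi> x))) (\<lambda>x. T (\<psi> x)) (\<lambda>_. \<epsilon>)"
    using struct_eqs_pullback[OF M N \<psi> invariant_system_struct_eqs[OF N s]] unfolding
        pullback_Omega_form .
  note c = smooth_fun_compose[OF M N \<psi>]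
  obtain A1' B1' where s': "invariant_system M \<epsilon> ?\<omega> ?\<theta> (\<lambda>x. A (\<psi> x)) (\<lambda>x. B (\<psi> x)) (\<lambda>x. T (\<psi> x)) A1'
      B1'"
    using struct_eqs_invariant_system_AB[OF M cf se D(1) c[OF D(6)] c[OF D(7)]] .
  have "dfun M (\<lambda>x. complex_of_real (A (\<psi> x))) \<doteq>\<^bsub>M\<^esub>
         (\<lambda>x. complex_of_real (A1 (\<psi> x)) + \<i> / 2 * (B1 (\<psi> x) + cnj (B1 (\<psi> x)) + complex_of_real \<epsilon>))
             \<odot> ?\<theta>
       + (\<lambda>x. complex_of_real (A1 (\<psi> x)) - \<i> / 2 * (B1 (\<psi> x) + cnj (B1 (\<psi> x)) + complex_of_real \<epsilon>))
           \<odot> cconj ?\<theta>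
       + (\<lambda>x. complex_of_real (A (\<psi> x) - B (\<psi> x) * T (\<psi> x))) \<odot> ?\<omega>"
    by (rule dfun_pullback_combination[OF M N \<psi> smooth_fun_of_real[OF N D(6)] D(2,4,14)])
  moreover have "dfun M (\<lambda>x. complex_of_real (B (\<psi> x))) \<doteq>\<^bsub>M\<^esub>
         (\<lambda>x. B1 (\<psi> x)) \<odot> ?\<theta> + (\<lambda>x. cnj (B1 (\<psi> x))) \<odot> cconj ?\<theta>
       + (\<lambda>x. complex_of_real (A (\<psi> x) * T (\<psi> x) - B (\<psi> x))) \<odot> ?\<omega>"
    by (rule dfun_pullback_combination[OF M N \<psi> smooth_fun_of_real[OF N D(7)] D(2,4,15)])
  ultimately show ?thesis
    using s' c[OF D(9)] c[OF D(10)] unfolding invariant_system_def by blast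
qed

text \<open>Away from zeros of \<open>h\<close> the radicand is positive, so the square root is
  smooth there.\<close>

lemma smooth_fun_cmod:
  assumes M: "smooth_atlas M" and h: "smooth_fun M h" "\<And>x. x \<in> points M \<Longrightarrow> h x \<noteq> 0"
  shows "smooth_fun M (\<lambda>x. cmod (h x))"
  unfolding cmod_def power2_eq_square
  by (intro smooth_fun_sqrt[OF M] smooth_fun_add[OF M] smooth_fun_mult[OF M] smooth_fun_Re[OF M]
      smooth_fun_Im[OF M] h)
    (use h(2) in \<open>auto simp: complex_eq_iff sum_squares_gt_zero_iff\<close>)

lemma smooth_fun_Ln:
  assumes M: "smooth_atlas M" and h: "smooth_fun M h" "\<And>x. x \<in> points M \<Longrightarrow> h x \<in> - \<real>\<^sub>\<le>\<^sub>0"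
  shows "smooth_fun M (\<lambda>x. Ln (h x))"
  unfolding smooth_fun_def o_def
proof
  fix c assume c: "c \<in> charts M"
  have o: "open (- \<real>\<^sub>\<le>\<^sub>0 :: complex set)" by (simp add: open_Compl)
  show "smooth_on (chart_img M c) (\<lambda>y. Ln (h (param M c y)))"
    by (rule smooth_on_compose[OF img_open[OF M c] o _ smooth_on_Ln])
      (use h c in \<open>auto simp: smooth_fun_def o_def param_in_points\<close>)
qed

text \<open>The volume form is multiplied by \<open>f x * h x * cnj (h x)\<close>, which does not
  vanish.\<close>

lemma coframe_scale:
  assumes cf: "coframe M \<omega> \<theta>" and e: "\<omega>' \<doteq>\<^bsub>M\<^esub> f \<odot> \<omega>" "\<theta>' \<doteq>\<^bsub>M\<^esub> h \<odot> \<theta>"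
    and nz: "\<And>x. x \<in> points M \<Longrightarrow> f x \<noteq> 0 \<and> h x \<noteq> 0"
  shows "coframe M \<omega>' \<theta>'"
  unfolding coframe_def
proof (intro ballI)
  fix c x assume c: "c \<in> charts M" "x \<in> chart_dom M c"
  obtain u v w where D: "(\<omega> \<^bold>\<and>\<^bold>\<and> \<theta> \<^bold>\<and> cconj \<theta>) c x (u, v, w) \<noteq> 0"
    using cf c unfolding coframe_def by blast
  have "(\<omega>' \<^bold>\<and>\<^bold>\<and> \<theta>' \<^bold>\<and> cconj \<theta>') c x (u, v, w)
      = f x * h x * cnj (h x) * (\<omega> \<^bold>\<and>\<^bold>\<and> \<theta> \<^bold>\<and> cconj \<theta>) c x (u, v, w)"
    unfolding form_apply form_eqD[OF e(1) c] form_eqD[OF e(2) c] by (simp add: algebra_simps)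
  then show "\<exists>u v w. (\<omega>' \<^bold>\<and>\<^bold>\<and> \<theta>' \<^bold>\<and> cconj \<theta>') c x (u, v, w) \<noteq> 0"
    using D nz[OF subsetD[OF dom_subset_points c(2)]] by (intro exI[of _ u] exI[of _ v] exI[of _ w])
        simp
qed

section \<open>Equality of structures\<close>

lemma same_structureE:
  assumes "same_structure M lam \<mu> lam' \<mu>'"
  obtains f h where "smooth_fun M f" "smooth_fun M h" "\<forall>x\<in>points M. f x \<noteq> 0" "\<forall>x\<in>points M. h x \<noteq> 0"
    "lam' \<doteq>\<^bsub>M\<^esub> (\<lambda>x. complex_of_real (f x)) \<odot> lam" "\<mu>' \<doteq>\<^bsub>M\<^esub> h \<odot> \<mu>"
  using assms unfolding same_structure_def by (elim exE conjE) (rule that, auto)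

lemma same_structureI:
  assumes "smooth_fun M f" "smooth_fun M h" "\<And>x. x \<in> points M \<Longrightarrow> f x \<noteq> 0" "\<And>x. x \<in> points M \<Longrightarrow> h x \<noteq>
      0"
    "lam' \<doteq>\<^bsub>M\<^esub> (\<lambda>x. complex_of_real (f x)) \<odot> lam" "\<mu>' \<doteq>\<^bsub>M\<^esub> h \<odot> \<mu>"
  shows "same_structure M lam \<mu> lam' \<mu>'"
  using assms unfolding same_structure_def by blast

lemma same_structure_cong:
  assumes "lam' \<doteq>\<^bsub>M\<^esub> lam''" "\<mu>' \<doteq>\<^bsub>M\<^esub> \<mu>''" "same_structure M lam \<mu> lam' \<mu>'"
  shows "same_structure M lam \<mu> lam'' \<mu>''"
proof -
  obtain f h where *: "smooth_fun M f" "smooth_fun M h" "\<forall>x\<in>points M. f x \<noteq> 0" "\<forall>x\<in>points M. h x \<noteq>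
      0"
    "lam' \<doteq>\<^bsub>M\<^esub> (\<lambda>x. complex_of_real (f x)) \<odot> lam" "\<mu>' \<doteq>\<^bsub>M\<^esub> h \<odot> \<mu>"
    using same_structureE[OF assms(3)] .
  note * = *(1,2) bspec[OF *(3)] bspec[OF *(4)] *(5,6)
  show ?thesis
    by (rule same_structureI[OF *(1-4) form_eq_trans[OF form_eq_sym[OF assms(1)] *(5)]
          form_eq_trans[OF form_eq_sym[OF assms(2)] *(6)]])
qed

lemma same_structure_sym:
  assumes M: "smooth_atlas M" and s: "same_structure M lam \<mu> lam' \<mu>'"
  shows "same_structure M lam' \<mu>' lam \<mu>"
proof -
  obtain f h where *: "smooth_fun M f" "smooth_fun M h" "\<forall>x\<in>points M. f x \<noteq> 0" "\<forall>x\<in>points M. h x \<noteq>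
      0"
    "lam' \<doteq>\<^bsub>M\<^esub> (\<lambda>x. complex_of_real (f x)) \<odot> lam" "\<mu>' \<doteq>\<^bsub>M\<^esub> h \<odot> \<mu>"
    using same_structureE[OF s] .
  note * = *(1,2) bspec[OF *(3)] bspec[OF *(4)] *(5,6)
  show ?thesis
  proof (rule same_structureI[OF smooth_fun_inverse[OF M *(1,3)] smooth_fun_inverse[OF M *(2,4)]])
    show "lam \<doteq>\<^bsub>M\<^esub> (\<lambda>x. complex_of_real (inverse (f x))) \<odot> lam'" "\<mu> \<doteq>\<^bsub>M\<^esub> (\<lambda>x. inverse (h x)) \<odot> \<mu>'"
    proof (rule_tac [!] form_eqI)
      fix c x v assume c: "c \<in> charts M" "x \<in> chart_dom M c"
      have nz: "f x \<noteq> 0" "h x \<noteq> 0" using *(3,4) subsetD[OF dom_subset_points c(2)] by auto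
      show "lam c x v = ((\<lambda>x. complex_of_real (inverse (f x))) \<odot> lam') c x v" "\<mu> c x v = ((\<lambda>x.
          inverse (h x)) \<odot> \<mu>') c x v"
        unfolding form_apply form_eqD[OF *(5) c] form_eqD[OF *(6) c] using nz by simp_all
    qed
  qed (use *(3,4) in auto)
qed

lemma same_structure_trans:
  assumes M: "smooth_atlas M" and s: "same_structure M lam \<mu> lam' \<mu>'" and s': "same_structure M lam'
      \<mu>' lam'' \<mu>''"
  shows "same_structure M lam \<mu> lam'' \<mu>''"
proof -
  obtain f h where *: "smooth_fun M f" "smooth_fun M h" "\<forall>x\<in>points M. f x \<noteq> 0" "\<forall>x\<in>points M. h x \<noteq>
      0"
    "lam' \<doteq>\<^bsub>M\<^esub> (\<lambda>x. complex_of_real (f x)) \<odot> lam" "\<mu>' \<doteq>\<^bsub>M\<^esub> h \<odot> \<mu>"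
    using same_structureE[OF s] .
  note * = *(1,2) bspec[OF *(3)] bspec[OF *(4)] *(5,6)
  obtain f' h' where **: "smooth_fun M f'" "smooth_fun M h'" "\<forall>x\<in>points M. f' x \<noteq> 0" "\<forall>x\<in>points M.
      h' x \<noteq> 0"
    "lam'' \<doteq>\<^bsub>M\<^esub> (\<lambda>x. complex_of_real (f' x)) \<odot> lam'" "\<mu>'' \<doteq>\<^bsub>M\<^esub> h' \<odot> \<mu>'"
    using same_structureE[OF s'] .
  note ** = **(1,2) bspec[OF **(3)] bspec[OF **(4)] **(5,6)
  show ?thesis
  proof (rule same_structureI[OF smooth_fun_mult[OF M **(1) *(1)] smooth_fun_mult[OF M **(2) *(2)]])
    show "lam'' \<doteq>\<^bsub>M\<^esub> (\<lambda>x. complex_of_real (f' x * f x)) \<odot> lam" "\<mu>'' \<doteq>\<^bsub>M\<^esub> (\<lambda>x. h' x * h x) \<odot> \<mu>"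
      by (rule_tac [!] form_eqI)
        (simp_all add: form_apply form_eqD[OF *(5)] form_eqD[OF *(6)] form_eqD[OF **(5)] form_eqD[OF
            **(6)])
  qed (use *(3,4) **(3,4) in auto)
qed

lemma same_structure_pullback:
  assumes M: "smooth_atlas M" and N: "smooth_atlas N" and \<psi>: "smooth_map M N \<psi>" and s:
      "same_structure N lam \<mu> lam' \<mu>'"
  shows "same_structure M (pullback M N \<psi> lam) (pullback M N \<psi> \<mu>) (pullback M N \<psi> lam') (pullback M
      N \<psi> \<mu>')"
proof -
  obtain f h where *: "smooth_fun N f" "smooth_fun N h" "\<forall>x\<in>points N. f x \<noteq> 0" "\<forall>x\<in>points N. h x \<noteq>
      0"
    "lam' \<doteq>\<^bsub>N\<^esub> (\<lambda>x. complex_of_real (f x)) \<odot> lam" "\<mu>' \<doteq>\<^bsub>N\<^esub> h \<odot> \<mu>"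
    using same_structureE[OF s] .
  note * = *(1,2) bspec[OF *(3)] bspec[OF *(4)] *(5,6)
  show ?thesis
    by (rule same_structureI[OF smooth_fun_compose[OF M N \<psi> *(1)] smooth_fun_compose[OF M N \<psi> *(2)]
        *(3,4)
          pullback_cong[OF M N \<psi> *(5), unfolded pullback_smul] pullback_cong[OF M N \<psi> *(6), unfolded
              pullback_smul]])
      (rule smooth_map_points[OF M N \<psi>], assumption)+
qed

text \<open>The factors from \<open>adapted_base\<close> involve the modulus of a shear about which
  no smoothness is recorded. Each factor is smooth as the quotient of components of two smooth
  forms, the denominator being nonzero by the coframe condition.\<close>

lemma adapted_base_same_structure:
  fixes M :: "('a, real^3) mfd"
  assumes M: "smooth_atlas M" and lam: "one_form M lam" "real_form M lam" and \<mu>: "one_form M \<mu>"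
    and cf: "coframe M lam \<mu>" and f: "one_form M \<omega>" "one_form M \<theta>"
    and b: "adapted_base M lam \<mu> \<omega> \<theta> r" and r: "\<And>x. x \<in> points M \<Longrightarrow> r x > 0"
  shows "same_structure M lam \<mu> \<omega> \<theta>"
proof -
  obtain s \<sigma> \<phi> where s: "no_twist_shear M lam \<mu> s" "\<sigma> \<in> {1, -1::real}"
    "\<omega> \<doteq>\<^bsub>M\<^esub> (\<lambda>x. complex_of_real (\<sigma> * cmod (s x))) \<odot> lam"
    "\<theta> \<doteq>\<^bsub>M\<^esub> (\<lambda>x. complex_of_real (r x) * cis (\<phi> x)) \<odot> \<mu>"
    using b unfolding adapted_base_def by (elim conjE exE) (rule that)
  have s0: "s x \<noteq> 0" if "x \<in> points M" for x
    using s(1) that unfolding no_twist_shear_def by blast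
  have ratio: "smooth_fun M g" if o: "one_form M \<alpha>" "one_form M \<beta>" and e: "\<beta> \<doteq>\<^bsub>M\<^esub> g \<odot> \<alpha>"
    and nz: "\<And>c x. c \<in> charts M \<Longrightarrow> x \<in> chart_dom M c \<Longrightarrow> \<exists>v. \<alpha> c x v \<noteq> 0" for g \<alpha> \<beta>
  proof (rule smooth_fun_ratio[OF M])
    fix c x assume c: "c \<in> charts M" "x \<in> chart_dom M c"
    obtain v where v: "\<alpha> c x v \<noteq> 0" using nz[OF c] by blast
    show "\<exists>n d. smooth_on (chart_img M c) n \<and> smooth_on (chart_img M c) d \<and> d (snd c x) \<noteq> 0 \<and>
        (\<forall>y\<in>chart_img M c. g (param M c y) * d y = n y)"
    proof (intro exI conjI ballI)
      show "smooth_on (chart_img M c) (\<lambda>y. \<beta> c (param M c y) v)" by (rule one_form_smooth[OF M o(2)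
          c(1)])
      show "smooth_on (chart_img M c) (\<lambda>y. \<alpha> c (param M c y) v)" by (rule one_form_smooth[OF M o(1)
          c(1)])
      show "\<alpha> c (param M c (snd c x)) v \<noteq> 0" unfolding param_chart[OF M c] by (rule v)
      show "g (param M c y) * \<alpha> c (param M c y) v = \<beta> c (param M c y) v" if "y \<in> chart_img M c" for
          y
        using form_eqD[OF e c(1) param_in_dom[OF that]] by (simp add: form_apply)
    qed
  qed
  have nz: "(\<exists>v. lam c x v \<noteq> 0) \<and> (\<exists>v. \<mu> c x v \<noteq> 0)" if c: "c \<in> charts M" "x \<in> chart_dom M c" for c
      x
  proof -
    obtain e0 e1 e2 where "dual_frame (lam c x) (\<mu> c x) e0 e1 e2" using coframe_dual_frame[OF M lam
        \<mu> cf c] .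
    then show ?thesis unfolding dual_frame_def by (metis zero_neq_one)
  qed
  have F: "smooth_fun M (\<lambda>x. complex_of_real (\<sigma> * cmod (s x)))"
    by (rule ratio[OF lam(1) f(1) s(3)]) (use nz in blast)
  have H: "smooth_fun M (\<lambda>x. complex_of_real (r x) * cis (\<phi> x))"
    by (rule ratio[OF \<mu> f(2) s(4)]) (use nz in blast)
  show ?thesis
  proof (rule same_structureI[OF _ H _ _ s(3,4)])
    show "smooth_fun M (\<lambda>x. \<sigma> * cmod (s x))" using smooth_fun_Re[OF M F] by simp
    show "\<sigma> * cmod (s x) \<noteq> 0" if "x \<in> points M" for x using s0[OF that] s(2) by auto
    show "complex_of_real (r x) * cis (\<phi> x) \<noteq> 0" if "x \<in> points M" for x using r[OF that] by simp
  qed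
qed

lemma invariant_system_of_coframe:
  fixes M :: "('a, real^3) mfd"
  assumes M: "smooth_atlas M" and O: "one_form M lam" "real_form M lam" "one_form M \<mu>" "coframe M
      lam \<mu>"
    and ic: "invariant_coframe M lam \<mu> \<epsilon> \<omega> \<theta> \<Omega> T"
  shows "same_structure M lam \<mu> \<omega> \<theta>"
    and "\<exists>A B A1 B1. \<Omega> \<doteq>\<^bsub>M\<^esub> Omega_form \<omega> \<theta> A B \<and> invariant_system M \<epsilon> \<omega> \<theta> A B T A1 B1"
proof -
  obtain r where r: "smooth_fun M r" "\<forall>x\<in>points M. r x > 0" "\<epsilon> \<in> {1, -1}"
    "struct_eqs M \<omega> \<theta> \<Omega> T (\<lambda>_. \<epsilon>)" "adapted_base M lam \<mu> \<omega> \<theta> r"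
    using invariant_coframeD[OF M O(1-3) ic] .
  note r = r(1) bspec[OF r(2)] r(3-5)
  note D = struct_eqsD[OF r(4)]
  show ss: "same_structure M lam \<mu> \<omega> \<theta>"
    by (rule adapted_base_same_structure[OF M O D(1,3) r(5,2)])
  obtain f h where *: "smooth_fun M f" "smooth_fun M h" "\<forall>x\<in>points M. f x \<noteq> 0" "\<forall>x\<in>points M. h x \<noteq>
      0"
    "\<omega> \<doteq>\<^bsub>M\<^esub> (\<lambda>x. complex_of_real (f x)) \<odot> lam" "\<theta> \<doteq>\<^bsub>M\<^esub> h \<odot> \<mu>"
    using same_structureE[OF ss] .
  note * = *(1,2) bspec[OF *(3)] bspec[OF *(4)] *(5,6)
  have cf: "coframe M \<omega> \<theta>" by (rule coframe_scale[OF O(4) *(5,6)]) (use *(3,4) in auto)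
  obtain A B A1 B1 where "\<Omega> \<doteq>\<^bsub>M\<^esub> Omega_form \<omega> \<theta> A B" "invariant_system M \<epsilon> \<omega> \<theta> A B T A1 B1"
    using struct_eqs_invariant_system[OF M cf r(4,3)] .
  then show "\<exists>A B A1 B1. \<Omega> \<doteq>\<^bsub>M\<^esub> Omega_form \<omega> \<theta> A B \<and> invariant_system M \<epsilon> \<omega> \<theta> A B T A1 B1" by blast
qed

text \<open>With \<open>lam\<close> = \<omega> / f, the form d lam is d(1 / f) \<and> \<omega> and
  contains no \<mu> \<and> \<open>cconj \<mu>\<close> term: the twist is zero. With
  \<open>\<mu>\<close> = \<theta> / h, the shear term of d\<theta> is carried over with the
  displayed factor.\<close>

lemma no_twist_shear_of_system:
  fixes M :: "('a, real^3) mfd"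
  assumes M: "smooth_atlas M" and O: "one_form M lam" "real_form M lam" "one_form M \<mu>" "coframe M
      lam \<mu>"
    and s: "invariant_system M \<epsilon> \<omega> \<theta> A B T A1 B1"
    and f: "smooth_fun M f" "smooth_fun M h" "\<And>x. x \<in> points M \<Longrightarrow> f x \<noteq> 0" "\<And>x. x \<in> points M \<Longrightarrow> h x \<noteq>
        0"
    and e: "\<omega> \<doteq>\<^bsub>M\<^esub> (\<lambda>x. complex_of_real (f x)) \<odot> lam" "\<theta> \<doteq>\<^bsub>M\<^esub> h \<odot> \<mu>"
  shows "no_twist_shear M lam \<mu> (\<lambda>x. cnj (h x) * complex_of_real (f x) / h x)"
proof -
  note D = invariant_systemD[OF s]
  let ?g = "\<lambda>x. complex_of_real (inverse (f x))" and ?k = "\<lambda>x. inverse (h x)"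
  have gr: "smooth_fun M (\<lambda>x. inverse (f x))" by (rule smooth_fun_inverse[OF M f(1,3)])
  have g: "smooth_fun M ?g" by (rule smooth_fun_of_real[OF M gr])
  have k: "smooth_fun M ?k" by (rule smooth_fun_inverse[OF M f(2,4)])
  have nz: "f x \<noteq> 0" "h x \<noteq> 0" if "x \<in> chart_dom M c" for c x
    using f(3,4) subsetD[OF dom_subset_points that] by auto
  have rg: "real_form M (dfun M ?g)"
    unfolding real_form_def by (intro ballI allI dfun_of_real_Reals[OF M gr])
  \<comment> \<open>The differentials of 1 / f and 1 / h are expanded in the coframe in order to
    read off the structure functions \<open>b\<close>, \<open>p\<close> and
    \<open>q\<close>.\<close>
  obtain a0 a1 where a: "dfun M ?g \<doteq>\<^bsub>M\<^esub> (\<lambda>x. complex_of_real (a0 x)) \<odot> lam + a1 \<odot> \<mu> + (\<lambda>x. cnj (a1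
      x)) \<odot> cconj \<mu>"
    using coframe_coeffs_real[OF M O one_form_dfun[OF M g] rg] .
  obtain k0 k1 k2 where kk: "dfun M ?k \<doteq>\<^bsub>M\<^esub> k0 \<odot> lam + k1 \<odot> \<mu> + k2 \<odot> cconj \<mu>"
    using coframe_coeffs[OF M O one_form_dfun[OF M k]] .
  have l: "lam \<doteq>\<^bsub>M\<^esub> ?g \<odot> \<omega>"
    by (rule form_eqI) (simp add: form_apply form_eqD[OF e(1)] nz)
  have m: "\<mu> \<doteq>\<^bsub>M\<^esub> ?k \<odot> \<theta>"
    by (rule form_eqI) (simp add: form_apply form_eqD[OF e(2)] nz)
  let ?b = "\<lambda>x. complex_of_real (f x) * a1 x"
  have e1: "ext_d M lam \<doteq>\<^bsub>M\<^esub> (\<lambda>x. \<i> * complex_of_real 0) \<odot> (\<mu> \<^bold>\<and> cconj \<mu>)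
                      + ?b \<odot> (\<mu> \<^bold>\<and> lam) + (\<lambda>x. cnj (?b x)) \<odot> (cconj \<mu> \<^bold>\<and> lam)"
  proof (rule form_eqI)
    fix c x and v :: "(real^3) \<times> (real^3)" assume c: "c \<in> charts M" "x \<in> chart_dom M c"
    obtain u w :: "real^3" where v: "v = (u, w)" by (rule prod.exhaust)
    show "ext_d M lam c x v = ((\<lambda>x. \<i> * complex_of_real 0) \<odot> (\<mu> \<^bold>\<and> cconj \<mu>)
                      + ?b \<odot> (\<mu> \<^bold>\<and> lam) + (\<lambda>x. cnj (?b x)) \<odot> (cconj \<mu> \<^bold>\<and> lam)) c x v"
      unfolding v form_eqD[OF ext_d_cong[OF M l] c] form_eqD[OF ext_d_smul[OF M g D(2)] c] form_plus
        form_smul form_wedge form_eqD[OF D(11) c] form_zero form_eqD[OF a c] form_eqD[OF e(1) c]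
            form_cconj
      by (simp add: algebra_simps)
  qed
  let ?p = "\<lambda>x. (\<i> * complex_of_real (B x) - complex_of_real (A x)) * cnj (h x) - h x * k2 x"
  let ?q = "\<lambda>x. \<i> * complex_of_real (T x) * complex_of_real (f x) - h x * k0 x"
  have e2: "ext_d M \<mu> \<doteq>\<^bsub>M\<^esub> ?p \<odot> (\<mu> \<^bold>\<and> cconj \<mu>) + ?q \<odot> (\<mu> \<^bold>\<and> lam)
      + (\<lambda>x. cnj (h x) * complex_of_real (f x) / h x) \<odot> (cconj \<mu> \<^bold>\<and> lam)"
  proof (rule form_eqI)
    fix c x and v :: "(real^3) \<times> (real^3)" assume c: "c \<in> charts M" "x \<in> chart_dom M c"
    obtain u w :: "real^3" where v: "v = (u, w)" by (rule prod.exhaust)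
    show "ext_d M \<mu> c x v = (?p \<odot> (\<mu> \<^bold>\<and> cconj \<mu>) + ?q \<odot> (\<mu> \<^bold>\<and> lam)
      + (\<lambda>x. cnj (h x) * complex_of_real (f x) / h x) \<odot> (cconj \<mu> \<^bold>\<and> lam)) c x v"
      unfolding v form_eqD[OF ext_d_cong[OF M m] c] form_eqD[OF ext_d_smul[OF M k D(4)] c] form_plus
        form_smul form_wedge form_eqD[OF D(12) c] form_eqD[OF kk c] form_eqD[OF e(1) c] form_eqD[OF
            e(2) c] form_cconj
      using nz[OF c(2)] by (simp add: field_simps)
  qed
  have "structure_functions M lam \<mu> (\<lambda>_. 0) ?b ?p ?q (\<lambda>x. cnj (h x) * complex_of_real (f x) / h x)"
    unfolding structure_functions_def using e1 e2 by blast
  then show ?thesis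
    unfolding no_twist_shear_def using f(3,4) by (intro exI conjI) (assumption, simp)
qed

text \<open>The data of \<open>adapted_base\<close> come from f and h: \<sigma> is the sign of f,
  the modulus of the shear is that of f, the radius is the modulus of h and \<phi> is its argument.
  The last one forces the restriction to a neighbourhood.\<close>

lemma invariant_coframe_of_system:
  fixes M :: "('a, real^3) mfd"
  assumes M: "smooth_atlas M" and O: "one_form M lam" "real_form M lam" "one_form M \<mu>" "coframe M
      lam \<mu>"
    and s: "invariant_system M \<epsilon> \<omega> \<theta> A B T A1 B1"
    and ss: "same_structure M lam \<mu> \<omega> \<theta>" and x0: "x0 \<in> points M"
  shows "\<exists>V. openin (mtop M) V \<and> x0 \<in> V \<and> invariant_coframe (M\<restriction>V) lam \<mu> \<epsilon> \<omega> \<theta> (Omega_form \<omega> \<theta> A B)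
      T"
proof -
  note D = invariant_systemD[OF s]
  obtain f h where f: "smooth_fun M f" "smooth_fun M h" "\<forall>x\<in>points M. f x \<noteq> 0" "\<forall>x\<in>points M. h x \<noteq>
      0"
    "\<omega> \<doteq>\<^bsub>M\<^esub> (\<lambda>x. complex_of_real (f x)) \<odot> lam" "\<theta> \<doteq>\<^bsub>M\<^esub> h \<odot> \<mu>"
    using same_structureE[OF ss] .
  note f = f(1,2) bspec[OF f(3)] bspec[OF f(4)] f(5,6)
  let ?s = "\<lambda>x. cnj (h x) * complex_of_real (f x) / h x"
  have nts: "no_twist_shear M lam \<mu> ?s" by (rule no_twist_shear_of_system[OF M O s f])
  define \<sigma> where "\<sigma> = sgn (f x0)"
  have \<sigma>: "\<sigma> \<in> {1, -1}" using f(3)[OF x0] by (auto simp: \<sigma>_def sgn_if)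
  \<comment> \<open>Dividing by the value at \<open>x0\<close> makes \<open>w x0 = 1\<close>, which
    lies off the branch cut of the logarithm.\<close>
  define w where "w = (\<lambda>x. h x / h x0)"
  have w: "smooth_fun M w" unfolding w_def
    by (rule smooth_fun_divide[OF M f(2) smooth_fun_const]) (use f(4)[OF x0] in simp)
  have sf: "smooth_fun M (\<lambda>x. \<sigma> * f x)" by (rule smooth_fun_mult[OF M smooth_fun_const f(1)])
  \<comment> \<open>The sign of \<open>f\<close> is constant on \<open>V\<close>, and
    \<open>w\<close> stays off the cut.\<close>
  define V where "V = {x \<in> points M. \<sigma> * f x \<in> {0<..}} \<inter> {x \<in> points M. w x \<in> - \<real>\<^sub>\<le>\<^sub>0}"
  have o: "open (- \<real>\<^sub>\<le>\<^sub>0 :: complex set)" by (simp add: open_Compl)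
  have V: "openin (mtop M) V"
    unfolding V_def by (intro openin_Int smooth_fun_vimage_open[OF M sf] smooth_fun_vimage_open[OF M
        w] o) simp
  have x0V: "x0 \<in> V"
    using x0 f(3,4)[OF x0] by (auto simp: V_def \<sigma>_def w_def sgn_if zero_less_mult_iff)
  note MV = smooth_atlas_submfd[OF M V] and OV = oriented_congruence_submfd[OF M V O]
  \<comment> \<open>A smooth branch of the argument of \<open>h\<close>: that of \<open>w\<close>,
    plus the constant argument of \<open>h x0\<close>.\<close>
  define \<phi> where "\<phi> = (\<lambda>x. Im (Ln (w x)) + Arg (h x0))"
  have wV: "w x \<in> - \<real>\<^sub>\<le>\<^sub>0" if "x \<in> points (M\<restriction>V)" for x using that by (auto simp: V_def)
  have \<phi>: "smooth_fun (M\<restriction>V) \<phi>"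
    unfolding \<phi>_def
    by (intro smooth_fun_add[OF MV] smooth_fun_const smooth_fun_Im[OF MV] smooth_fun_Ln[OF MV]
        smooth_fun_submfd[OF M V w] wV)
  have nh: "h x \<noteq> 0" if "x \<in> points (M\<restriction>V)" for x using that f(4) by auto
  have r: "smooth_fun (M\<restriction>V) (\<lambda>x. cmod (h x))"
    by (rule smooth_fun_cmod[OF MV smooth_fun_submfd[OF M V f(2)] nh])
  have r0: "cmod (h x) > 0" if "x \<in> points (M\<restriction>V)" for x using nh[OF that] by simp
  have pol: "complex_of_real (cmod (h x)) * cis (\<phi> x) = h x" if x: "x \<in> points (M\<restriction>V)" for x
  proof -
    have w0: "w x \<noteq> 0" and h0: "h x0 \<noteq> 0" using wV[OF x] f(4)[OF x0] by auto
    have "w x = complex_of_real (cmod (w x)) * cis (Im (Ln (w x)))"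
      using exp_eq_polar[of "Ln (w x)"] w0 norm_exp_eq_Re[of "Ln (w x)"] by simp
    moreover have "h x0 = complex_of_real (cmod (h x0)) * cis (Arg (h x0))"
      using cis_Arg[OF h0] h0 by (simp add: sgn_eq)
    moreover have "h x = w x * h x0" using h0 by (simp add: w_def)
    ultimately have "h x = complex_of_real (cmod (w x) * cmod (h x0)) * (cis (Im (Ln (w x))) * cis
        (Arg (h x0)))"
      by (metis (no_types, opaque_lifting) mult.assoc mult.left_commute of_real_mult)
    then show ?thesis using h0 by (simp add: \<phi>_def cis_mult w_def norm_divide)
  qed
  have "adapted_base (M\<restriction>V) lam \<mu> \<omega> \<theta> (\<lambda>x. cmod (h x))"
    unfolding adapted_base_def
  proof (intro exI conjI)
    show "no_twist_shear (M\<restriction>V) lam \<mu> ?s" by (rule no_twist_shear_submfd[OF M V O(1,3) nts])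
    show "\<omega> \<doteq>\<^bsub>M\<restriction>V\<^esub> (\<lambda>x. complex_of_real (\<sigma> * cmod (?s x))) \<odot> lam"
    proof (rule form_eq_trans[OF form_eq_submfd[OF M V f(5)] form_eq_smul[OF form_eq_refl]])
      fix x assume x: "x \<in> points (M\<restriction>V)"
      have "\<sigma> * f x > 0" using x by (auto simp: V_def)
      then have "f x = \<sigma> * \<bar>f x\<bar>" using \<sigma> by (auto simp: abs_if)
      moreover have "cmod (?s x) = \<bar>f x\<bar>" using nh[OF x] by (simp add: norm_mult norm_divide)
      ultimately show "complex_of_real (f x) = complex_of_real (\<sigma> * cmod (?s x))" by metis
    qed
    show "\<theta> \<doteq>\<^bsub>M\<restriction>V\<^esub> (\<lambda>x. complex_of_real (cmod (h x)) * cis (\<phi> x)) \<odot> \<mu>"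
      by (rule form_eq_trans[OF form_eq_submfd[OF M V f(6)] form_eq_smul[OF form_eq_refl]]) (simp
          only: pol)
  qed (use \<sigma> \<phi> in auto)
  then have "invariant_coframe (M\<restriction>V) lam \<mu> \<epsilon> \<omega> \<theta> (Omega_form \<omega> \<theta> A B) T"
    by (rule invariant_coframeI[OF MV OV(1-3) struct_eqs_submfd[OF M V
        invariant_system_struct_eqs[OF M s]] _ r r0 D(1)])
  then show ?thesis using V x0V by blast
qed

text \<open>Both factors are 1, so the shear is 1, the phase is 0 and the radius is 1; no shrinking
  occurs and the coframe is invariant on all of \<open>M\<close>.\<close>

lemma invariant_coframe_of_system_self:
  fixes M :: "('a, real^3) mfd"
  assumes M: "smooth_atlas M" and s: "invariant_system M \<epsilon> \<omega> \<theta> A B T A1 B1"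
  shows "special_congruence M \<omega> \<theta>" "invariant_coframe M \<omega> \<theta> \<epsilon> \<omega> \<theta> (Omega_form \<omega> \<theta> A B) T"
proof -
  note D = invariant_systemD[OF s]
  have one: "\<alpha> \<doteq>\<^bsub>M\<^esub> (\<lambda>x. 1) \<odot> \<alpha>" for \<alpha> :: "('a, real^3, real^3) form"
    by (rule form_eqI) (simp add: form_apply)
  have nts: "no_twist_shear M \<omega> \<theta> (\<lambda>x. 1)"
  proof -
    have "no_twist_shear M \<omega> \<theta> (\<lambda>x. cnj 1 * complex_of_real 1 / 1)"
      by (rule no_twist_shear_of_system[OF M D(2-5) s, of "\<lambda>_. 1" "\<lambda>_. 1"]) (simp_all add:
          smooth_fun_const one)
    then show ?thesis by simp
  qed
  have "adapted_base M \<omega> \<theta> \<omega> \<theta> (\<lambda>_. 1)"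
    unfolding adapted_base_def
    by (rule exI[of _ "\<lambda>_. 1"], rule exI[of _ 1], rule exI[of _ "\<lambda>_. 0"])
      (use nts one smooth_fun_const in simp)
  then show ic: "invariant_coframe M \<omega> \<theta> \<epsilon> \<omega> \<theta> (Omega_form \<omega> \<theta> A B) T"
    by (rule invariant_coframeI[OF M D(2-4) invariant_system_struct_eqs[OF M s] _ smooth_fun_const _
        D(1)]) simp
  show "special_congruence M \<omega> \<theta>"
  proof (rule special_congruenceI[OF _ nts])
    show "oriented_congruence M \<omega> \<theta>" unfolding oriented_congruence_def using D by blast
    fix x assume x: "x \<in> points M"
    have "openin (mtop M) (points M)" by (simp add: points_def)
    then show "\<exists>U \<epsilon> \<omega>' \<theta>' \<Omega> T. openin (mtop M) U \<and> x \<in> U \<and> invariant_coframe (M\<restriction>U) \<omega> \<theta> \<epsilon> \<omega>' \<theta>' \<Omega> T"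
      using x ic submfd_points by metis
  qed
qed

text \<open>\<open>structure_functions\<close> is a pointwise condition without any regularity of
  the coefficients. At each point, values may be taken from some local solution and combined by
  choice, since \<open>ext_d\<close> agrees with its restriction to an open set.\<close>

lemma no_twist_shear_glue:
  fixes M :: "('a, 'e::euclidean_space) mfd"
  assumes M: "smooth_atlas M" and lam: "one_form M lam" and \<mu>: "one_form M \<mu>"
    and loc: "\<And>x. x \<in> points M \<Longrightarrow> \<exists>U s. openin (mtop M) U \<and> x \<in> U \<and> no_twist_shear (M\<restriction>U) lam \<mu> s"
  shows "\<exists>s. no_twist_shear M lam \<mu> s"
proof -
  have "\<exists>b p q s. s \<noteq> 0 \<and> (\<forall>c\<in>charts M. x \<in> chart_dom M c \<longrightarrow> (\<forall>v.
      ext_d M lam c x v = b * (\<mu> \<^bold>\<and> lam) c x v + cnj b * (cconj \<mu> \<^bold>\<and> lam) c x v \<and>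
      ext_d M \<mu> c x v = p * (\<mu> \<^bold>\<and> cconj \<mu>) c x v + q * (\<mu> \<^bold>\<and> lam) c x v + s * (cconj \<mu> \<^bold>\<and> lam) c x
          v))"
    if x: "x \<in> points M" for x
  proof -
    obtain U s where U: "openin (mtop M) U" "x \<in> U" and s: "no_twist_shear (M\<restriction>U) lam \<mu> s" using
        loc[OF x] by blast
    obtain a b p q where 1: "structure_functions (M\<restriction>U) lam \<mu> a b p q s" and 2: "\<forall>x\<in>points (M\<restriction>U). a x
        = 0 \<and> s x \<noteq> 0"
      using s unfolding no_twist_shear_def by blast
    have e: "ext_d (M\<restriction>U) lam \<doteq>\<^bsub>M\<restriction>U\<^esub> (\<lambda>x. \<i> * complex_of_real (a x)) \<odot> (\<mu> \<^bold>\<and> cconj \<mu>)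
                      + b \<odot> (\<mu> \<^bold>\<and> lam) + (\<lambda>x. cnj (b x)) \<odot> (cconj \<mu> \<^bold>\<and> lam)"
      "ext_d (M\<restriction>U) \<mu> \<doteq>\<^bsub>M\<restriction>U\<^esub> p \<odot> (\<mu> \<^bold>\<and> cconj \<mu>) + q \<odot> (\<mu> \<^bold>\<and> lam) + s \<odot> (cconj \<mu> \<^bold>\<and> lam)"
      using 1 unfolding structure_functions_def by auto
    have 0: "a x = 0" "s x \<noteq> 0" using 2 x U(2) by auto
    have "ext_d M lam c x v = b x * (\<mu> \<^bold>\<and> lam) c x v + cnj (b x) * (cconj \<mu> \<^bold>\<and> lam) c x v \<and>
      ext_d M \<mu> c x v = p x * (\<mu> \<^bold>\<and> cconj \<mu>) c x v + q x * (\<mu> \<^bold>\<and> lam) c x v + s x * (cconj \<mu> \<^bold>\<and> lam)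
          c x v"
      if c: "c \<in> charts M" "x \<in> chart_dom M c" for c v
    proof -
      have c': "c \<in> charts (M\<restriction>U)" "x \<in> chart_dom (M\<restriction>U) c" using c U(2) by auto
      show ?thesis
        using form_eqD[OF e(1) c', of v] form_eqD[OF e(2) c', of v]
        unfolding ext_d_submfd[OF M U(1) lam c(1) c'(2)] ext_d_submfd[OF M U(1) \<mu> c(1) c'(2)]
            form_plus form_smul 0(1)
        by simp
    qed
    then show ?thesis using 0(2) by blast
  qed
  then obtain b p q s where *: "\<And>x. x \<in> points M \<Longrightarrow> s x \<noteq> 0"
    "\<And>x c v. x \<in> points M \<Longrightarrow> c \<in> charts M \<Longrightarrow> x \<in> chart_dom M c \<Longrightarrow>
      ext_d M lam c x v = b x * (\<mu> \<^bold>\<and> lam) c x v + cnj (b x) * (cconj \<mu> \<^bold>\<and> lam) c x v \<and>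
      ext_d M \<mu> c x v = p x * (\<mu> \<^bold>\<and> cconj \<mu>) c x v + q x * (\<mu> \<^bold>\<and> lam) c x v + s x * (cconj \<mu> \<^bold>\<and> lam)
          c x v"
    by metis
  have "structure_functions M lam \<mu> (\<lambda>_. 0) b p q s"
    unfolding structure_functions_def
    by (intro conjI form_eqI) (simp_all add: *(2)[OF subsetD[OF dom_subset_points]] form_plus
        form_smul)
  then show ?thesis unfolding no_twist_shear_def using *(1) by blast
qed

section \<open>Invariance\<close>

lemma fourth_root_of_unity:
  fixes \<tau> :: complex
  assumes "\<tau> ^ 4 = 1"
  obtains k :: real where "k \<in> {1, -1}" "\<tau> = complex_of_real k \<or> \<tau> = \<i> * complex_of_real k"
proof -
  have "(\<tau>\<^sup>2 - 1) * (\<tau>\<^sup>2 + 1) = 0"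
    using assms by (simp add: algebra_simps power2_eq_square power4_eq_xxxx)
  then consider "\<tau>\<^sup>2 = 1" | "\<tau>\<^sup>2 = \<i>\<^sup>2" by (auto simp: eq_neg_iff_add_eq_0)
  then show thesis
  proof cases
    case 1
    then have "\<tau> = 1 \<or> \<tau> = - 1" by (simp add: power2_eq_1_iff)
    then show thesis using that[of 1] that[of "-1"] by auto
  next
    case 2
    then have "\<tau> = \<i> \<or> \<tau> = - \<i>" by (simp only: power2_eq_iff)
    then show thesis using that[of 1] that[of "-1"] by auto
  qed
qed

lemma ext_d_const_smul:
  assumes M: "smooth_atlas M" and \<alpha>: "one_form M \<alpha>" and e: "\<beta> \<doteq>\<^bsub>M\<^esub> (\<lambda>_. k) \<odot> \<alpha>"
    and c: "c \<in> charts M" "x \<in> chart_dom M c"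
  shows "ext_d M \<beta> c x (u, v) = k * ext_d M \<alpha> c x (u, v)"
  unfolding form_eqD[OF ext_d_cong[OF M e] c] form_eqD[OF ext_d_smul[OF M smooth_fun_const \<alpha>] c]
    form_apply dfun_const[OF M] by simp

lemma dfun_const_multiple:
  assumes M: "smooth_atlas M" and g: "smooth_fun M g" and e: "\<And>y. y \<in> points M \<Longrightarrow> f y = k * g y"
    and c: "c \<in> charts M" "x \<in> chart_dom M c"
  shows "dfun M (\<lambda>x. complex_of_real (f x)) c x v = complex_of_real k * dfun M (\<lambda>x. complex_of_real
      (g x)) c x v"
proof -
  have "dfun M (\<lambda>x. complex_of_real (f x)) c x v = dfun M (\<lambda>x. complex_of_real k * complex_of_real
      (g x)) c x v"
    by (rule form_eqD[OF dfun_cong[OF M] c]) (simp add: e)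
  also have "\<dots> = complex_of_real k * dfun M (\<lambda>x. complex_of_real (g x)) c x v"
    by (rule dfun_linear[OF M bounded_linear_mult_right smooth_fun_of_real[OF M g] c])
  finally show ?thesis .
qed

text \<open>Comparing d\<theta>' with \<tau> d\<theta> on the dual frame transforms A, B and T.
  Differentiating these relations transforms \<open>A1\<close> and \<open>B1\<close>; when \<tau> is
  \<i> or -\<i>, A and B are interchanged up to sign.\<close>

lemma invariant_system_scalars:
  fixes M :: "('a, real^3) mfd"
  assumes M: "smooth_atlas M"
    and s: "invariant_system M \<epsilon> \<omega> \<theta> A B T A1 B1" and s': "invariant_system M \<epsilon>' \<omega>' \<theta>' A' B' T' A1'
        B1'"
    and \<tau>: "\<tau> ^ 4 = 1" and e: "\<omega>' \<doteq>\<^bsub>M\<^esub> (\<lambda>_. \<tau>\<^sup>2) \<odot> \<omega>" "\<theta>' \<doteq>\<^bsub>M\<^esub> (\<lambda>_. \<tau>) \<odot> \<theta>"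
    and x: "x \<in> points M"
  shows "\<epsilon>' = \<epsilon> \<and> complex_of_real (T' x) = \<tau>\<^sup>2 * complex_of_real (T x) \<and>
    Complex (A' x) (B' x) = cnj \<tau> * Complex (A x) (B x) \<and>
    (if \<tau>\<^sup>2 = 1 then A1' x = A1 x \<and> B1' x = B1 x
     else A1' x = Im (B1 x) \<and> B1' x = \<i> * complex_of_real (A1 x) - complex_of_real (Re (B1 x) + \<epsilon> /
         2))"
proof -
  note D = invariant_systemD[OF s] and D' = invariant_systemD[OF s']
  obtain k :: real where k: "k \<in> {1, -1}" and cases: "\<tau> = complex_of_real k \<or> \<tau> = \<i> *
      complex_of_real k"
    using fourth_root_of_unity[OF \<tau>] by blast
  have kk: "k * k = 1" "k \<noteq> 0" using k by auto
  have ckk: "complex_of_real k * complex_of_real k = 1" using kk(1) by (metis of_real_1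
      of_real_mult)
  \<comment> \<open>Established at every point, not only at \<open>x\<close>, because these
    relations are differentiated below.\<close>
  have pt: "(\<tau> = complex_of_real k \<longrightarrow> A' y = k * A y \<and> B' y = k * B y \<and> T' y = T y) \<and>
      (\<tau> = \<i> * complex_of_real k \<longrightarrow> A' y = k * B y \<and> B' y = - k * A y \<and> T' y = - T y)" if y: "y \<in>
          points M" for y
  proof -
    obtain c where c: "c \<in> charts M" "y \<in> chart_dom M c" using atlas_cover[OF M y] by blast
    obtain e0 e1 e2 where d: "dual_frame (\<omega> c y) (\<theta> c y) e0 e1 e2" using coframe_dual_frame[OF M
        D(2-5) c] .
    note fr = d[unfolded dual_frame_def]
    note R = ext_d_const_smul[OF M D(4) e(2) c, unfolded form_eqD[OF D(12) c] form_eqD[OF D'(12) c]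
        form_apply
      form_eqD[OF e(1) c] form_eqD[OF e(2) c]]
    show ?thesis
      using R[of e1 e2] R[of e1 e0] k by (auto simp: fr complex_eq_iff power2_eq_square)
  qed
  obtain c where c: "c \<in> charts M" "x \<in> chart_dom M c" using atlas_cover[OF M x] by blast
  obtain e0 e1 e2 where d: "dual_frame (\<omega> c x) (\<theta> c x) e0 e1 e2" using coframe_dual_frame[OF M
      D(2-5) c] .
  note fr = d[unfolded dual_frame_def]
  note ev = form_eqD[OF D(14) c] form_eqD[OF D(15) c] form_eqD[OF D'(14) c] form_eqD[OF D'(15) c]
      form_apply
    form_eqD[OF e(1) c] form_eqD[OF e(2) c]
  show ?thesis
  proof (rule disjE[OF cases])
    assume t: "\<tau> = complex_of_real k"
    have \<tau>2: "\<tau>\<^sup>2 = 1" using ckk by (simp add: t power2_eq_square)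
    have p: "A' y = k * A y" "B' y = k * B y" "T' y = T y" if "y \<in> points M" for y
      using mp[OF conjunct1[OF pt[OF that]] t] by simp_all
    note RA = dfun_const_multiple[OF M D(6) p(1) c, unfolded ev]
    note RB = dfun_const_multiple[OF M D(7) p(2) c, unfolded ev]
    have b: "B1' x = B1 x"
      using RB[of e1] RB[of e2] k by (auto simp: t fr complex_eq_iff)
    have a: "A1' x = A1 x" "Re (B1' x) + \<epsilon>' / 2 = Re (B1 x) + \<epsilon> / 2"
      using RA[of e1] RA[of e2] k by (auto simp: t fr complex_eq_iff field_simps)
    show ?thesis
      using a b p[OF x] unfolding \<tau>2 by (simp add: t complex_eq_iff)
  next
    assume t: "\<tau> = \<i> * complex_of_real k"
    have \<tau>2: "\<tau>\<^sup>2 = - 1" by (simp add: t power_mult_distrib power2_eq_square[of "complex_of_real k"]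
        ckk)
    have p: "A' y = k * B y" "B' y = - k * A y" "T' y = - T y" if "y \<in> points M" for y
      using mp[OF conjunct2[OF pt[OF that]] t] by simp_all
    note RA = dfun_const_multiple[OF M D(7) p(1) c, unfolded ev]
    note RB = dfun_const_multiple[OF M D(6) p(2) c, unfolded ev]
    have a: "A1' x = Im (B1 x)" "Re (B1' x) + \<epsilon>' / 2 = - Re (B1 x)"
      using RA[of e1] RA[of e2] k by (auto simp: t fr complex_eq_iff field_simps)
    have b: "Re (B1' x) = - (Re (B1 x) + \<epsilon> / 2)" "Im (B1' x) = A1 x"
      using RB[of e1] RB[of e2] k by (auto simp: t fr complex_eq_iff field_simps)
    \<comment> \<open>The equations for dA and for dB each express the real part of
      \<open>B1'\<close>; their comparison yields equality of the signs.\<close>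
    have "\<epsilon>' = \<epsilon>" using a(2) b(1) by simp
    moreover have "- 1 \<noteq> (1::complex)" by (simp add: complex_eq_iff)
    ultimately show ?thesis
      using a(1) b p[OF x] unfolding \<tau>2 by (simp add: t complex_eq_iff)
  qed
qed

text \<open>A constant phase has modulus 1, so it leaves \<theta> \<and>
  \<open>cconj \<theta>\<close> unchanged, and it alters \<Omega> only by a constant multiple of the
  closed form \<omega>. Hence d\<Omega>, and with it the curvature coefficient, is the same.\<close>

lemma struct_eqs_compare:
  fixes M :: "('a, real^3) mfd"
  assumes M: "smooth_atlas M" and cf: "coframe M \<omega> \<theta>"
    and s: "struct_eqs M \<omega> \<theta> \<Omega> T k" and s': "struct_eqs M \<omega>' \<theta>' \<Omega>' T' k'"
    and e: "\<omega>' \<doteq>\<^bsub>M\<^esub> (\<lambda>_. complex_of_real F) \<odot> \<omega>" "\<theta>' \<doteq>\<^bsub>M\<^esub> (\<lambda>_. t) \<odot> \<theta>"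
    and Ft: "F = 1 \<and> t = 1 \<or> F = - 1 \<and> t = \<i>" and x: "x \<in> points M"
  shows "k' x = k x"
proof -
  note D = struct_eqsD[OF s] and D' = struct_eqsD[OF s']
  have O: "\<Omega>' \<doteq>\<^bsub>M\<^esub> \<Omega> + (\<lambda>_. complex_of_real (F - 1)) \<odot> \<omega>"
  proof (rule form_eqI)
    fix c y v assume c: "c \<in> charts M" "y \<in> chart_dom M c"
    obtain e0 e1 e2 where d: "dual_frame (\<omega> c y) (\<theta> c y) e0 e1 e2" using coframe_dual_frame[OF M
        D(1-3) cf c] .
    note fr = d[unfolded dual_frame_def]
    note R = ext_d_const_smul[OF M D(3) e(2) c, unfolded form_eqD[OF D(9) c] form_eqD[OF D'(9) c]
        form_apply
      form_eqD[OF e(1) c] form_eqD[OF e(2) c]]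
    have im: "Im (\<Omega> c y v) = 0" "Im (\<Omega>' c y v) = 0" for v
      using D(5) D'(5) c by (simp_all add: real_form_def complex_is_Real_iff)
    \<comment> \<open>The comparison of d\<theta> alone leaves a multiple of \<theta> in the
      difference undetermined; reality of both connection forms excludes it.\<close>
    have 12: "\<Omega>' c y e1 = \<Omega> c y e1" "\<Omega>' c y e2 = \<Omega> c y e2"
      using R[of e1 e2] Ft im by (auto simp: fr complex_eq_iff)
    have 0: "\<Omega>' c y e0 = \<Omega> c y e0 + complex_of_real (F - 1)"
      using R[of e1 e0] Ft im by (auto simp: fr complex_eq_iff)
    have "complex_of_real (Re (\<omega> c y v)) = \<omega> c y v"
      using D(2) c by (simp add: real_form_def complex_is_Real_iff complex_eq_iff)
    then show "\<Omega>' c y v = (\<Omega> + (\<lambda>_. complex_of_real (F - 1)) \<odot> \<omega>) c y v"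
      unfolding dual_frame_expand[OF d one_form_linear[OF M D'(4) c], of v]
        form_apply dual_frame_expand[OF d one_form_linear[OF M D(4) c], of v] 12 0
      by (simp add: algebra_simps)
  qed
  obtain c where c: "c \<in> charts M" "x \<in> chart_dom M c" using atlas_cover[OF M x] by blast
  obtain e0 e1 e2 where d: "dual_frame (\<omega> c x) (\<theta> c x) e0 e1 e2" using coframe_dual_frame[OF M
      D(1-3) cf c] .
  note fr = d[unfolded dual_frame_def]
  have "ext_d M ((\<lambda>_. complex_of_real (F - 1)) \<odot> \<omega>) c x (e1, e2) = 0"
    unfolding ext_d_const_smul[OF M D(1) form_eq_refl c] form_eqD[OF D(8) c] form_zero by simp
  then have "ext_d M \<Omega>' c x (e1, e2) = ext_d M \<Omega> c x (e1, e2)"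
    unfolding form_eqD[OF ext_d_cong[OF M O] c]
      form_eqD[OF ext_d_add[OF M D(4) one_form_smul[OF M smooth_fun_const D(1)]] c] form_plus by
          simp
  then show ?thesis
    unfolding form_eqD[OF D(10) c] form_eqD[OF D'(10) c] form_apply form_eqD[OF e(2) c]
    using Ft by (auto simp: fr complex_eq_iff)
qed

text \<open>A finite connected set of reals has at most one element.\<close>

lemma constant_sign:
  fixes f :: "'a \<Rightarrow> real"
  assumes M: "smooth_atlas M" and conn: "connected_space (mtop M)" and f: "smooth_fun M f"
    and pm: "\<And>x. x \<in> points M \<Longrightarrow> f x \<in> {1, -1}" and x: "x \<in> points M" "y \<in> points M"
  shows "f x = f y"
proof -
  have "connectedin euclidean (f ` topspace (mtop M))"
    using connectedin_continuous_map_image[OF smooth_fun_continuous[OF M f]] conn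
    by (simp add: connectedin_topspace)
  then have "connected (f ` points M)" by (simp add: points_def)
  moreover have "finite (f ` points M)" by (rule finite_subset[of _ "{1, -1}"]) (use pm in auto)
  ultimately have "f ` points M = {} \<or> (\<exists>a. f ` points M = {a})"
    using connected_finite_iff_sing by blast
  then show ?thesis using x by (metis empty_iff imageI singletonD)
qed

text \<open>Pointwise algebra restricts the factors to finitely many values; connectedness then
  makes the choice the same at all points.\<close>

lemma same_structure_systems:
  fixes M :: "('a, real^3) mfd"
  assumes M: "smooth_atlas M" and conn: "connected_space (mtop M)"
    and s: "invariant_system M \<epsilon> \<omega> \<theta> A B T A1 B1" and s': "invariant_system M \<epsilon>' \<omega>' \<theta>' A' B' T' A1'
        B1'"
    and ss: "same_structure M \<omega> \<theta> \<omega>' \<theta>'"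
  shows "\<exists>\<tau>. \<tau> ^ 4 = 1 \<and> \<omega>' \<doteq>\<^bsub>M\<^esub> (\<lambda>_. \<tau>\<^sup>2) \<odot> \<omega> \<and> \<theta>' \<doteq>\<^bsub>M\<^esub> (\<lambda>_. \<tau>) \<odot> \<theta>"
proof (cases "points M = {}")
  case True
  then have "chart_dom M c = {}" for c using dom_subset_points[of M c] by blast
  \<comment> \<open>Without points every identity of forms is vacuous.\<close>
  then show ?thesis by (intro exI[of _ 1]) (simp add: form_eq_def)
next
  case False
  then obtain x0 where x0: "x0 \<in> points M" by blast
  note D = invariant_systemD[OF s] and D' = invariant_systemD[OF s']
  obtain f h where *: "smooth_fun M f" "smooth_fun M h" "\<forall>x\<in>points M. f x \<noteq> 0" "\<forall>x\<in>points M. h x \<noteq>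
      0"
    "\<omega>' \<doteq>\<^bsub>M\<^esub> (\<lambda>x. complex_of_real (f x)) \<odot> \<omega>" "\<theta>' \<doteq>\<^bsub>M\<^esub> h \<odot> \<theta>"
    using same_structureE[OF ss] .
  note * = *(1,2) bspec[OF *(3)] bspec[OF *(4)] *(5,6)
  have hf: "h x = cnj (h x) * complex_of_real (f x)" if x: "x \<in> points M" for x
  proof -
    obtain c where c: "c \<in> charts M" "x \<in> chart_dom M c" using atlas_cover[OF M x] by blast
    obtain e0 e1 e2 where d: "dual_frame (\<omega> c x) (\<theta> c x) e0 e1 e2" using coframe_dual_frame[OF M
        D(2-5) c] .
    note fr = d[unfolded dual_frame_def]
    have R: "ext_d M \<theta>' c x v = (dfun M h \<^bold>\<and> \<theta> + h \<odot> ext_d M \<theta>) c x v" for v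
      unfolding form_eqD[OF ext_d_cong[OF M *(6)] c] form_eqD[OF ext_d_smul[OF M *(2) D(4)] c] ..
    note R' = R[unfolded form_plus form_smul form_eqD[OF D'(12) c] form_eqD[OF D(12) c]]
    note R1 = R'[of "(e1, e0)", unfolded form_apply form_eqD[OF *(5) c] form_eqD[OF *(6) c],
        simplified fr]
    note R2 = R'[of "(e2, e0)", unfolded form_apply form_eqD[OF *(5) c] form_eqD[OF *(6) c],
        simplified fr]
    \<comment> \<open>Real and imaginary parts of the components on \<open>(e1, e0)\<close> and
      \<open>(e2, e0)\<close>. Combining them in pairs eliminates \<open>dfun M h c x e0\<close>
      together with \<open>T\<close> and \<open>T'\<close>.\<close>
    have "f x * Re (h x) - T' x * (f x * Im (h x)) = Re (h x) - T x * Im (h x) - Re (dfun M h c x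
        e0)"
      "T' x * (f x * Re (h x)) - f x * Im (h x) = Im (h x) + T x * Re (h x) - Im (dfun M h c x e0)"
      using R1 by (simp_all add: complex_eq_iff algebra_simps)
    moreover have "- T' x * (f x * Re (h x)) - f x * Im (h x) = Im (dfun M h c x e0) - T x * Re (h
        x) + Im (h x)"
      "- T' x * (f x * Im (h x)) - f x * Re (h x) = - Re (dfun M h c x e0) - T x * Im (h x) - Re (h
          x)"
      using R2 by (simp_all add: complex_eq_iff algebra_simps)
    ultimately have "Re (h x) = f x * Re (h x)" "Im (h x) = - (f x * Im (h x))" by linarith+
    then show ?thesis by (intro complex_eqI) (simp_all add: mult.commute)
  qed
  have f1: "f x \<in> {1, -1}" if x: "x \<in> points M" for x
  proof -
    have "cmod (h x) = cmod (h x) * \<bar>f x\<bar>" using arg_cong[OF hf[OF x], of cmod] by (simp add: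
        norm_mult)
    then have "\<bar>f x\<bar> = 1" using *(4)[OF x] by simp
    then show ?thesis by auto
  qed
  define F where "F = f x0"
  have F: "f x = F" if "x \<in> points M" for x
    unfolding F_def by (rule constant_sign[OF M conn *(1) f1 that x0])
  \<comment> \<open>From h = F cnj h, the factor is real for F = 1 and purely imaginary for F = -1;
    \<open>t\<close> is the constant phase and \<open>R\<close> the real remainder.\<close>
  define t where "t = (if F = 1 then 1 else \<i>)"
  define R where "R = (\<lambda>x. if F = 1 then Re (h x) else Im (h x))"
  have Ft: "F = 1 \<and> t = 1 \<or> F = - 1 \<and> t = \<i>" using f1[OF x0] by (auto simp: t_def F_def)
  have hR: "h x = t * complex_of_real (R x)" if x: "x \<in> points M" for x
    using hf[OF x] Ft unfolding F[OF x] R_def by (auto simp: complex_eq_iff)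
  have R: "smooth_fun M R"
    unfolding R_def using smooth_fun_Re[OF M *(2)] smooth_fun_Im[OF M *(2)] by (cases "F = 1") auto
  have R0: "R x \<noteq> 0" if x: "x \<in> points M" for x using hR[OF x] *(4)[OF x] by auto
  let ?\<theta> = "(\<lambda>x. complex_of_real (R x)) \<odot> \<theta>"
  have e1: "\<omega>' \<doteq>\<^bsub>M\<^esub> (\<lambda>_. complex_of_real F) \<odot> \<omega>"
    by (rule form_eq_trans[OF *(5) form_eq_smul[OF form_eq_refl]]) (simp add: F)
  have e2: "\<theta>' \<doteq>\<^bsub>M\<^esub> (\<lambda>_. t) \<odot> ?\<theta>"
    by (rule form_eq_trans[OF *(6)], rule form_eqI) (simp add: form_apply hR subsetD[OF
        dom_subset_points])
  have cf: "coframe M \<omega> ?\<theta>"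
    by (rule coframe_scale[OF D(5), of _ "\<lambda>_. 1" _ "\<lambda>x. complex_of_real (R x)"])
      (simp_all add: form_eq_def form_apply R0)
  have RR: "(R x)\<^sup>2 = 1" if x: "x \<in> points M" for x
  proof -
    \<comment> \<open>Rescaling by \<open>R\<close> turns the constant \<open>\<epsilon>\<close>
      into a quotient by the square of \<open>R\<close>, and the phase \<open>t\<close> preserves
      it. As both constants are signs, that square is 1.\<close>
    have eq: "\<epsilon>' = \<epsilon> / (R x)\<^sup>2"
      using struct_eqs_compare[OF M cf struct_eqs_scale[OF M invariant_system_struct_eqs[OF M s] R
          R0]
          invariant_system_struct_eqs[OF M s'] e1 e2 Ft x] by simp
    have pos: "(R x)\<^sup>2 > 0" using R0[OF x] by simp
    then have "\<bar>\<epsilon>'\<bar> * (R x)\<^sup>2 = \<bar>\<epsilon>\<bar>" unfolding eq by (simp add: abs_divide)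
    then show ?thesis using D(1) D'(1) by auto
  qed
  have R1: "R x \<in> {1, -1}" if x: "x \<in> points M" for x using RR[OF x] by (simp add: power2_eq_1_iff)
  have Rc: "R x = R x0" if "x \<in> points M" for x by (rule constant_sign[OF M conn R R1 that x0])
  \<comment> \<open>Connectedness makes \<open>R\<close> constant, so h itself is the constant
    \<open>\<tau>\<close>; its square is F because \<open>R x0\<close> is a sign.\<close>
  define \<tau> where "\<tau> = t * complex_of_real (R x0)"
  have t2: "\<tau>\<^sup>2 = complex_of_real F" using R1[OF x0] Ft by (auto simp: \<tau>_def power2_eq_square)
  have "\<tau> ^ 4 = (\<tau>\<^sup>2)\<^sup>2" by simp
  also have "\<dots> = 1" unfolding t2 using Ft by auto
  finally have "\<tau> ^ 4 = 1" .
  moreover have "\<omega>' \<doteq>\<^bsub>M\<^esub> (\<lambda>_. \<tau>\<^sup>2) \<odot> \<omega>" using e1 by (simp add: t2)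
  moreover have "\<theta>' \<doteq>\<^bsub>M\<^esub> (\<lambda>_. \<tau>) \<odot> \<theta>"
    by (rule form_eq_trans[OF *(6) form_eq_smul[OF form_eq_refl]]) (metis hR Rc \<tau>_def)
  ultimately show ?thesis by blast
qed

lemma diffeomorphismD:
  assumes "diffeomorphism M N \<psi>"
  defines "\<eta> \<equiv> inv_into (points M) \<psi>"
  shows "smooth_map M N \<psi>" "smooth_map N M \<eta>" "\<And>x. x \<in> points M \<Longrightarrow> \<eta> (\<psi> x) = x"
    "\<And>y. y \<in> points N \<Longrightarrow> \<psi> (\<eta> y) = y"
proof -
  have b: "bij_betw \<psi> (points M) (points N)" using assms(1) unfolding diffeomorphism_def by blast
  show "smooth_map M N \<psi>" "smooth_map N M \<eta>" using assms(1) unfolding diffeomorphism_def \<eta>_def by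
      auto
  show "\<eta> (\<psi> x) = x" if "x \<in> points M" for x
    unfolding \<eta>_def by (rule inv_into_f_f[OF bij_betw_imp_inj_on[OF b] that])
  show "\<psi> (\<eta> y) = y" if "y \<in> points N" for y
    unfolding \<eta>_def by (rule f_inv_into_f) (use b that in \<open>simp add: bij_betw_def\<close>)
qed

text \<open>The square of a fourth root of unity is a sign, hence an admissible real factor for
  \<open>\<omega>\<close>.\<close>

lemma same_structure_root:
  assumes "\<tau> ^ 4 = 1" "\<omega>' \<doteq>\<^bsub>M\<^esub> (\<lambda>_. \<tau>\<^sup>2) \<odot> \<omega>" "\<theta>' \<doteq>\<^bsub>M\<^esub> (\<lambda>_. \<tau>) \<odot> \<theta>"
  shows "same_structure M \<omega> \<theta> \<omega>' \<theta>'"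
proof -
  obtain k :: real where k: "k \<in> {1, -1}" "\<tau> = complex_of_real k \<or> \<tau> = \<i> * complex_of_real k"
    using fourth_root_of_unity[OF assms(1)] by blast
  have "complex_of_real (Re (\<tau>\<^sup>2)) = \<tau>\<^sup>2" using k by (auto simp: complex_eq_iff power2_eq_square)
  moreover have "\<tau> \<noteq> 0" using assms(1) by auto
  ultimately have "\<omega>' \<doteq>\<^bsub>M\<^esub> (\<lambda>_. complex_of_real (Re (\<tau>\<^sup>2))) \<odot> \<omega>" "Re (\<tau>\<^sup>2) \<noteq> 0" "\<tau> \<noteq> 0"
    using assms(2) by (simp, metis of_real_0 power_not_zero, simp)
  then show ?thesis by (intro same_structureI[OF smooth_fun_const smooth_fun_const _ _ _ assms(3)])
      auto
qed

text \<open>\<open>same_structure\<close> is an equivalence relation stable under pullback, so on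
  both sides the given pair may be replaced by the invariant forms. The question becomes when two
  solutions of the system on \<open>M\<close> define the same structure.\<close>

lemma cong_equivalence_iff:
  fixes M :: "('a, real^3) mfd" and N :: "('b, real^3) mfd"
  assumes M: "smooth_atlas M" and N: "smooth_atlas N" and conn: "connected_space (mtop M)"
    and O: "one_form M lam" "real_form M lam" "one_form M \<mu>" "coframe M lam \<mu>"
    and O': "one_form N lam'" "real_form N lam'" "one_form N \<mu>'" "coframe N lam' \<mu>'"
    and ic: "invariant_coframe M lam \<mu> \<epsilon> \<omega> \<theta> \<Omega> T" and ic': "invariant_coframe N lam' \<mu>' \<epsilon>' \<omega>' \<theta>' \<Omega>'
        T'"
    and \<psi>: "diffeomorphism M N \<psi>"
  shows "cong_equivalence M lam \<mu> N lam' \<mu>' \<psi> \<longleftrightarrow> (\<exists>\<tau>::complex. \<tau> ^ 4 = 1 \<and>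
           pullback M N \<psi> \<omega>' \<doteq>\<^bsub>M\<^esub> (\<lambda>_. \<tau>\<^sup>2) \<odot> \<omega> \<and> pullback M N \<psi> \<theta>' \<doteq>\<^bsub>M\<^esub> (\<lambda>_. \<tau>) \<odot> \<theta>)" (is "_ \<longleftrightarrow> ?R")
proof -
  note dD = diffeomorphismD[OF \<psi>]
  let ?p = "pullback M N \<psi>"
  have S: "same_structure M lam \<mu> \<omega> \<theta>" by (rule invariant_system_of_coframe(1)[OF M O ic])
  have S': "same_structure M (?p lam') (?p \<mu>') (?p \<omega>') (?p \<theta>')"
    by (rule same_structure_pullback[OF M N dD(1) invariant_system_of_coframe(1)[OF N O' ic']])
  obtain A B A1 B1 where s: "invariant_system M \<epsilon> \<omega> \<theta> A B T A1 B1"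
    using invariant_system_of_coframe(2)[OF M O ic] by blast
  obtain A' B' A1' B1' where s': "invariant_system N \<epsilon>' \<omega>' \<theta>' A' B' T' A1' B1'"
    using invariant_system_of_coframe(2)[OF N O' ic'] by blast
  note ps = invariant_system_pullback[OF M N dD s']
  have "cong_equivalence M lam \<mu> N lam' \<mu>' \<psi> \<longleftrightarrow> same_structure M lam \<mu> (?p lam') (?p \<mu>')"
    using \<psi> by (simp add: cong_equivalence_def)
  also have "\<dots> \<longleftrightarrow> same_structure M \<omega> \<theta> (?p \<omega>') (?p \<theta>')"
    using same_structure_trans[OF M] same_structure_sym[OF M] S S' by meson
  also have "\<dots> \<longleftrightarrow> ?R"
    using same_structure_systems[OF M conn s ps] same_structure_root[of _ "?p \<omega>'" M \<omega> "?p \<theta>'" \<theta>] by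
        blast
  finally show ?thesis .
qed

text \<open>The function \<open>inv_into\<close> of the identity is the identity only on the points
  of \<open>M\<close>, so continuity and smoothness are transferred by congruence there.\<close>

lemma diffeomorphism_ident:
  assumes M: "smooth_atlas M"
  shows "diffeomorphism M M (\<lambda>x. x)"
proof -
  have i: "inv_into (points M) (\<lambda>x. x) x = x" if "x \<in> points M" for x
    using inv_into_f_f[of "\<lambda>x. x" "points M" x] that by (simp add: inj_on_def)
  have "smooth_map M M (inv_into (points M) (\<lambda>x. x))"
    unfolding smooth_map_def
  proof (intro conjI ballI)
    show "continuous_map (mtop M) (mtop M) (inv_into (points M) (\<lambda>x. x))"
      by (rule continuous_map_eq[of _ _ "\<lambda>x. x"]) (use i in \<open>simp_all add: points_def\<close>)
    fix c c' assume c: "c \<in> charts M" "c' \<in> charts M"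
    have ic: "inv_into (points M) (\<lambda>x. x) x = x" if "x \<in> chart_dom M c" for x
      by (rule i[OF subsetD[OF dom_subset_points that]])
    have eq: "{x \<in> chart_dom M c. inv_into (points M) (\<lambda>x. x) x \<in> chart_dom M c'} = chart_dom M c \<inter>
        chart_dom M c'"
      using ic by auto
    have "open (snd c ` (chart_dom M c \<inter> chart_dom M c'))"
      by (rule chart_image_open[OF M c(1) dom_open[OF M c(2)]])
    then show "smooth_on (snd c ` {x \<in> chart_dom M c. inv_into (points M) (\<lambda>x. x) x \<in> chart_dom M
        c'})
        (snd c' \<circ> inv_into (points M) (\<lambda>x. x) \<circ> param M c)"
      unfolding eq
      by (rule smooth_on_cong[OF _ _ transition_smooth[OF M c]])
        (auto simp: param_chart[OF M c(1)] ic)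
  qed
  then show ?thesis
    unfolding diffeomorphism_def using smooth_map_ident[OF M] by (simp add: bij_betw_def inj_on_def)
qed

lemma pullback_ident:
  fixes M :: "('a, 'e::euclidean_space) mfd"
  assumes M: "smooth_atlas M" and \<alpha>: "one_form M \<alpha>"
  shows "pullback M M (\<lambda>x. x) \<alpha> \<doteq>\<^bsub>M\<^esub> \<alpha>"
  using pullback_inclusion[OF M _ \<alpha>, of "points M"] by (simp add: submfd_points) (simp add:
      points_def)

text \<open>From left to right the model is the open submanifold with its own invariant forms.
  Conversely the model's solution is pulled back and gives local invariant coframes; the local
  shears are glued to the global one that the class requires.\<close>

lemma special_congruence_iff:
  fixes M :: "('a, real^3) mfd"
  assumes M: "smooth_manifold M"
  shows "special_congruence M lam \<mu> \<longleftrightarrow> oriented_congruence M lam \<mu> \<and>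
       (\<forall>x\<in>points M. \<exists>U (M' :: ('a, real^3) mfd) \<psi> \<epsilon> \<omega> \<omega>1 A B T0 A1 B1.
          openin (mtop M) U \<and> x \<in> U \<and> smooth_manifold M' \<and>
          invariant_system M' \<epsilon> \<omega> \<omega>1 A B T0 A1 B1 \<and>
          cong_equivalence (M\<restriction>U) lam \<mu> M' \<omega> \<omega>1 \<psi>)" (is "_ \<longleftrightarrow> ?oc \<and> (\<forall>x\<in>points M. ?E x)")
proof (intro iffI conjI ballI)
  note MA = smooth_manifold_atlas[OF M]
  assume sp: "special_congruence M lam \<mu>"
  show oc: ?oc using sp unfolding special_congruence_def by blast
  fix x assume x: "x \<in> points M"
  obtain U \<epsilon> \<omega> \<theta> \<Omega> T where U: "openin (mtop M) U" "x \<in> U" and ic: "invariant_coframe (M\<restriction>U) lam \<mu> \<epsilon> \<omega>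
      \<theta> \<Omega> T"
    using special_congruence_local[OF MA sp x] by blast
  note MU = smooth_atlas_submfd[OF MA U(1)] and OU = oriented_congruence_submfd[OF MA U(1)
      oriented_congruenceD[OF oc]]
  obtain A B A1 B1 where s: "invariant_system (M\<restriction>U) \<epsilon> \<omega> \<theta> A B T A1 B1"
    using invariant_system_of_coframe(2)[OF MU OU ic] by blast
  note D = invariant_systemD[OF s]
  \<comment> \<open>The witness for the equivalence is the identity map of the open
    submanifold.\<close>
  have "cong_equivalence (M\<restriction>U) lam \<mu> (M\<restriction>U) \<omega> \<theta> (\<lambda>x. x)"
    unfolding cong_equivalence_def
    using diffeomorphism_ident[OF MU]
      same_structure_cong[OF form_eq_sym[OF pullback_ident[OF MU D(2)]] form_eq_sym[OF
          pullback_ident[OF MU D(4)]]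
        invariant_system_of_coframe(1)[OF MU OU ic]] by blast
  then show "?E x" using U s smooth_manifold_submfd[OF M U(1)] by blast
next
  note MA = smooth_manifold_atlas[OF M]
  assume *: "?oc \<and> (\<forall>x\<in>points M. ?E x)"
  then have oc: ?oc by blast
  note O = oriented_congruenceD[OF oc]
  have loc: "(\<exists>U s. openin (mtop M) U \<and> x \<in> U \<and> no_twist_shear (M\<restriction>U) lam \<mu> s) \<and>
      (\<exists>V \<epsilon> \<omega> \<theta> \<Omega> T. openin (mtop M) V \<and> x \<in> V \<and> invariant_coframe (M\<restriction>V) lam \<mu> \<epsilon> \<omega> \<theta> \<Omega> T)"
    if x: "x \<in> points M" for x
  proof -
    obtain U \<psi> \<epsilon> \<omega> \<theta> A B T A1 B1 and M' :: "('a, real^3) mfd" where U: "openin (mtop M) U" "x \<in> U"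
      and M': "smooth_manifold M'" and s: "invariant_system M' \<epsilon> \<omega> \<theta> A B T A1 B1"
      and ce: "cong_equivalence (M\<restriction>U) lam \<mu> M' \<omega> \<theta> \<psi>"
      using bspec[OF conjunct2[OF *] x] by (elim exE conjE) (rule that)
    note MU = smooth_atlas_submfd[OF MA U(1)] and OU = oriented_congruence_submfd[OF MA U(1) O]
    let ?\<omega> = "pullback (M\<restriction>U) M' \<psi> \<omega>" and ?\<theta> = "pullback (M\<restriction>U) M' \<psi> \<theta>"
    have \<psi>: "diffeomorphism (M\<restriction>U) M' \<psi>" and ss: "same_structure (M\<restriction>U) lam \<mu> ?\<omega> ?\<theta>"
      using ce unfolding cong_equivalence_def by auto
    have ps: "invariant_system (M\<restriction>U) \<epsilon> ?\<omega> ?\<theta> (\<lambda>x. A (\<psi> x)) (\<lambda>x. B (\<psi> x)) (\<lambda>x. T (\<psi> x))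
        (\<lambda>x. A1 (\<psi> x)) (\<lambda>x. B1 (\<psi> x))"
      by (rule invariant_system_pullback[OF MU smooth_manifold_atlas[OF M'] diffeomorphismD[OF \<psi>]
          s])
    have xU: "x \<in> points (M\<restriction>U)" using x U(2) by simp
    obtain V where V: "openin (mtop (M\<restriction>U)) V" "x \<in> V" and ic: "invariant_coframe (M\<restriction>U\<restriction>V) lam \<mu> \<epsilon> ?\<omega>
        ?\<theta>
        (Omega_form ?\<omega> ?\<theta> (\<lambda>x. A (\<psi> x)) (\<lambda>x. B (\<psi> x))) (\<lambda>x. T (\<psi> x))"
      using invariant_coframe_of_system[OF MU OU ps ss xU] by (elim exE conjE) (rule that)
    obtain f h where f: "smooth_fun (M\<restriction>U) f" "smooth_fun (M\<restriction>U) h" "\<forall>x\<in>points (M\<restriction>U). f x \<noteq> 0"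
        "\<forall>x\<in>points (M\<restriction>U). h x \<noteq> 0"
      "?\<omega> \<doteq>\<^bsub>M\<restriction>U\<^esub> (\<lambda>x. complex_of_real (f x)) \<odot> lam" "?\<theta> \<doteq>\<^bsub>M\<restriction>U\<^esub> h \<odot> \<mu>"
      using same_structureE[OF ss] .
    have nts: "no_twist_shear (M\<restriction>U) lam \<mu> (\<lambda>x. cnj (h x) * complex_of_real (f x) / h x)"
      by (rule no_twist_shear_of_system[OF MU OU ps f(1,2) bspec[OF f(3)] bspec[OF f(4)] f(5,6)])
    have "V \<subseteq> U" using openin_imp_subset[of "mtop M" U V] V(1) by simp
    then have eq: "M\<restriction>U\<restriction>V = M\<restriction>V" by (simp add: submfd_submfd Int_absorb1)
    have V': "openin (mtop M) V" using V(1) U(1) by (simp add: openin_open_subtopology)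
    show ?thesis
    proof
      show "\<exists>U s. openin (mtop M) U \<and> x \<in> U \<and> no_twist_shear (M\<restriction>U) lam \<mu> s"
        by (intro exI conjI) (rule U nts)+
      show "\<exists>V \<epsilon> \<omega> \<theta> \<Omega> T. openin (mtop M) V \<and> x \<in> V \<and> invariant_coframe (M\<restriction>V) lam \<mu> \<epsilon> \<omega> \<theta> \<Omega> T"
        by (intro exI conjI) (rule V' V(2) ic[unfolded eq])+
    qed
  qed
  have "\<exists>s. no_twist_shear M lam \<mu> s"
    by (rule no_twist_shear_glue[OF MA O(1,3) conjunct1[OF loc]])
  then obtain s where s: "no_twist_shear M lam \<mu> s" ..
  show "special_congruence M lam \<mu>"
    by (rule special_congruenceI[OF oc s conjunct2[OF loc]])
qed

lemma special_congruence_oriented: "special_congruence M lam \<mu> \<Longrightarrow> oriented_congruence M lam \<mu>"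
  unfolding special_congruence_def by blast

theorem theorem8p6:
  fixes M :: "('a, real^3) mfd" and N :: "('b, real^3) mfd"
  assumes "smooth_manifold M" and "smooth_manifold N"
  shows "
    \<comment> \<open>every structure of the class has, near each point, invariant forms obtained from \<open>K0 = \<epsilon>\<close>\<close>
    (\<forall>lam \<mu>. special_congruence M lam \<mu> \<longrightarrow>
       (\<forall>x\<in>points M. \<exists>U \<epsilon> \<omega> \<omega>1 \<Omega> T0. openin (mtop M) U \<and> x \<in> U \<and>
          invariant_coframe (M\<restriction>U) lam \<mu> \<epsilon> \<omega> \<omega>1 \<Omega> T0)) \<and>
    \<comment> \<open>they represent the structure and satisfy the system\<close>
    (\<forall>lam \<mu> U \<epsilon> \<omega> \<omega>1 \<Omega> T0. special_congruence M lam \<mu> \<and> openin (mtop M) U \<and>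
       invariant_coframe (M\<restriction>U) lam \<mu> \<epsilon> \<omega> \<omega>1 \<Omega> T0 \<longrightarrow>
       same_structure (M\<restriction>U) lam \<mu> \<omega> \<omega>1 \<and>
       (\<exists>A B A1 B1. \<Omega> \<doteq>\<^bsub>M\<restriction>U\<^esub> Omega_form \<omega> \<omega>1 A B \<and>
          invariant_system (M\<restriction>U) \<epsilon> \<omega> \<omega>1 A B T0 A1 B1)) \<and>
    \<comment> \<open>every solution of the system represents a structure of the class,
       and is the invariant coframe of that structure\<close>
    (\<forall>\<epsilon> \<omega> \<omega>1 A B T0 A1 B1. invariant_system M \<epsilon> \<omega> \<omega>1 A B T0 A1 B1 \<longrightarrow>
       special_congruence M \<omega> \<omega>1 \<and>
       invariant_coframe M \<omega> \<omega>1 \<epsilon> \<omega> \<omega>1 (Omega_form \<omega> \<omega>1 A B) T0) \<and>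
    \<comment> \<open>up to local equivalence the structures of the class are those represented by solutions\<close>
    (\<forall>lam \<mu>. special_congruence M lam \<mu> \<longleftrightarrow> oriented_congruence M lam \<mu> \<and>
       (\<forall>x\<in>points M. \<exists>U (M' :: ('a, real^3) mfd) \<psi> \<epsilon> \<omega> \<omega>1 A B T0 A1 B1.
          openin (mtop M) U \<and> x \<in> U \<and> smooth_manifold M' \<and>
          invariant_system M' \<epsilon> \<omega> \<omega>1 A B T0 A1 B1 \<and>
          cong_equivalence (M\<restriction>U) lam \<mu> M' \<omega> \<omega>1 \<psi>)) \<and>
    \<comment> \<open>invariance: local equivalences are the local diffeomorphisms matching the invariant forms
       up to the discrete choices, \<open>\<tau> = \<plusminus>1, \<plusminus>\<i>\<close>\<close>
    (\<forall>lam \<mu> lam' \<mu>' U V \<psi> \<epsilon> \<omega> \<omega>1 \<Omega> T0 \<epsilon>' \<omega>' \<omega>1' \<Omega>' T0'.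
       special_congruence M lam \<mu> \<and> special_congruence N lam' \<mu>' \<and>
       openin (mtop M) U \<and> connectedin (mtop M) U \<and> openin (mtop N) V \<and>
       invariant_coframe (M\<restriction>U) lam \<mu> \<epsilon> \<omega> \<omega>1 \<Omega> T0 \<and>
       invariant_coframe (N\<restriction>V) lam' \<mu>' \<epsilon>' \<omega>' \<omega>1' \<Omega>' T0' \<and>
       diffeomorphism (M\<restriction>U) (N\<restriction>V) \<psi> \<longrightarrow>
       (cong_equivalence (M\<restriction>U) lam \<mu> (N\<restriction>V) lam' \<mu>' \<psi> \<longleftrightarrow>
        (\<exists>\<tau>::complex. \<tau> ^ 4 = 1 \<and>
           pullback (M\<restriction>U) (N\<restriction>V) \<psi> \<omega>' \<doteq>\<^bsub>M\<restriction>U\<^esub> (\<lambda>_. \<tau>\<^sup>2) \<odot> \<omega> \<and>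
           pullback (M\<restriction>U) (N\<restriction>V) \<psi> \<omega>1' \<doteq>\<^bsub>M\<restriction>U\<^esub> (\<lambda>_. \<tau>) \<odot> \<omega>1))) \<and>
    \<comment> \<open>the corresponding invariance of the scalars\<close>
    (\<forall>U V \<psi> \<tau> \<epsilon> \<omega> \<omega>1 A B T0 A1 B1 \<epsilon>' \<omega>' \<omega>1' A' B' T0' A1' B1'.
       openin (mtop M) U \<and> openin (mtop N) V \<and>
       invariant_system (M\<restriction>U) \<epsilon> \<omega> \<omega>1 A B T0 A1 B1 \<and>
       invariant_system (N\<restriction>V) \<epsilon>' \<omega>' \<omega>1' A' B' T0' A1' B1' \<and>
       diffeomorphism (M\<restriction>U) (N\<restriction>V) \<psi> \<and> \<tau> ^ 4 = 1 \<and>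
       pullback (M\<restriction>U) (N\<restriction>V) \<psi> \<omega>' \<doteq>\<^bsub>M\<restriction>U\<^esub> (\<lambda>_. \<tau>\<^sup>2) \<odot> \<omega> \<and>
       pullback (M\<restriction>U) (N\<restriction>V) \<psi> \<omega>1' \<doteq>\<^bsub>M\<restriction>U\<^esub> (\<lambda>_. \<tau>) \<odot> \<omega>1 \<longrightarrow>
       (\<forall>x\<in>U. \<epsilon>' = \<epsilon> \<and> complex_of_real (T0' (\<psi> x)) = \<tau>\<^sup>2 * complex_of_real (T0 x) \<and>
          Complex (A' (\<psi> x)) (B' (\<psi> x)) = cnj \<tau> * Complex (A x) (B x) \<and>
          (if \<tau>\<^sup>2 = 1 then A1' (\<psi> x) = A1 x \<and> B1' (\<psi> x) = B1 x
           else A1' (\<psi> x) = Im (B1 x) \<and>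
                B1' (\<psi> x) = \<i> * complex_of_real (A1 x) - complex_of_real (Re (B1 x) + \<epsilon> / 2))))"
proof -
  note M = smooth_manifold_atlas[OF assms(1)] and N = smooth_manifold_atlas[OF assms(2)]
  note OM = oriented_congruence_submfd[OF M _ oriented_congruenceD[OF special_congruence_oriented]]
    and ON = oriented_congruence_submfd[OF N _ oriented_congruenceD[OF special_congruence_oriented]]
  show ?thesis
  proof (intro conjI[OF _ conjI[OF _ conjI[OF _ conjI[OF _ conjI]]]] allI, goal_cases)
    case (1 lam \<mu>)
    show ?case by (intro impI ballI, rule special_congruence_local[OF M])
  next
    case (2 lam \<mu> U \<epsilon> \<omega> \<omega>1 \<Omega> T0)
    show ?case
    proof (intro impI, elim conjE)
      assume a: "special_congruence M lam \<mu>" "openin (mtop M) U" "invariant_coframe (M\<restriction>U) lam \<mu> \<epsilon> \<omega>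
          \<omega>1 \<Omega> T0"
      note * = smooth_atlas_submfd[OF M a(2)] OM[OF a(2,1) a(1) a(1) a(1)] a(3)
      show "same_structure (M\<restriction>U) lam \<mu> \<omega> \<omega>1 \<and> (\<exists>A B A1 B1. \<Omega> \<doteq>\<^bsub>M\<restriction>U\<^esub> Omega_form \<omega> \<omega>1 A B \<and>
          invariant_system (M\<restriction>U) \<epsilon> \<omega> \<omega>1 A B T0 A1 B1)"
        by (intro conjI invariant_system_of_coframe[OF *])
    qed
  next
    case (3 \<epsilon> \<omega> \<omega>1 A B T0 A1 B1)
    show ?case by (intro impI conjI invariant_coframe_of_system_self[OF M])
  next
    case (4 lam \<mu>)
    show ?case by (rule special_congruence_iff[OF assms(1)])
  next
    case (5 lam \<mu> lam' \<mu>' U V \<psi> \<epsilon> \<omega> \<omega>1 \<Omega> T0 \<epsilon>' \<omega>' \<omega>1' \<Omega>' T0')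
    show ?case
    proof (intro impI, elim conjE)
      assume a: "special_congruence M lam \<mu>" "special_congruence N lam' \<mu>'"
        "openin (mtop M) U" "connectedin (mtop M) U" "openin (mtop N) V"
        "invariant_coframe (M\<restriction>U) lam \<mu> \<epsilon> \<omega> \<omega>1 \<Omega> T0" "invariant_coframe (N\<restriction>V) lam' \<mu>' \<epsilon>' \<omega>' \<omega>1' \<Omega>'
            T0'"
        "diffeomorphism (M\<restriction>U) (N\<restriction>V) \<psi>"
      have "connected_space (mtop (M\<restriction>U))" using a(4) by (simp add: connectedin_def)
      from cong_equivalence_iff[OF smooth_atlas_submfd[OF M a(3)] smooth_atlas_submfd[OF N a(5)]
          this
          OM[OF a(3,1) a(1) a(1) a(1)] ON[OF a(5,2) a(2) a(2) a(2)] a(6-8)]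
      show "cong_equivalence (M\<restriction>U) lam \<mu> (N\<restriction>V) lam' \<mu>' \<psi> \<longleftrightarrow>
        (\<exists>\<tau>::complex. \<tau> ^ 4 = 1 \<and>
           pullback (M\<restriction>U) (N\<restriction>V) \<psi> \<omega>' \<doteq>\<^bsub>M\<restriction>U\<^esub> (\<lambda>_. \<tau>\<^sup>2) \<odot> \<omega> \<and>
           pullback (M\<restriction>U) (N\<restriction>V) \<psi> \<omega>1' \<doteq>\<^bsub>M\<restriction>U\<^esub> (\<lambda>_. \<tau>) \<odot> \<omega>1)" .
    qed
  next
    case (6 U V \<psi> \<tau> \<epsilon> \<omega> \<omega>1 A B T0 A1 B1 \<epsilon>' \<omega>' \<omega>1' A' B' T0' A1' B1')
    show ?case
    proof (intro impI, elim conjE, intro ballI)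
      fix x
      assume a: "openin (mtop M) U" "openin (mtop N) V" "invariant_system (M\<restriction>U) \<epsilon> \<omega> \<omega>1 A B T0 A1 B1"
        "invariant_system (N\<restriction>V) \<epsilon>' \<omega>' \<omega>1' A' B' T0' A1' B1'" "diffeomorphism (M\<restriction>U) (N\<restriction>V) \<psi>" "\<tau> ^ 4 =
            1"
        "pullback (M\<restriction>U) (N\<restriction>V) \<psi> \<omega>' \<doteq>\<^bsub>M\<restriction>U\<^esub> (\<lambda>_. \<tau>\<^sup>2) \<odot> \<omega>"
        "pullback (M\<restriction>U) (N\<restriction>V) \<psi> \<omega>1' \<doteq>\<^bsub>M\<restriction>U\<^esub> (\<lambda>_. \<tau>) \<odot> \<omega>1" "x \<in> U"
      have x: "x \<in> points (M\<restriction>U)" using openin_subset[OF a(1)] a(9) by (auto simp: points_def)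
      note MU = smooth_atlas_submfd[OF M a(1)] and NV = smooth_atlas_submfd[OF N a(2)]
      show "\<epsilon>' = \<epsilon> \<and> complex_of_real (T0' (\<psi> x)) = \<tau>\<^sup>2 * complex_of_real (T0 x) \<and>
          Complex (A' (\<psi> x)) (B' (\<psi> x)) = cnj \<tau> * Complex (A x) (B x) \<and>
          (if \<tau>\<^sup>2 = 1 then A1' (\<psi> x) = A1 x \<and> B1' (\<psi> x) = B1 x
           else A1' (\<psi> x) = Im (B1 x) \<and>
                B1' (\<psi> x) = \<i> * complex_of_real (A1 x) - complex_of_real (Re (B1 x) + \<epsilon> / 2))"
        by (rule invariant_system_scalars[OF MU a(3) invariant_system_pullback[OF MU NV
            diffeomorphismD[OF a(5)] a(4)]
              a(6-8) x])
    qed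
  qed
qed

end
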